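(* Let $C=\operatorname{Spec}A_0$ be a smooth affine curve over $\mathbb{C}$ with function field $K_0=\operatorname{Frac}(A_0)$ and let $A:=A_0[D_+,D_-]\subseteq K_0[u,u^{-1}]$, where $D_\pm$ are $\mathbb{Q}$-divisors on $C$ satisfying $D_++D_-\le0$. Let $L$ be the field $L:=\operatorname{Frac}(A)[\sqrt[d]{tu^b}]$, where $t\in K_0$, $t\ne0$, and $b,d\in\mathbb{N}$, $d\geq 1$. If $A'$ is the normalization of $A$ in $L$, and $A'_0$ is its degree $0$ part, then the following hold. 1. $A_0'$ is the normalization of $A_0$ in $K_0[s]$ with $s:=\sqrt[k]{t}$, where $k:=\gcd(b,d)$. 2. $A'\cong A_0'[D_+',D_-']$ with $$D_\pm':=\frac{k}{d}\left(p^*(D_\pm)\pm\beta\operatorname{div}s\right),$$ where $p:C':=\operatorname{Spec}A_0'\to C$ is the projection and $\beta$ is an integer defined by $\beta b\equiv k\mod d$.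
   Context: For a $\mathbb{Q}$-divisor $D=\sum D(a)\,a$ on a smooth affine curve $C=\operatorname{Spec} A_0$, $\lfloor D\rfloor=\sum\lfloor D(a)\rfloor a$. For $\mathbb{Q}$-divisors with $D_++D_-\le0$, the normal graded $A_0$-algebra $A_0[D_+,D_-]=\bigoplus_{n\in\mathbb{Z}}A_n\subseteq\operatorname{Frac}(A_0)[u,u^{-1}]$ ($u$ an indeterminate of degree $1$) is defined by $A_n=H^0(C,\mathcal{O}_C(\lfloor nD_+\rfloor))\cdot u^n$ and $A_{-n}=H^0(C,\mathcal{O}_C(\lfloor nD_-\rfloor))\cdot u^{-n}$ for $n\ge0$; $A_0'[D_+',D_-']$ is defined in the same way over $A_0'$. Here $\sqrt[d]{tu^b}$ denotes a $d$-th root of $tu^b$ in an algebraic closure of $\operatorname{Frac}(A)$, and $\sqrt[k]{t}$ the $k$-th root $(\sqrt[d]{tu^b})^{d/k}u^{-b/k}\in L$ of $t$. The ring $A'$ carries a natural $\frac1d\mathbb{Z}$-grading extending the grading of $A$, in which $\sqrt[d]{tu^b}$ has degree $b/d$; $A'_0$ is its part of degree $0$. The case $b=0$ (where $\gcd(0,d)=d$) is allowed. *)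

theory Defs
  imports
    "HOL-Library.Poly_Mapping"
    "HOL-Number_Theory.Cong"
    "HOL-Algebra.QuotRing"
    "HOL-Algebra.Generated_Rings"
    "HOL-Algebra.Algebraic_Closure_Type"
begin

text \<open>
  Integral domains are represented as subsets \<open>R\<close> of a field type. The field type may be
  larger than the field of fractions of \<open>R\<close>.
\<close>

abbreviation ring_on :: "'a::comm_ring_1 set \<Rightarrow> 'a ring" where
  "ring_on R \<equiv> ring_of_type_algebra\<lparr>carrier := R\<rparr>"

definition frac_field :: "'a::field set \<Rightarrow> 'a set" where
  "frac_field R = {x / y | x y. x \<in> R \<and> y \<in> R \<and> y \<noteq> 0}"

definition adjoin :: "'a::field set \<Rightarrow> 'a \<Rightarrow> 'a set" where
  "adjoin R x = generate_ring ring_of_type_algebra (R \<union> {x})"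

definition normalization_in :: "'a::field set \<Rightarrow> 'a set \<Rightarrow> 'a set" where
  "normalization_in R L =
    {x \<in> L. \<exists>p :: 'a poly. Polynomial.lead_coeff p = 1 \<and>
       (\<forall>i. Polynomial.coeff p i \<in> R) \<and> poly p x = 0}"


section \<open>Smooth affine curves and orders of rational functions\<close>

definition closed_points :: "'a::field set \<Rightarrow> 'a set set" where
  "closed_points R = {P. maximalideal P (ring_on R)}"

definition local_ring :: "'a::field set \<Rightarrow> 'a set \<Rightarrow> 'a set" where
  "local_ring R P = {x / y | x y. x \<in> R \<and> y \<in> R - P}"

definition uniformizer :: "'a::field set \<Rightarrow> 'a set \<Rightarrow> 'a \<Rightarrow> bool" where
  "uniformizer R P \<pi> \<longleftrightarrow>
    {x / y | x y. x \<in> P \<and> y \<in> R - P} = {\<pi> * g | g. g \<in> local_ring R P}"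

text \<open>
  \<open>Spec R\<close> for a finitely generated \<open>\<complex>\<close>-algebra \<open>R\<close> (with structure map \<open>\<iota>\<close>) that is a domain of
  Krull dimension one. Over \<open>\<complex>\<close>, smoothness means that the local rings at the closed points are
  regular, i.e. that their maximal ideals are generated by as many elements as their dimension,
  which is one.
\<close>

definition smooth_affine_curve :: "(complex \<Rightarrow> 'a::field) \<Rightarrow> 'a set \<Rightarrow> bool" where
  "smooth_affine_curve \<iota> R \<longleftrightarrow>
     \<iota> \<in> ring_hom ring_of_type_algebra ring_of_type_algebra \<and>
     (\<exists>S. finite S \<and> R = generate_ring ring_of_type_algebra (range \<iota> \<union> S)) \<and>
     \<not> maximalideal {0} (ring_on R) \<and>
     (\<forall>P. primeideal P (ring_on R) \<longrightarrow> P \<noteq> {0} \<longrightarrow> maximalideal P (ring_on R)) \<and>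
     (\<forall>P\<in>closed_points R. \<exists>\<pi>. uniformizer R P \<pi>)"

text \<open>Only meaningful for \<open>f \<noteq> 0\<close> in the field of fractions of \<open>R\<close>.\<close>

definition ord_at :: "'a::field set \<Rightarrow> 'a set \<Rightarrow> 'a \<Rightarrow> int" where
  "ord_at R P f = (THE n. \<exists>\<pi> g. uniformizer R P \<pi> \<and>
     g \<in> local_ring R P \<and> g \<noteq> 0 \<and> inverse g \<in> local_ring R P \<and> f = \<pi> powi n * g)"


section \<open>Divisors with rational coefficients\<close>

definition qdivisor :: "'a::field set \<Rightarrow> ('a set \<Rightarrow> rat) \<Rightarrow> bool" where
  "qdivisor R D \<longleftrightarrow> finite {P. D P \<noteq> 0} \<and> {P. D P \<noteq> 0} \<subseteq> closed_points R"

definition principal_divisor :: "'a::field set \<Rightarrow> 'a \<Rightarrow> 'a set \<Rightarrow> rat" where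
  "principal_divisor R f P = (if P \<in> closed_points R then of_int (ord_at R P f) else 0)"

definition ramification_index ::
    "('a::field \<Rightarrow> 'b::field) \<Rightarrow> 'a set \<Rightarrow> 'b set \<Rightarrow> 'b set \<Rightarrow> int" where
  "ramification_index h R R' Q =
    (THE e. \<exists>\<pi>. uniformizer R {x \<in> R. h x \<in> Q} \<pi> \<and> e = ord_at R' Q (h \<pi>))"

text \<open>
  The pullback along the morphism \<open>Spec R' \<rightarrow> Spec R\<close> given by an embedding \<open>h\<close> of the function
  fields with \<open>h ` R \<subseteq> R'\<close>; it maps a closed point \<open>Q\<close> to \<open>{x \<in> R. h x \<in> Q}\<close>.
\<close>

definition pullback_divisor ::
    "('a::field \<Rightarrow> 'b::field) \<Rightarrow> 'a set \<Rightarrow> 'b set \<Rightarrow> ('a set \<Rightarrow> rat) \<Rightarrow> 'b set \<Rightarrow> rat" where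
  "pullback_divisor h R R' D Q =
    (if Q \<in> closed_points R'
     then of_int (ramification_index h R R' Q) * D {x \<in> R. h x \<in> Q} else 0)"

definition global_sections :: "'a::field set \<Rightarrow> ('a set \<Rightarrow> int) \<Rightarrow> 'a set" where
  "global_sections R E =
    {f \<in> frac_field R. f = 0 \<or> (\<forall>P\<in>closed_points R. 0 \<le> ord_at R P f + E P)}"


section \<open>The graded algebra of a pair of divisors\<close>

text \<open>
  The type \<open>int \<Rightarrow>\<^sub>0 'a\<close> is the ring of Laurent polynomials over \<open>'a\<close>; the indeterminate \<open>u\<close>
  is \<open>Poly_Mapping.single 1 1\<close>.
\<close>

definition dpd_coeffs ::
    "'a::field set \<Rightarrow> ('a set \<Rightarrow> rat) \<Rightarrow> ('a set \<Rightarrow> rat) \<Rightarrow> int \<Rightarrow> 'a set" where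
  "dpd_coeffs R Dp Dm n =
    (if n \<ge> 0 then global_sections R (\<lambda>P. \<lfloor>of_int n * Dp P\<rfloor>)
     else global_sections R (\<lambda>P. \<lfloor>of_int (- n) * Dm P\<rfloor>))"

definition dpd_algebra ::
    "'a::field set \<Rightarrow> ('a set \<Rightarrow> rat) \<Rightarrow> ('a set \<Rightarrow> rat) \<Rightarrow> (int \<Rightarrow>\<^sub>0 'a) set" where
  "dpd_algebra R Dp Dm = {p. \<forall>n. Poly_Mapping.lookup p n \<in> dpd_coeffs R Dp Dm n}"

definition dpd_part ::
    "'a::field set \<Rightarrow> ('a set \<Rightarrow> rat) \<Rightarrow> ('a set \<Rightarrow> rat) \<Rightarrow> int \<Rightarrow> (int \<Rightarrow>\<^sub>0 'a) set" where
  "dpd_part R Dp Dm n = Poly_Mapping.single n ` dpd_coeffs R Dp Dm n"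


section \<open>The algebraic closure of the field of rational functions in \<open>u\<close>\<close>

text \<open>
  If \<open>'k\<close> is the function field of the curve, then the field of fractions of a
  \<^const>\<open>dpd_algebra\<close> is the whole of \<open>(int \<Rightarrow>\<^sub>0 'k) fract\<close>.
\<close>

type_synonym 'k laurent_closure = "(int \<Rightarrow>\<^sub>0 'k) fract alg_closure"

definition laurent_emb :: "(int \<Rightarrow>\<^sub>0 'k::field) \<Rightarrow> 'k laurent_closure" where
  "laurent_emb p = to_ac (Fract p 1)"

definition const_emb :: "'k::field \<Rightarrow> 'k laurent_closure" where
  "const_emb c = laurent_emb (Poly_Mapping.single 0 c)"

definition u_var :: "'k::field laurent_closure" where
  "u_var = laurent_emb (Poly_Mapping.single 1 1)"

text \<open>
  Write \<open>K\<^sub>0\<close> for the field \<open>'k\<close>. For \<open>v\<close> with \<open>v ^ d = t * u ^ b\<close>, the ring \<open>K\<^sub>0[u, u\<^sup>-\<^sup>1, v, v\<^sup>-\<^sup>1]\<close> is graded by giving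
  \<open>K\<^sub>0\<close> degree \<open>0\<close>, \<open>u\<close> degree \<open>1\<close> and \<open>v\<close> degree \<open>b / d\<close>. Its part of degree \<open>q\<close> is the
  \<open>K\<^sub>0\<close>-span of the monomials of degree \<open>q\<close>. As \<open>v\<close> itself need not lie in the normalization \<open>B\<close>
  (\<open>t\<close> may have poles), the degrees on \<open>B\<close> are those induced from this larger ring.
\<close>

definition homogeneous_of_degree ::
    "'k::field laurent_closure \<Rightarrow> nat \<Rightarrow> nat \<Rightarrow> rat \<Rightarrow> 'k laurent_closure set" where
  "homogeneous_of_degree v b d q =
    module.span (\<lambda>c x. const_emb c * x)
      {u_var powi i * v powi j | i j. of_int i + of_int j * of_nat b / of_nat d = q}"

definition degree_part ::
    "'k::field laurent_closure set \<Rightarrow> 'k laurent_closure \<Rightarrow> nat \<Rightarrow> nat \<Rightarrow> rat \<Rightarrow>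
     'k laurent_closure set" where
  "degree_part B v b d q = B \<inter> homogeneous_of_degree v b d q"

end

theory Submission
  imports Defs "Jordan_Normal_Form.Char_Poly"
begin

text \<open>
  Let \<open>\<beta> b' + \<gamma> d' = 1\<close>, where \<open>b = k b'\<close> and \<open>d = k d'\<close>. The element \<open>w = v\<^sup>\<beta> u\<^sup>\<gamma>\<close> has degree \<open>k / d\<close> and
  satisfies \<open>w ^ d' = s\<^sup>\<beta> u\<close>, so that \<open>K\<^sub>0[u, u\<^sup>-\<^sup>1, v, v\<^sup>-\<^sup>1] = K[w, w\<^sup>-\<^sup>1]\<close> for the field \<open>K = K\<^sub>0[s]\<close>, over
  which \<open>w\<close> is transcendental. This ring is integrally closed, so it contains the normalization of \<open>A\<close>.

  The algebra \<open>A\<close> consists of the Laurent polynomials on which the monomial valuations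
  \<open>\<Sum> f\<^sub>n u\<^sup>n \<mapsto> min (ord\<^sub>P f\<^sub>n + n r)\<close> with \<open>r = D\<^sub>+(P)\<close> and \<open>r = - D\<^sub>-(P)\<close> are nonnegative. Their extensions to
  \<open>K[w, w\<^sup>-\<^sup>1]\<close> are the analogous valuations for \<open>D'\<^sub>\<plusminus>\<close>, so that integral elements satisfy the
  conditions that define \<open>A\<^sub>0'[D'\<^sub>+, D'\<^sub>-]\<close>. Conversely, a homogeneous element satisfying them is locally over \<open>C\<close>
  integral over \<open>A\<close>, because a power of it is a homogeneous element of \<open>A\<close> times a function integral over \<open>A\<^sub>0\<close>.

  That the integral closure \<open>A\<^sub>0'\<close> of \<open>A\<^sub>0\<close> in \<open>K\<close> is a finitely generated algebra follows from Kummer theory: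
  averaging over the conjugations \<open>s \<mapsto> \<zeta> s\<close> shows that it is a direct sum of fractional ideals of \<open>A\<^sub>0\<close>.
\<close>

section \<open>Subrings and ideals\<close>

text \<open>Both corrections in \<open>D'\<close> come from
  \<open>w ^ d' = s powi \<beta> * u\<close>: the \<open>d'\<close>-th power of
  \<open>f * w powi n\<close> is \<open>f ^ d' * s powi (\<beta> * n) * u powi n\<close>, so slopes
  over \<open>C\<close> are pulled back, shifted by \<beta> times the order of \<open>s\<close>, and
  divided by \<open>d' = d / k\<close>. The congruence for \<beta>, divided by \<open>k\<close>, is
  a Bezout relation; it makes the passage from monomials in \<open>u, v\<close> to monomials in
  \<open>s, w\<close> invertible over the integers, also for \<open>b = 0\<close>. Three obstacles
  shape the proof. \<open>T ^ k - t\<close> may be reducible, so the degree of \<open>K\<close> is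
  not \<open>k\<close> but the least exponent for which the power of \<open>s\<close> falls into
  \<open>K\<^sub>0\<close>. The valuations are defined on Laurent polynomials, whereas
  \<open>A'\<close> consists a priori of elements of the field \<open>L\<close>; this is why
  integral closedness of the Laurent ring is needed. Finally, a divisor on an affine curve need not
  have a principal multiple, so no single homogeneous element of \<open>A\<close> can serve as a
  comparison everywhere; the converse inclusion is proved at each point of \<open>C\<close> and
  glued by an ideal of denominators.\<close>

definition is_subring :: "'a::comm_ring_1 set \<Rightarrow> bool" where
  "is_subring R \<longleftrightarrow> 1 \<in> R \<and> (\<forall>x\<in>R. \<forall>y\<in>R. x - y \<in> R \<and> x * y \<in> R)"

text \<open>Predicates on plain subsets keep the arithmetic of the type available;
  \<open>ideal_ring_on\<close>, \<open>maximalideal_ring_on\<close> and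
  \<open>primeideal_ring_on\<close> translate to the locales in which curves are defined. Negation
  is multiplication by \<open>-1\<close>.\<close>

definition is_ideal :: "'a::comm_ring_1 set \<Rightarrow> 'a set \<Rightarrow> bool" where
  "is_ideal R I \<longleftrightarrow> I \<subseteq> R \<and> 0 \<in> I \<and> (\<forall>x\<in>I. \<forall>y\<in>I. x + y \<in> I) \<and> (\<forall>r\<in>R. \<forall>x\<in>I. r * x \<in> I)"

lemma is_idealD:
  assumes "is_ideal R I"
  shows "I \<subseteq> R" "0 \<in> I" "x \<in> I \<Longrightarrow> y \<in> I \<Longrightarrow> x + y \<in> I" "r \<in> R \<Longrightarrow> x \<in> I \<Longrightarrow> r * x \<in> I"
    "r \<in> R \<Longrightarrow> x \<in> I \<Longrightarrow> x * r \<in> I"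
  using assms by (auto simp: is_ideal_def mult.commute)

context
  fixes R :: "'a::comm_ring_1 set"
  assumes R: "is_subring R"
begin

lemma subring_1: "1 \<in> R"
  and subring_diff: "x \<in> R \<Longrightarrow> y \<in> R \<Longrightarrow> x - y \<in> R"
  and subring_mult: "x \<in> R \<Longrightarrow> y \<in> R \<Longrightarrow> x * y \<in> R"
  using R by (auto simp: is_subring_def)

lemma subring_0: "0 \<in> R"
  using subring_diff[OF subring_1 subring_1] by simp

lemma subring_uminus: "x \<in> R \<Longrightarrow> - x \<in> R"
  using subring_diff[OF subring_0] by force

lemma subring_add: "x \<in> R \<Longrightarrow> y \<in> R \<Longrightarrow> x + y \<in> R"
  using subring_diff[OF _ subring_uminus, of x y] by simp

lemma subring_sum: "(\<And>i. i \<in> I \<Longrightarrow> f i \<in> R) \<Longrightarrow> (\<Sum>i\<in>I. f i) \<in> R"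
  by (induction I rule: infinite_finite_induct) (auto intro: subring_0 subring_add)

lemma subring_prod: "(\<And>i. i \<in> I \<Longrightarrow> f i \<in> R) \<Longrightarrow> (\<Prod>i\<in>I. f i) \<in> R"
  by (induction I rule: infinite_finite_induct) (auto intro: subring_1 subring_mult)

lemma subring_power: "x \<in> R \<Longrightarrow> x ^ n \<in> R"
  by (induction n) (auto intro: subring_1 subring_mult)

lemmas subring_intros =
  subring_0 subring_1 subring_add subring_mult subring_diff subring_uminus
  subring_sum subring_prod subring_power

lemma cring_ring_on: "cring (ring_on R)"
proof -
  interpret cring "ring_of_type_algebra :: 'a ring" by (rule cring_from_type_algebra)
  have neg: "\<ominus>\<^bsub>ring_of_type_algebra\<^esub> x = - x" for x :: 'a
    by (rule sum_zero_eq_neg[symmetric]) (auto simp: ring_of_type_algebra_def)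
  have "subcring R (ring_of_type_algebra :: 'a ring)"
    by (rule subcringI', rule subringI)
       (auto simp: neg, auto simp: ring_of_type_algebra_def intro: subring_intros)
  thus ?thesis
    by (subst (asm) subcring_iff) (auto simp: ring_of_type_algebra_def)
qed

lemma ideal_ring_on: "ideal I (ring_on R) \<longleftrightarrow> is_ideal R I"
proof -
  have a_inv: "a_inv (ring_on R) x = - x" if "x \<in> R" for x
  proof -
    interpret cring "ring_on R" by (rule cring_ring_on)
    show ?thesis
      by (rule sum_zero_eq_neg[symmetric])
         (use that in \<open>auto simp: ring_of_type_algebra_def intro!: subring_intros\<close>)
  qed
  show ?thesis
  proof
    assume "ideal I (ring_on R)"
    then interpret ideal I "ring_on R" .
    show "is_ideal R I"
      unfolding is_ideal_def
      using a_subset additive_subgroup.zero_closed[OF additive_subgroup_axioms]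
        additive_subgroup.a_closed[OF additive_subgroup_axioms] I_l_closed
      by (auto simp: ring_of_type_algebra_def)
  next
    assume I: "is_ideal R I"
    have neg: "- x \<in> I" if "x \<in> I" for x
    proof -
      have "(-1) * x \<in> I"
        using I that subring_uminus[OF subring_1] unfolding is_ideal_def by blast
      thus ?thesis by simp
    qed
    show "ideal I (ring_on R)"
      using is_idealD[OF I] neg a_inv
      by (intro idealI cring.axioms cring_ring_on group.subgroupI abelian_group.a_group ring.is_abelian_group)
         (auto simp: ring_of_type_algebra_def a_inv_def)
  qed
qed

end

section \<open>Maximal and prime ideals\<close>

definition is_maximal :: "'a::comm_ring_1 set \<Rightarrow> 'a set \<Rightarrow> bool" where
  "is_maximal R P \<longleftrightarrow> is_ideal R P \<and> 1 \<notin> P \<and> (\<forall>J. is_ideal R J \<longrightarrow> P \<subseteq> J \<longrightarrow> 1 \<notin> J \<longrightarrow> J = P)"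

definition is_prime :: "'a::comm_ring_1 set \<Rightarrow> 'a set \<Rightarrow> bool" where
  "is_prime R P \<longleftrightarrow> is_ideal R P \<and> 1 \<notin> P \<and> (\<forall>x\<in>R. \<forall>y\<in>R. x * y \<in> P \<longrightarrow> x \<in> P \<or> y \<in> P)"

lemma ideal_1_iff: "is_ideal R J \<Longrightarrow> is_subring R \<Longrightarrow> 1 \<in> J \<longleftrightarrow> J = R"
  unfolding is_ideal_def by (metis mult.right_neutral subring_1 subset_antisym subsetI)

lemma maximalideal_ring_on:
  assumes "is_subring R"
  shows "maximalideal P (ring_on R) \<longleftrightarrow> is_maximal R P"
  using assms unfolding is_maximal_def maximalideal_def maximalideal_axioms_def
  by (auto simp: ideal_ring_on ideal_1_iff) (auto simp: is_ideal_def)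

lemma primeideal_ring_on:
  assumes "is_subring R"
  shows "primeideal P (ring_on R) \<longleftrightarrow> is_prime R P"
proof -
  have [simp]: "carrier (ring_on R) = R" "mult (ring_on R) = (*)"
    by (simp_all add: ring_of_type_algebra_def)
  show ?thesis
    using cring_ring_on[OF assms] ideal_1_iff[OF _ assms, of P]
    unfolding is_prime_def primeideal_def primeideal_axioms_def ideal_ring_on[OF assms] by auto
qed

lemma closed_points_iff: "is_subring R \<Longrightarrow> P \<in> closed_points R \<longleftrightarrow> is_maximal R P"
  by (simp add: closed_points_def maximalideal_ring_on)

lemma ideal_uminus: "is_ideal R I \<Longrightarrow> is_subring R \<Longrightarrow> x \<in> I \<Longrightarrow> - x \<in> I"
  using is_idealD(4)[of R I "-1" x] subring_uminus[OF _ subring_1] by force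

text \<open>If \<open>y\<close> is outside \<open>P\<close>, then \<open>P + R y\<close> contains
  \<open>1 = p + r * y\<close>, and multiplying by \<open>x\<close> writes \<open>x\<close> as
  \<open>x * p + r * (x * y)\<close>.\<close>

lemma maximal_imp_prime:
  assumes R: "is_subring R" and P: "is_maximal R P"
  shows "is_prime R P"
  unfolding is_prime_def
proof (intro conjI ballI impI)
  show I: "is_ideal R P" and "1 \<notin> P" using P by (auto simp: is_maximal_def)
  fix x y assume xy: "x \<in> R" "y \<in> R" "x * y \<in> P"
  show "x \<in> P \<or> y \<in> P"
  proof (rule disjCI)
    assume y: "y \<notin> P"
    define J where "J = {p + r * y | p r. p \<in> P \<and> r \<in> R}"
    have PR: "p \<in> R" if "p \<in> P" for p using is_idealD(1)[OF I] that by blast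
    have "is_ideal R J" unfolding is_ideal_def
    proof (intro conjI ballI)
      show "J \<subseteq> R" by (auto simp: J_def intro!: subring_add[OF R] subring_mult[OF R] xy dest: PR)
      show "0 \<in> J" unfolding J_def
        by (rule CollectI) (rule exI[of _ 0], rule exI[of _ 0], auto intro: is_idealD[OF I] subring_0[OF R])
    next
      fix a b assume "a \<in> J" "b \<in> J"
      then obtain p r p' r' where *: "a = p + r * y" "b = p' + r' * y" "p \<in> P" "p' \<in> P" "r \<in> R" "r' \<in> R"
        by (auto simp: J_def)
      hence "a + b = (p + p') + (r + r') * y" by (simp add: algebra_simps)
      moreover have "p + p' \<in> P" "r + r' \<in> R"
        using * by (auto intro: is_idealD(3)[OF I] subring_add[OF R])
      ultimately show "a + b \<in> J" unfolding J_def by blast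
    next
      fix c a assume "c \<in> R" "a \<in> J"
      then obtain p r where *: "a = p + r * y" "p \<in> P" "r \<in> R" by (auto simp: J_def)
      hence "c * a = c * p + (c * r) * y" by (simp add: algebra_simps)
      moreover have "c * p \<in> P" "c * r \<in> R"
        using * \<open>c \<in> R\<close> by (auto intro: is_idealD(4)[OF I] subring_mult[OF R])
      ultimately show "c * a \<in> J" unfolding J_def by blast
    qed
    moreover have "P \<subseteq> J"
    proof
      fix p assume "p \<in> P"
      thus "p \<in> J" unfolding J_def
        by (intro CollectI exI[of _ p] exI[of _ 0]) (auto intro: subring_0[OF R])
    qed
    moreover have "y \<in> J" unfolding J_def
      by (intro CollectI exI[of _ 0] exI[of _ 1]) (auto intro: subring_1[OF R] is_idealD(2)[OF I])
    ultimately have "1 \<in> J" using P y unfolding is_maximal_def by blast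
    then obtain p r where "1 = p + r * y" "p \<in> P" "r \<in> R" by (auto simp: J_def)
    hence "x = x * p + r * (x * y)" by (metis distrib_left mult.left_commute mult.right_neutral)
    moreover have "x * p + r * (x * y) \<in> P"
      by (rule is_idealD(3)[OF I is_idealD(4)[OF I xy(1) \<open>p \<in> P\<close>] is_idealD(4)[OF I \<open>r \<in> R\<close> xy(3)]])
    ultimately show "x \<in> P" by simp
  qed
qed

section \<open>Subrings generated by a set\<close>

lemma generate_ring_subring: "is_subring (generate_ring ring_of_type_algebra H)"
  unfolding is_subring_def
proof (intro conjI ballI)
  let ?G = "ring_of_type_algebra :: 'a ring"
  interpret cring ?G by (rule cring_from_type_algebra)
  have neg: "a_inv ?G x = - x" for x
    by (rule sum_zero_eq_neg[symmetric]) (auto simp: ring_of_type_algebra_def)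
  show "1 \<in> generate_ring ?G H"
    using generate_ring.one[of ?G H] by (simp add: ring_of_type_algebra_def)
  fix x y assume *: "x \<in> generate_ring ?G H" "y \<in> generate_ring ?G H"
  show "x * y \<in> generate_ring ?G H"
    using generate_ring.eng_mult[OF *] by (simp add: ring_of_type_algebra_def)
  show "x - y \<in> generate_ring ?G H"
    using generate_ring.eng_add[OF *(1) generate_ring.a_inv[OF *(2)]] neg[of y]
    by (simp add: ring_of_type_algebra_def)
qed

lemma generate_ring_incl: "H \<subseteq> generate_ring ring_of_type_algebra H"
  by (auto intro: generate_ring.incl)

lemma generate_ring_least:
  assumes E: "is_subring E" and "H \<subseteq> E"
  shows "generate_ring ring_of_type_algebra H \<subseteq> (E :: 'a::comm_ring_1 set)"
proof
  let ?G = "ring_of_type_algebra :: 'a ring"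
  interpret cring ?G by (rule cring_from_type_algebra)
  have neg: "a_inv ?G x = - x" for x
    by (rule sum_zero_eq_neg[symmetric]) (auto simp: ring_of_type_algebra_def)
  fix x assume "x \<in> generate_ring ?G H"
  thus "x \<in> E"
  proof induction
    case (a_inv h) thus ?case using neg[of h] subring_uminus[OF E] by simp
  qed (use assms in \<open>auto simp: ring_of_type_algebra_def intro: subring_intros[OF E]\<close>)
qed

text \<open>Allows generators to be adjoined one at a time, each step being a passage to
  \<open>polys_at\<close>.\<close>

lemma generate_ring_insert_subset:
  fixes x :: "'a::comm_ring_1"
  shows "generate_ring ring_of_type_algebra (insert x H) =
   generate_ring ring_of_type_algebra (insert x (generate_ring ring_of_type_algebra H))"
  (is "?L = ?R")
proof
  show "?L \<subseteq> ?R"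
    by (rule generate_ring_least[OF generate_ring_subring])
       (use generate_ring_incl[of "insert x (generate_ring ring_of_type_algebra H)"] generate_ring_incl[of H] in auto)
  show "?R \<subseteq> ?L"
    by (rule generate_ring_least[OF generate_ring_subring])
       (use generate_ring_incl[of "insert x H"] generate_ring_least[OF generate_ring_subring, of H "insert x H"] in auto)
qed

section \<open>Integral elements\<close>

definition poly_over :: "'a::comm_ring_1 set \<Rightarrow> 'a poly \<Rightarrow> bool" where
  "poly_over R p \<longleftrightarrow> (\<forall>i. coeff p i \<in> R)"

definition integral_over :: "'a::comm_ring_1 set \<Rightarrow> 'a \<Rightarrow> bool" where
  "integral_over R x \<longleftrightarrow> (\<exists>p. lead_coeff p = 1 \<and> poly_over R p \<and> poly p x = 0)"

lemma normalization_in_eq: "normalization_in R L = {x \<in> L. integral_over R x}"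
  by (simp add: normalization_in_def integral_over_def poly_over_def)

lemma integral_over_mono: "R \<subseteq> S \<Longrightarrow> integral_over R x \<Longrightarrow> integral_over S x"
  unfolding integral_over_def poly_over_def by blast

text \<open>The ring \<open>R[x]\<close>, realised inside the ambient type.\<close>

definition polys_at :: "'a::comm_ring_1 set \<Rightarrow> 'a \<Rightarrow> 'a set" where
  "polys_at R x = {poly p x | p. poly_over R p}"

text \<open>Coefficients are indexed by the generators themselves. Intended for finite
  \<open>W\<close>: sums over infinite sets are \<open>0\<close>.\<close>

definition lspan :: "'a::comm_ring_1 set \<Rightarrow> 'a set \<Rightarrow> 'a set" where
  "lspan R W = {\<Sum>w\<in>W. c w * w | c. \<forall>w\<in>W. c w \<in> R}"

definition module_finite :: "'a::comm_ring_1 set \<Rightarrow> 'a set \<Rightarrow> bool" where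
  "module_finite R S \<longleftrightarrow> is_subring S \<and> R \<subseteq> S \<and> (\<exists>W. finite W \<and> S = lspan R W)"

context
  fixes R :: "'a::comm_ring_1 set"
  assumes R: "is_subring R"
begin

lemma poly_over_0: "poly_over R 0"
  and poly_over_1: "poly_over R 1"
  and poly_over_pCons: "poly_over R (pCons a p) \<longleftrightarrow> a \<in> R \<and> poly_over R p"
  and poly_over_monom: "c \<in> R \<Longrightarrow> poly_over R (monom c n)"
  and poly_over_add: "poly_over R p \<Longrightarrow> poly_over R q \<Longrightarrow> poly_over R (p + q)"
  and poly_over_diff: "poly_over R p \<Longrightarrow> poly_over R q \<Longrightarrow> poly_over R (p - q)"
  and poly_over_uminus: "poly_over R p \<Longrightarrow> poly_over R (- p)"
  and poly_over_smult: "c \<in> R \<Longrightarrow> poly_over R p \<Longrightarrow> poly_over R (smult c p)"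
  and poly_over_mult: "poly_over R p \<Longrightarrow> poly_over R q \<Longrightarrow> poly_over R (p * q)"
  by (auto simp: poly_over_def coeff_pCons coeff_mult coeff_1 split: nat.splits
      intro!: subring_intros[OF R])

lemma poly_over_sum: "(\<And>i. i \<in> I \<Longrightarrow> poly_over R (f i)) \<Longrightarrow> poly_over R (\<Sum>i\<in>I. f i)"
  by (induction I rule: infinite_finite_induct) (auto intro: poly_over_0 poly_over_add)

lemma poly_over_prod: "(\<And>i. i \<in> I \<Longrightarrow> poly_over R (f i)) \<Longrightarrow> poly_over R (\<Prod>i\<in>I. f i)"
  by (induction I rule: infinite_finite_induct) (auto intro: poly_over_1 poly_over_mult)

lemma poly_in_subring: "poly_over R p \<Longrightarrow> x \<in> R \<Longrightarrow> poly p x \<in> R"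
  unfolding poly_altdef by (intro subring_intros[OF R]) (auto simp: poly_over_def)

lemma polys_at_subring: "is_subring (polys_at R x)"
  unfolding is_subring_def
proof (intro conjI ballI)
  show "1 \<in> polys_at R x" unfolding polys_at_def
    by (intro CollectI exI[of _ 1]) (simp add: poly_over_1)
  fix a b assume "a \<in> polys_at R x" "b \<in> polys_at R x"
  then obtain p q where *: "a = poly p x" "b = poly q x" "poly_over R p" "poly_over R q"
    by (auto simp: polys_at_def)
  show "a - b \<in> polys_at R x" unfolding polys_at_def
    by (intro CollectI exI[of _ "p - q"]) (simp add: * poly_over_diff)
  show "a * b \<in> polys_at R x" unfolding polys_at_def
    by (intro CollectI exI[of _ "p * q"]) (simp add: * poly_over_mult)
qed

lemma polys_at_incl: "R \<subseteq> polys_at R x"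
proof
  fix a assume "a \<in> R"
  thus "a \<in> polys_at R x" unfolding polys_at_def
    by (intro CollectI exI[of _ "[:a:]"]) (simp add: poly_over_pCons poly_over_0)
qed

lemma polys_at_gen: "x \<in> polys_at R x"
  unfolding polys_at_def
  by (intro CollectI exI[of _ "[:0,1:]"]) (simp add: poly_over_pCons poly_over_0 subring_0[OF R] subring_1[OF R])

lemma polys_at_least:
  assumes "is_subring S" "R \<subseteq> S" "x \<in> S"
  shows "polys_at R x \<subseteq> S"
  using assms by (auto simp: polys_at_def poly_over_def poly_altdef intro!: subring_sum subring_mult subring_power)

lemma generate_ring_eq_polys_at:
  "generate_ring ring_of_type_algebra (insert x R) = polys_at R x"
proof
  show "generate_ring ring_of_type_algebra (insert x R) \<subseteq> polys_at R x"
    by (rule generate_ring_least[OF polys_at_subring]) (use polys_at_incl polys_at_gen in auto)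
  show "polys_at R x \<subseteq> generate_ring ring_of_type_algebra (insert x R)"
    by (rule polys_at_least[OF generate_ring_subring]) (use generate_ring_incl[of "insert x R"] in auto)
qed


section \<open>Spans and finite ring extensions\<close>

lemma lspan_0: "0 \<in> lspan R W"
  unfolding lspan_def by (intro CollectI exI[of _ "\<lambda>_. 0"]) (simp add: subring_0[OF R])

lemma lspan_add: "x \<in> lspan R W \<Longrightarrow> y \<in> lspan R W \<Longrightarrow> x + y \<in> lspan R W"
  unfolding lspan_def
proof clarify
  fix c c' assume "\<forall>w\<in>W. c w \<in> R" "\<forall>w\<in>W. c' w \<in> R"
  thus "\<exists>d. (\<Sum>w\<in>W. c w * w) + (\<Sum>w\<in>W. c' w * w) = (\<Sum>w\<in>W. d w * w) \<and> (\<forall>w\<in>W. d w \<in> R)"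
    by (intro exI[of _ "\<lambda>w. c w + c' w"]) (auto simp: sum.distrib algebra_simps intro: subring_add[OF R])
qed

lemma lspan_scale: "r \<in> R \<Longrightarrow> x \<in> lspan R W \<Longrightarrow> r * x \<in> lspan R W"
  unfolding lspan_def
proof clarify
  fix c assume "\<forall>w\<in>W. c w \<in> R" "r \<in> R"
  thus "\<exists>d. r * (\<Sum>w\<in>W. c w * w) = (\<Sum>w\<in>W. d w * w) \<and> (\<forall>w\<in>W. d w \<in> R)"
    by (intro exI[of _ "\<lambda>w. r * c w"]) (auto simp: sum_distrib_left mult.assoc intro: subring_mult[OF R])
qed

lemma lspan_sum: "(\<And>i. i \<in> A \<Longrightarrow> f i \<in> lspan R W) \<Longrightarrow> (\<Sum>i\<in>A. f i) \<in> lspan R W"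
  by (induction A rule: infinite_finite_induct) (auto intro: lspan_0 lspan_add)

lemma lspan_gen: "finite W \<Longrightarrow> w \<in> W \<Longrightarrow> w \<in> lspan R W"
  unfolding lspan_def
proof (intro CollectI exI conjI)
  assume "finite W" "w \<in> W"
  thus "w = (\<Sum>v\<in>W. (if v = w then 1 else 0) * v)"
    by (simp add: if_distrib[of "\<lambda>x. x * _"] cong: if_cong)
qed (auto intro: subring_0[OF R] subring_1[OF R])

lemma lspan_least:
  assumes "0 \<in> M" "\<And>x y. x \<in> M \<Longrightarrow> y \<in> M \<Longrightarrow> x + y \<in> M" "\<And>r x. r \<in> R \<Longrightarrow> x \<in> M \<Longrightarrow> r * x \<in> M"
    and "W \<subseteq> M"
  shows "lspan R W \<subseteq> M"
proof
  fix x assume "x \<in> lspan R W"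
  then obtain c where c: "x = (\<Sum>w\<in>W. c w * w)" "\<forall>w\<in>W. c w \<in> R" by (auto simp: lspan_def)
  have "(\<Sum>w\<in>V. c w * w) \<in> M" if "V \<subseteq> W" for V
    using that
  proof (induction V rule: infinite_finite_induct)
    case (insert w V)
    have "c w * w \<in> M" using insert.prems c(2) assms(4) by (intro assms(3)) auto
    thus ?case using insert by (auto intro: assms(2))
  qed (use assms(1) in auto)
  thus "x \<in> M" using c(1) by blast
qed

lemma module_finite_refl: "module_finite R R"
  unfolding module_finite_def
proof (intro conjI exI[of _ "{1}"])
  show "R = lspan R {1}" by (auto simp: lspan_def)
qed (auto simp: R)

text \<open>A monic equation of degree \<open>n\<close> rewrites \<open>x ^ n\<close> through lower
  powers, so the span \<open>M\<close> of the powers below \<open>n\<close> is closed under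
  multiplication by \<open>x\<close>.\<close>

lemma module_finite_polys_at:
  assumes "integral_over R x"
  shows "module_finite R (polys_at R x)"
proof -
  from assms obtain p where p: "lead_coeff p = 1" "poly_over R p" "poly p x = 0"
    by (auto simp: integral_over_def)
  define n where "n = degree p"
  define M where "M = lspan R ((\<lambda>j. x ^ j) ` {..<n})"
  have pow: "x ^ j \<in> M" if "j < n" for j
    unfolding M_def by (rule lspan_gen) (use that in auto)
  have "(\<Sum>i<n. coeff p i * x ^ i) + x ^ n = (\<Sum>i\<le>n. coeff p i * x ^ i)"
    using p(1) by (simp add: n_def lessThan_Suc_atMost[symmetric])
  also have "\<dots> = 0" using p(3) by (simp add: poly_altdef n_def)
  finally have "x ^ n = - (\<Sum>i<n. coeff p i * x ^ i)"
    by (metis add.commute eq_neg_iff_add_eq_0)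
  also have "\<dots> = (\<Sum>i<n. (- coeff p i) * x ^ i)"
    by (simp add: sum_negf)
  also have "\<dots> \<in> M" unfolding M_def
    by (intro lspan_sum lspan_scale lspan_gen subring_uminus[OF R])
       (use p(2) in \<open>auto simp: poly_over_def\<close>)
  finally have pow_n: "x ^ n \<in> M" .
  have closed: "x * m \<in> M" if "m \<in> M" for m
  proof -
    have "M \<subseteq> {m. x * m \<in> M}" unfolding M_def
    proof (rule lspan_least)
      show "(\<lambda>j. x ^ j) ` {..<n} \<subseteq> {m. x * m \<in> lspan R ((\<lambda>j. x ^ j) ` {..<n})}"
      proof clarify
        fix j assume "j < n"
        hence "Suc j < n \<or> Suc j = n" by auto
        hence "x ^ Suc j \<in> M" using pow pow_n by metis
        thus "x * x ^ j \<in> lspan R ((\<lambda>j. x ^ j) ` {..<n})" by (simp add: M_def)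
      qed
    qed (auto simp: distrib_left lspan_0 lspan_add lspan_scale mult.left_commute[of x])
    thus ?thesis using that by blast
  qed
  \<comment> \<open>For \<open>n = 0\<close> no power lies below \<open>n\<close>, but then
    \<open>x ^ n\<close> is \<open>1\<close> itself.\<close>
  have one: "1 \<in> M"
  proof (cases "n = 0")
    case True
    thus ?thesis using pow_n by simp
  next
    case False
    thus ?thesis using pow[of 0] by simp
  qed
  have "poly q x \<in> M" if "poly_over R q" for q
    using that
  proof (induction q)
    case 0
    thus ?case by (simp add: M_def lspan_0)
  next
    case (pCons a q)
    have "poly q x \<in> M" "a \<in> R" using pCons by (auto simp: poly_over_pCons)
    hence "x * poly q x \<in> M" "a * 1 \<in> M"
      using closed one unfolding M_def by (auto intro: lspan_scale simp del: mult_1_right)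
    hence "a * 1 + x * poly q x \<in> M" unfolding M_def by (intro lspan_add)
    thus ?case by simp
  qed
  moreover have "M \<subseteq> polys_at R x"
    unfolding M_def
    by (rule lspan_least)
       (use polys_at_incl polys_at_gen in \<open>auto intro: subring_intros[OF polys_at_subring]\<close>)
  ultimately have "polys_at R x = M" by (auto simp: polys_at_def)
  thus ?thesis
    unfolding module_finite_def M_def using polys_at_subring polys_at_incl by blast
qed

end

lemma adjoin_eq_polys_at: "is_subring R \<Longrightarrow> adjoin R x = polys_at R x"
  by (simp add: adjoin_def generate_ring_eq_polys_at)

text \<open>The products of generators of the two stages generate the whole extension.\<close>

lemma module_finite_trans:
  assumes R: "is_subring R" and RS: "module_finite R S" and ST: "module_finite S T"
  shows "module_finite R T"
proof -
  obtain W where W: "finite W" "S = lspan R W" and S: "is_subring S" "R \<subseteq> S"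
    using RS by (auto simp: module_finite_def)
  obtain V where V: "finite V" "T = lspan S V" and T: "is_subring T" "S \<subseteq> T"
    using ST by (auto simp: module_finite_def)
  define U where "U = (\<lambda>(w, v). w * v) ` (W \<times> V)"
  have fin: "finite U" using W V by (auto simp: U_def)
  have "lspan R U \<subseteq> T"
  proof (rule lspan_least[OF R])
    have "w * v \<in> T" if "w \<in> W" "v \<in> V" for w v
    proof -
      have "w \<in> T" using lspan_gen[OF R W(1) that(1)] W(2) T(2) by auto
      moreover have "v \<in> T" using lspan_gen[OF S(1) V(1) that(2)] V(2) by auto
      ultimately show ?thesis by (rule subring_mult[OF T(1)])
    qed
    thus "U \<subseteq> T" by (auto simp: U_def)
  qed (use S T in \<open>auto intro!: subring_intros[OF T(1)]\<close>)
  moreover have "T \<subseteq> lspan R U"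
  proof
    fix x assume "x \<in> T"
    then obtain c where c: "x = (\<Sum>v\<in>V. c v * v)" "\<forall>v\<in>V. c v \<in> S"
      by (auto simp: V(2) lspan_def)
    have "s * v \<in> lspan R U" if "v \<in> V" "s \<in> S" for s v
    proof -
      have "lspan R W \<subseteq> {s. s * v \<in> lspan R U}"
      proof (rule lspan_least[OF R])
        show "W \<subseteq> {s. s * v \<in> lspan R U}"
          using that fin by (auto simp: U_def intro!: lspan_gen[OF R])
      qed (auto simp: distrib_right mult.assoc intro: lspan_0[OF R] lspan_add[OF R] lspan_scale[OF R])
      thus ?thesis using that W(2) by auto
    qed
    thus "x \<in> lspan R U" using c by (auto intro!: lspan_sum[OF R])
  qed
  ultimately show ?thesis
    unfolding module_finite_def using T S fin by blast
qed

text \<open>Cayley-Hamilton: multiplication by \<open>z\<close> acts on the generators by a matrix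
  over \<open>R\<close>, the vector of generators is an eigenvector for \<open>z\<close>, and
  \<open>z\<close> is a root of the monic characteristic polynomial. The vector is nonzero because
  \<open>1\<close> lies in its span.\<close>

lemma module_finite_imp_integral:
  fixes R :: "'a::field set"
  assumes R: "is_subring R" and S: "module_finite R S" and z: "z \<in> S"
  shows "integral_over R z"
proof -
  obtain W where W: "finite W" "S = lspan R W" and S': "is_subring S" "R \<subseteq> S"
    using S by (auto simp: module_finite_def)
  obtain f where f: "bij_betw f {0..<card W} W"
    using ex_bij_betw_nat_finite[OF W(1)] by blast
  define n where "n = card W"
  have "\<exists>c. z * w = (\<Sum>v\<in>W. c v * v) \<and> (\<forall>v\<in>W. c v \<in> R)" if "w \<in> W" for w
  proof -
    have "z * w \<in> S"
      using lspan_gen[OF R W(1) that] W(2) z subring_mult[OF S'(1)] by auto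
    thus ?thesis by (auto simp: W(2) lspan_def)
  qed
  then obtain c where c: "\<And>w. w \<in> W \<Longrightarrow> z * w = (\<Sum>v\<in>W. c w v * v)"
    "\<And>w v. w \<in> W \<Longrightarrow> v \<in> W \<Longrightarrow> c w v \<in> R" by metis
  have fW: "f i \<in> W" if "i < n" for i using f that by (auto simp: bij_betw_def n_def)
  define A where "A = mat n n (\<lambda>(i, j). c (f i) (f j))"
  have A: "A \<in> carrier_mat n n" by (simp add: A_def)
  have "eigenvector A (vec n f) z"
    unfolding eigenvector_def
  proof (intro conjI)
    show "vec n f \<in> carrier_vec (dim_row A)" by (simp add: A_def)
    show "vec n f \<noteq> 0\<^sub>v (dim_row A)"
    proof
      assume "vec n f = 0\<^sub>v (dim_row A)"
      hence *: "f i = 0" if "i < n" for i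
        using that by (metis A_def dim_row_mat(1) index_vec index_zero_vec(1))
      have "w = 0" if "w \<in> W" for w
        using f that * by (auto simp: bij_betw_def n_def)
      moreover have "1 \<in> lspan R W" using subring_1[OF S'(1)] W(2) by simp
      ultimately obtain c where "1 = (\<Sum>w\<in>W. c w * w)" and "\<And>w. w \<in> W \<Longrightarrow> w = 0"
        by (auto simp: lspan_def)
      moreover from this have "(\<Sum>w\<in>W. c w * w) = 0" by (intro sum.neutral) auto
      ultimately have "(1::'a) = 0" by simp
      thus False by simp
    qed
    show "A *\<^sub>v vec n f = z \<cdot>\<^sub>v vec n f"
    proof (rule eq_vecI)
      fix i assume "i < dim_vec (z \<cdot>\<^sub>v vec n f)"
      hence i: "i < n" by simp
      have "(A *\<^sub>v vec n f) $ i = (\<Sum>j\<in>{0..<n}. c (f i) (f j) * f j)"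
        using i by (simp add: A_def scalar_prod_def)
      also have "\<dots> = (\<Sum>v\<in>W. c (f i) v * v)"
        using sum.reindex_bij_betw[OF f, of "\<lambda>v. c (f i) v * v"] by (simp add: n_def)
      also have "\<dots> = z * f i" using c(1) fW i by simp
      finally show "(A *\<^sub>v vec n f) $ i = (z \<cdot>\<^sub>v vec n f) $ i" using i by simp
    qed (simp add: A_def)
  qed
  hence "poly (char_poly A) z = 0"
    using eigenvalue_root_char_poly[OF A] by (auto simp: eigenvalue_def)
  moreover have "lead_coeff (char_poly A) = 1"
    using degree_monic_char_poly[OF A] by simp
  moreover have "poly_over R (char_poly A)"
    unfolding char_poly_def char_poly_matrix_def det_def
    using A fW c(2)
    by (auto simp: A_def sign_def poly_over_0[OF R] permutes_in_image poly_over_pCons[OF R] 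
        subring_0[OF R] subring_1[OF R]
        intro!: poly_over_sum[OF R] poly_over_prod[OF R] poly_over_mult[OF R] poly_over_add[OF R]
         poly_over_1[OF R] poly_over_uminus[OF R] subring_uminus[OF R])
  ultimately show ?thesis unfolding integral_over_def by blast
qed

context
  fixes R :: "'a::field set"
  assumes R: "is_subring R"
begin

lemma integral_incl: "x \<in> R \<Longrightarrow> integral_over R x"
  by (rule module_finite_imp_integral[OF R module_finite_refl[OF R]])

text \<open>Integral elements are adjoined one by one. Differences and products of integral
  elements, and the finitely many coefficients of an equation, can thus be treated inside one finite
  extension.\<close>

lemma finite_integral_extension:
  assumes "finite C" "\<And>c. c \<in> C \<Longrightarrow> integral_over R c"
  shows "\<exists>S. module_finite R S \<and> C \<subseteq> S"
  using assms
proof (induction C rule: finite_induct)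
  case empty
  thus ?case using module_finite_refl[OF R] by auto
next
  case (insert x C)
  then obtain S where S: "module_finite R S" "C \<subseteq> S" by auto
  hence S': "is_subring S" "R \<subseteq> S" by (auto simp: module_finite_def)
  have "integral_over S x" using insert.prems S'(2) by (auto intro: integral_over_mono)
  hence "module_finite R (polys_at S x)"
    using module_finite_trans[OF R S(1)] module_finite_polys_at[OF S'(1)] by blast
  moreover have "insert x C \<subseteq> polys_at S x"
    using S(2) polys_at_incl[OF S'(1)] polys_at_gen[OF S'(1)] by blast
  ultimately show ?case by blast
qed

lemma integral_closure_subring: "is_subring {x. integral_over R x}"
  unfolding is_subring_def
proof (intro conjI ballI)
  show "1 \<in> {x. integral_over R x}" using integral_incl subring_1[OF R] by auto
  fix x y assume "x \<in> {x. integral_over R x}" "y \<in> {x. integral_over R x}"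
  then obtain S where S: "module_finite R S" "{x, y} \<subseteq> S"
    using finite_integral_extension[of "{x, y}"] by auto
  hence "is_subring S" by (simp add: module_finite_def)
  hence "x - y \<in> S" "x * y \<in> S" using S(2) by (auto intro: subring_intros)
  thus "x - y \<in> {x. integral_over R x}" "x * y \<in> {x. integral_over R x}"
    using module_finite_imp_integral[OF R S(1)] by auto
qed

lemma integral_trans:
  assumes "\<And>s. s \<in> S \<Longrightarrow> integral_over R s" "integral_over S x"
  shows "integral_over R x"
proof -
  from assms(2) obtain p where p: "lead_coeff p = 1" "poly_over S p" "poly p x = 0"
    by (auto simp: integral_over_def)
  obtain T where T: "module_finite R T" "coeff p ` {..degree p} \<subseteq> T"
    using finite_integral_extension[of "coeff p ` {..degree p}"] p(2) assms(1)
    by (auto simp: poly_over_def)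
  hence T': "is_subring T" by (simp add: module_finite_def)
  have "coeff p i \<in> T" for i
    using T(2) subring_0[OF T'] by (cases "i \<le> degree p") (auto simp: coeff_eq_0)
  hence "integral_over T x" using p by (auto simp: integral_over_def poly_over_def)
  hence "module_finite R (polys_at T x)"
    using module_finite_trans[OF R T(1)] module_finite_polys_at[OF T'] by blast
  thus ?thesis using module_finite_imp_integral[OF R] polys_at_gen[OF T'] by blast
qed

text \<open>\<open>x\<close> is a root of \<open>T ^ n - x ^ n\<close>, which is monic over the
  integral closure of \<open>R\<close>; transitivity does the rest.\<close>

lemma integral_root:
  assumes "n > 0" "integral_over R (x ^ n)"
  shows "integral_over R x"
proof (rule integral_trans[of "{x. integral_over R x}"])
  note I = integral_closure_subring
  have "lead_coeff (monom 1 n - [:x ^ n:]) = 1"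
  proof -
    have "degree (monom 1 n - [:x ^ n:]) = n"
      using degree_add_eq_left[of "- [:x ^ n:]" "monom 1 n"] assms(1)
      by (simp add: degree_monom_eq del: minus_pCons)
    thus ?thesis using assms(1) by (simp add: coeff_pCons split: nat.splits)
  qed
  moreover have "poly_over {x. integral_over R x} (monom 1 n - [:x ^ n:])"
    using assms subring_1[OF I] subring_0[OF I]
    by (intro poly_over_diff[OF I] poly_over_monom[OF I]) (auto simp: poly_over_pCons[OF I] poly_over_0[OF I])
  ultimately show "integral_over {x. integral_over R x} x"
    unfolding integral_over_def[of "{x. integral_over R x}"]
    by (intro exI[of _ "monom 1 n - [:x ^ n:]"]) (auto simp: poly_monom)
qed auto

end

section \<open>Integrality along field embeddings\<close>

lemma subring_image:
  assumes "field_hom h" "is_subring R"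
  shows "is_subring (h ` R)"
proof -
  interpret field_hom h by fact
  show ?thesis
    unfolding is_subring_def
  proof (intro conjI ballI)
    show "1 \<in> h ` R" using subring_1[OF assms(2)] by (metis hom_one image_eqI)
    fix x y assume "x \<in> h ` R" "y \<in> h ` R"
    thus "x - y \<in> h ` R" "x * y \<in> h ` R"
      using subring_diff[OF assms(2)] subring_mult[OF assms(2)] by (auto simp flip: hom_minus hom_mult)
  qed
qed

lemma poly_over_image:
  assumes "field_hom h" "poly_over (h ` S) p"
  shows "\<exists>q. p = map_poly h q \<and> poly_over S q"
proof -
  interpret field_hom h by fact
  define q where "q = map_poly (inv_into UNIV h) p"
  have inj: "inj h" by (rule inj_f)
  have cq: "coeff q i = inv_into UNIV h (coeff p i)" for i
    unfolding q_def by (rule coeff_map_poly) (metis hom_zero inj inv_f_f)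
  have "p = map_poly h q"
  proof (rule poly_eqI)
    fix i
    have "coeff p i \<in> range h" using assms(2) by (auto simp: poly_over_def)
    thus "coeff p i = coeff (map_poly h q) i" by (simp add: cq f_inv_into_f)
  qed
  moreover have "poly_over S q" unfolding poly_over_def
  proof
    fix i
    obtain r where "r \<in> S" "coeff p i = h r" using assms(2) unfolding poly_over_def by blast
    thus "coeff q i \<in> S" using inj by (simp add: cq inv_f_f)
  qed
  ultimately show ?thesis by blast
qed

lemma integral_hom_reflect:
  assumes "field_hom h" "integral_over (h ` R) (h x)"
  shows "integral_over R x"
proof -
  interpret field_hom h by fact
  from assms(2) obtain p where p: "lead_coeff p = 1" "poly_over (h ` R) p" "poly p (h x) = 0"
    by (auto simp: integral_over_def)
  obtain q where pq: "p = map_poly h q" and "poly_over R q"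
    using poly_over_image[OF assms(1) p(2)] by blast
  moreover have "lead_coeff q = 1" "poly q x = 0"
    using p(1,3) unfolding pq by auto
  ultimately show ?thesis unfolding integral_over_def by blast
qed

text \<open>While the constant term vanishes, a factor \<open>T\<close> can be cancelled because
  \<open>x\<close> is nonzero. A nonzero constant term is a multiple of \<open>x\<close> lying in
  \<open>R\<close>; from it come inverses in \<open>radical_field\<close> and nonzero elements of
  contracted primes.\<close>

lemma integral_nonzero_const:
  assumes "integral_over R x" "x \<noteq> (0 :: 'a :: idom)"
  shows "\<exists>p. lead_coeff p = 1 \<and> poly_over R p \<and> poly p x = 0 \<and> coeff p 0 \<noteq> 0"
proof -
  have "\<exists>q. lead_coeff q = 1 \<and> poly_over R q \<and> poly q x = 0 \<and> coeff q 0 \<noteq> 0"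
    if "lead_coeff p = 1" "poly_over R p" "poly p x = 0" for p
    using that
  proof (induction p)
    case (pCons a p)
    show ?case
    proof (cases "a = 0")
      case True
      have "p \<noteq> 0" using pCons True by auto
      have "coeff p i \<in> R" for i
        using pCons.prems(2) coeff_pCons_Suc[of a p i] unfolding poly_over_def by metis
      hence "poly_over R p" by (simp add: poly_over_def)
      thus ?thesis using pCons True assms(2) \<open>p \<noteq> 0\<close> by auto
    next
      case False
      thus ?thesis using pCons.prems by (intro exI[of _ "pCons a p"]) auto
    qed
  qed auto
  thus ?thesis using assms(1) by (auto simp: integral_over_def)
qed

section \<open>Noetherian rings\<close>

definition noetherian :: "'a::comm_ring_1 set \<Rightarrow> bool" where
  "noetherian R \<longleftrightarrow> (\<forall>I. is_ideal R I \<longrightarrow> (\<exists>S. finite S \<and> S \<subseteq> I \<and> I = lspan R S))"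

lemma lspan_subset_ideal: "is_subring R \<Longrightarrow> is_ideal R I \<Longrightarrow> S \<subseteq> I \<Longrightarrow> lspan R S \<subseteq> I"
  by (rule lspan_least) (auto intro: is_idealD)

context
  fixes R :: "'a::comm_ring_1 set"
  assumes R: "is_subring R"
begin

text \<open>Zorn's lemma applies: the union of a chain is a finitely generated ideal, and one member
  already contains all the generators, so the union is that member.\<close>

lemma noetherian_has_maximal:
  assumes noeth: "noetherian R" and F: "F \<noteq> {}" "\<And>I. I \<in> F \<Longrightarrow> is_ideal R I"
  shows "\<exists>M\<in>F. \<forall>J\<in>F. M \<subseteq> J \<longrightarrow> J = M"
proof (rule subset_Zorn_nonempty[OF F(1)])
  fix C assume C: "C \<noteq> {}" "subset.chain F C"
  hence CF: "C \<subseteq> F" by (simp add: subset_chain_def)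
  have "is_ideal R (\<Union>C)" unfolding is_ideal_def
  proof (intro conjI ballI)
    fix x y assume "x \<in> \<Union>C" "y \<in> \<Union>C"
    then obtain I J where "x \<in> I" "I \<in> C" "y \<in> J" "J \<in> C" by auto
    moreover from this have "I \<subseteq> J \<or> J \<subseteq> I" using C(2) by (auto simp: subset_chain_def)
    ultimately have "\<exists>K\<in>C. x \<in> K \<and> y \<in> K" by blast
    thus "x + y \<in> \<Union>C" using CF F(2) is_idealD(3) by blast
  next
    fix r x assume "r \<in> R" "x \<in> \<Union>C"
    thus "r * x \<in> \<Union>C" using CF F(2) is_idealD(4) by blast
  next
    show "0 \<in> \<Union>C" using C(1) CF F(2) is_idealD(2) by blast
  next
    show "\<Union>C \<subseteq> R" using CF F(2) is_idealD(1) by blast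
  qed
  then obtain S where S: "finite S" "S \<subseteq> \<Union>C" "\<Union>C = lspan R S"
    using noeth by (auto simp: noetherian_def)
  obtain K where K: "K \<in> C" "S \<subseteq> K"
    using finite_subset_Union_chain[OF S(1,2) C] by auto
  have "is_ideal R K" using K(1) CF F(2) by blast
  hence "\<Union>C \<subseteq> K" unfolding S(3) using K(2) by (rule lspan_subset_ideal[OF R])
  moreover have "K \<subseteq> \<Union>C" using K(1) by (rule Union_upper)
  ultimately have eq: "\<Union>C = K" by (rule equalityI)
  have "K \<in> F" using CF K(1) by (rule subsetD)
  thus "\<Union>C \<in> F" by (rule ssubst[OF eq])
qed

lemma exists_maximal_ideal:
  assumes noeth: "noetherian R" and I: "is_ideal R I" "1 \<notin> I"
  shows "\<exists>P. is_maximal R P \<and> I \<subseteq> P"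
proof -
  define F where "F = {J. is_ideal R J \<and> 1 \<notin> J \<and> I \<subseteq> J}"
  have "I \<in> F" using I by (simp add: F_def)
  hence "F \<noteq> {}" by blast
  have "is_ideal R J" if "J \<in> F" for J using that by (simp add: F_def)
  from noetherian_has_maximal[OF noeth \<open>F \<noteq> {}\<close> this]
  obtain M where M: "M \<in> F" "\<forall>J\<in>F. M \<subseteq> J \<longrightarrow> J = M" ..
  have "J = M" if "is_ideal R J" "M \<subseteq> J" "1 \<notin> J" for J
  proof -
    have "J \<in> F" using that M(1) unfolding F_def by blast
    thus ?thesis using M(2) that(2) by blast
  qed
  thus ?thesis using M(1) unfolding is_maximal_def F_def by (intro exI[of _ M]) simp
qed

text \<open>Hilbert's basis theorem: \<open>J n\<close> collects the leading coefficients, in degree \<open>n\<close>, of the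
  polynomials representing elements of the ideal.\<close>

lemma noetherian_polys_at:
  assumes noeth: "noetherian R"
  shows "noetherian (polys_at R x)"
  unfolding noetherian_def
proof (intro allI impI)
  let ?T = "polys_at R x"
  note T = polys_at_subring[OF R, of x]
  fix I assume I: "is_ideal ?T I"
  \<comment> \<open>Degree at most \<open>n\<close> rather than exactly \<open>n\<close>: leading
    terms may cancel in sums, and \<open>J n\<close> has to be an ideal.\<close>
  define J where "J n = {coeff p n | p. poly_over R p \<and> degree p \<le> n \<and> poly p x \<in> I}" for n
  have J_ideal: "is_ideal R (J n)" for n
    unfolding is_ideal_def
  proof (intro conjI ballI)
    show "J n \<subseteq> R" by (auto simp: J_def poly_over_def)
    show "0 \<in> J n" unfolding J_def
      by (intro CollectI exI[of _ 0]) (auto simp: poly_over_0[OF R] is_idealD(2)[OF I])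
    fix a b assume "a \<in> J n" "b \<in> J n"
    then obtain p q where "a = coeff p n" "poly_over R p" "degree p \<le> n" "poly p x \<in> I"
      "b = coeff q n" "poly_over R q" "degree q \<le> n" "poly q x \<in> I" by (auto simp: J_def)
    thus "a + b \<in> J n" unfolding J_def
      by (intro CollectI exI[of _ "p + q"])
         (auto simp: poly_over_add[OF R] is_idealD(3)[OF I] degree_add_le)
  next
    fix r a assume "r \<in> R" "a \<in> J n"
    then obtain p where "a = coeff p n" "poly_over R p" "degree p \<le> n" "poly p x \<in> I"
      by (auto simp: J_def)
    thus "r * a \<in> J n" unfolding J_def using \<open>r \<in> R\<close> polys_at_incl[OF R, of x] degree_smult_le[of r p]
      by (intro CollectI exI[of _ "smult r p"])
         (auto simp: poly_over_smult[OF R] intro: is_idealD(4)[OF I])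
  qed
  have J_Suc: "J n \<subseteq> J (Suc n)" for n
  proof
    fix a assume "a \<in> J n"
    then obtain p where p: "a = coeff p n" "poly_over R p" "degree p \<le> n" "poly p x \<in> I"
      by (auto simp: J_def)
    have "x * poly p x \<in> I" by (rule is_idealD(4)[OF I polys_at_gen[OF R] p(4)])
    thus "a \<in> J (Suc n)" unfolding J_def using p degree_pCons_le[of 0 p]
      by (intro CollectI exI[of _ "pCons 0 p"]) (auto simp: poly_over_pCons[OF R] subring_0[OF R])
  qed
  hence J_mono: "m \<le> n \<Longrightarrow> J m \<subseteq> J n" for m n by (rule lift_Suc_mono_le)
  have "is_ideal R (\<Union>n. J n)" unfolding is_ideal_def
  proof (intro conjI ballI)
    fix a b assume "a \<in> (\<Union>n. J n)" "b \<in> (\<Union>n. J n)"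
    then obtain m n where "a \<in> J m" "b \<in> J n" by auto
    hence "a \<in> J (max m n)" "b \<in> J (max m n)"
      using J_mono[of m "max m n"] J_mono[of n "max m n"] by auto
    thus "a + b \<in> (\<Union>n. J n)" using is_idealD(3)[OF J_ideal] by blast
  next
    fix r a assume "r \<in> R" "a \<in> (\<Union>n. J n)"
    thus "r * a \<in> (\<Union>n. J n)" using is_idealD(4)[OF J_ideal] by blast
  next
    show "0 \<in> (\<Union>n. J n)" using is_idealD(2)[OF J_ideal] by blast
    show "(\<Union>n. J n) \<subseteq> R" using is_idealD(1)[OF J_ideal] by blast
  qed
  then obtain S where S: "finite S" "S \<subseteq> (\<Union>n. J n)" "(\<Union>n. J n) = lspan R S"
    using noeth by (auto simp: noetherian_def)
  have "\<exists>N. S \<subseteq> J N"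
    using S(1,2)
  proof (induction S rule: finite_induct)
    case (insert a S)
    then obtain N n where "S \<subseteq> J N" "a \<in> J n" by auto
    hence "insert a S \<subseteq> J (max N n)"
      using J_mono[of N "max N n"] J_mono[of n "max N n"] by auto
    thus ?case by blast
  qed auto
  then obtain N where "S \<subseteq> J N" by auto
  hence "(\<Union>n. J n) \<subseteq> J N" using S(3) lspan_subset_ideal[OF R J_ideal] by auto
  \<comment> \<open>The chain is stationary from \<open>N\<close> on, so a coefficient in degree
    \<open>n > N\<close> is also one in degree \<open>N\<close>; the missing degrees are supplied by
    a monomial factor.\<close>
  hence J_stable: "J n \<subseteq> J (min n N)" for n by (cases "n \<le> N") (auto simp: min_def)
  have "\<exists>S. finite S \<and> S \<subseteq> J n \<and> J n = lspan R S" for n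
    using noeth J_ideal by (auto simp: noetherian_def)
  then obtain S where S: "\<And>n. finite (S n)" "\<And>n. S n \<subseteq> J n" "\<And>n. J n = lspan R (S n)" by metis
  have "\<exists>p. c = coeff p n \<and> poly_over R p \<and> degree p \<le> n \<and> poly p x \<in> I" if "c \<in> S n" for c n
  proof -
    have "c \<in> J n" using S(2) that by blast
    thus ?thesis unfolding J_def by auto
  qed
  hence *: "\<forall>n c. \<exists>p. c \<in> S n \<longrightarrow> c = coeff p n \<and> poly_over R p \<and> degree p \<le> n \<and> poly p x \<in> I"
    by blast
  obtain p where "\<forall>n c. c \<in> S n \<longrightarrow>
      c = coeff (p n c) n \<and> poly_over R (p n c) \<and> degree (p n c) \<le> n \<and> poly (p n c) x \<in> I"
    using choice[of "\<lambda>n f. \<forall>c. c \<in> S n \<longrightarrow> c = coeff (f c) n \<and> poly_over R (f c) \<and> degree (f c) \<le> n \<and> poly (f c) x \<in> I"]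
      choice[OF spec[OF *]] by blast
  hence p: "c \<in> S n \<Longrightarrow> coeff (p n c) n = c" "c \<in> S n \<Longrightarrow> poly_over R (p n c)"
    "c \<in> S n \<Longrightarrow> degree (p n c) \<le> n" "c \<in> S n \<Longrightarrow> poly (p n c) x \<in> I" for n c
    by simp_all
  define G where "G = (\<Union>n\<le>N. (\<lambda>c. poly (p n c) x) ` S n)"
  have G: "finite G" "G \<subseteq> I" using S(1) p(4) by (auto simp: G_def)
  \<comment> \<open>Induction on a strict bound for the degree, so that the case \<open>0\<close>
    means \<open>q = 0\<close>. In the step \<open>h\<close>, a combination of the chosen
    polynomials, has the same coefficient in degree \<open>n\<close> as \<open>q\<close>, and the
    bound drops for \<open>q - h\<close>.\<close>
  have "poly q x \<in> lspan ?T G" if "poly_over R q" "poly q x \<in> I" "\<forall>i\<ge>n. coeff q i = 0" for n q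
    using that
  proof (induction n arbitrary: q)
    case 0
    hence "q = 0" by (intro poly_eqI) auto
    thus ?case using lspan_0[OF T] by simp
  next
    case (Suc n)
    define M where "M = min n N"
    have "degree q \<le> n" using Suc.prems(3) by (intro degree_le) auto
    hence "coeff q n \<in> J n" using Suc.prems unfolding J_def by blast
    hence "coeff q n \<in> lspan R (S M)" using J_stable S(3) by (auto simp: M_def)
    then obtain r where r: "coeff q n = (\<Sum>c\<in>S M. r c * c)" "\<And>c. c \<in> S M \<Longrightarrow> r c \<in> R"
      by (auto simp: lspan_def)
    define h where "h = (\<Sum>c\<in>S M. monom (r c) (n - M) * p M c)"
    have h_over: "poly_over R h"
      unfolding h_def using p(2) r(2)
      by (intro poly_over_sum[OF R] poly_over_mult[OF R] poly_over_monom[OF R]) auto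
    have "poly (monom (r c) (n - M)) x \<in> ?T" if "c \<in> S M" for c
      using poly_over_monom[OF R r(2)[OF that]] unfolding polys_at_def by blast
    moreover have "poly (p M c) x \<in> G" if "c \<in> S M" for c
      using that by (auto simp: G_def M_def)
    ultimately have h_lspan: "poly h x \<in> lspan ?T G"
      unfolding h_def poly_sum poly_mult using G(1)
      by (intro lspan_sum[OF T] lspan_scale[OF T] lspan_gen[OF T]) auto
    have "M \<le> n" by (simp add: M_def)
    have "coeff h n = (\<Sum>c\<in>S M. r c * coeff (p M c) M)"
      unfolding h_def coeff_sum coeff_monom_mult using \<open>M \<le> n\<close> by (intro sum.cong) auto
    hence "coeff h n = coeff q n" using p(1) r(1) by simp
    moreover have "degree h \<le> n" unfolding h_def
    proof (rule degree_sum_le)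
      fix c assume "c \<in> S M"
      hence "degree (p M c) \<le> M" by (rule p(3))
      thus "degree (monom (r c) (n - M) * p M c) \<le> n"
        using degree_mult_le[of "monom (r c) (n - M)" "p M c"] degree_monom_le[of "r c" "n - M"] \<open>M \<le> n\<close>
        by linarith
    qed (use S(1) in auto)
    ultimately have *: "coeff (q - h) i = 0" if "i \<ge> n" for i
      using Suc.prems(3) that by (cases "i = n") (auto simp: coeff_eq_0)
    have "lspan ?T G \<subseteq> I" by (rule lspan_subset_ideal[OF T I G(2)])
    hence "poly q x + - poly h x \<in> I"
      using h_lspan by (intro is_idealD(3)[OF I Suc.prems(2)] ideal_uminus[OF I T]) auto
    hence "poly (q - h) x \<in> I" by simp
    hence "poly (q - h) x \<in> lspan ?T G"
      using * by (intro Suc.IH poly_over_diff[OF R Suc.prems(1) h_over]) auto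
    from lspan_add[OF T this h_lspan] show ?case by simp
  qed
  note in_lspan = this
  have "I \<subseteq> lspan ?T G"
  proof
    fix a assume "a \<in> I"
    moreover from this obtain q where "a = poly q x" "poly_over R q"
      using is_idealD(1)[OF I] by (auto simp: polys_at_def)
    ultimately show "a \<in> lspan ?T G"
      using in_lspan[of q "Suc (degree q)"] by (auto simp: coeff_eq_0)
  qed
  moreover have "lspan ?T G \<subseteq> I" by (rule lspan_subset_ideal[OF T I G(2)])
  ultimately show "\<exists>S. finite S \<and> S \<subseteq> I \<and> I = lspan ?T S" using G by blast
qed

end

lemma noetherian_field:
  fixes F :: "'a::field set"
  assumes F: "is_subring F" "\<And>x. x \<in> F \<Longrightarrow> inverse x \<in> F"
  shows "noetherian F"
  unfolding noetherian_def
proof (intro allI impI)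
  fix I assume I: "is_ideal F I"
  show "\<exists>S. finite S \<and> S \<subseteq> I \<and> I = lspan F S"
  proof (cases "I = {0}")
    case True
    thus ?thesis by (intro exI[of _ "{}"]) (auto simp: lspan_def)
  next
    case False
    then obtain x where x: "x \<in> I" "x \<noteq> 0" using is_idealD(2)[OF I] by blast
    hence "inverse x * x \<in> I" using is_idealD(1)[OF I] F(2) by (intro is_idealD(4)[OF I]) auto
    hence "1 \<in> I" using x by simp
    hence "I = F" using ideal_1_iff[OF I F(1)] by simp
    thus ?thesis using subring_1[OF F(1)] by (intro exI[of _ "{1}"]) (auto simp: lspan_def)
  qed
qed

lemma noetherian_finitely_generated:
  fixes F :: "'a::field set"
  assumes F: "is_subring F" "\<And>x. x \<in> F \<Longrightarrow> inverse x \<in> F" and "finite S"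
  shows "noetherian (generate_ring ring_of_type_algebra (F \<union> S))"
  using assms(3)
proof (induction S rule: finite_induct)
  case empty
  have "generate_ring ring_of_type_algebra F = F"
    using generate_ring_incl[of F] generate_ring_least[OF F(1), of F] by auto
  thus ?case using noetherian_field[OF F] by simp
next
  case (insert x S)
  note G = generate_ring_subring[of "F \<union> S"]
  have "generate_ring ring_of_type_algebra (F \<union> insert x S) =
        polys_at (generate_ring ring_of_type_algebra (F \<union> S)) x"
    using generate_ring_insert_subset[of x "F \<union> S"] generate_ring_eq_polys_at[OF G, of x] by simp
  thus ?case using noetherian_polys_at[OF G insert.IH] by simp
qed

section \<open>One-dimensional Noetherian domains\<close>

lemma frac_fieldI: "x \<in> R \<Longrightarrow> y \<in> R \<Longrightarrow> y \<noteq> 0 \<Longrightarrow> x / y \<in> frac_field R"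
  unfolding frac_field_def by blast

lemma frac_fieldE:
  assumes "f \<in> frac_field R"
  obtains x y where "f = x / y" "x \<in> R" "y \<in> R" "y \<noteq> 0"
  using assms unfolding frac_field_def by blast

lemma frac_field_contains: "is_subring R \<Longrightarrow> x \<in> R \<Longrightarrow> x \<in> frac_field R"
  using frac_fieldI[of x R 1] subring_1[of R] by simp

lemma frac_field_is_subring:
  assumes R: "is_subring R"
  shows "is_subring (frac_field R)"
  unfolding is_subring_def
proof (intro conjI ballI)
  show "1 \<in> frac_field R" using frac_field_contains subring_1 R by blast
  fix f g assume "f \<in> frac_field R" "g \<in> frac_field R"
  then obtain x y z w where *: "f = x / y" "x \<in> R" "y \<in> R" "y \<noteq> 0" "g = z / w" "z \<in> R" "w \<in> R" "w \<noteq> 0"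
    by (metis frac_fieldE)
  have "f - g = (x * w - z * y) / (y * w)" "f * g = (x * z) / (y * w)"
    using * by (auto simp: field_simps)
  thus "f - g \<in> frac_field R" "f * g \<in> frac_field R"
    using * by (auto intro!: frac_fieldI subring_intros[OF R])
qed

lemma inverse_frac_field:
  assumes R: "is_subring R" and "f \<in> frac_field R"
  shows "inverse f \<in> frac_field R"
  using assms(2)
proof (rule frac_fieldE)
  fix x y assume "f = x / y" "x \<in> R" "y \<in> R" "y \<noteq> 0"
  thus "inverse f \<in> frac_field R"
    using frac_fieldI[of y R x] frac_field_contains[OF R subring_0[OF R]] by (cases "x = 0") auto
qed

text \<open>Krull dimension one without chains of primes: \<open>maximal_nonzero\<close> excludes
  fields, \<open>prime_maximal\<close> bounds the dimension. Regularity is kept apart, because the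
  integral closure must be an instance before its local rings are known to be regular.\<close>

locale noetherian_dim1 =
  fixes R :: "'a::field set"
  assumes subring: "is_subring R"
    and noeth: "noetherian R"
    and maximal_nonzero: "\<And>P. is_maximal R P \<Longrightarrow> \<exists>x\<in>P. x \<noteq> 0"
    and prime_maximal: "\<And>P x. is_prime R P \<Longrightarrow> x \<in> P \<Longrightarrow> x \<noteq> 0 \<Longrightarrow> is_maximal R P"
begin

lemmas R_intros = subring_intros[OF subring]

lemma maximal_ideal: "is_maximal R P \<Longrightarrow> is_ideal R P"
  and maximal_not_1: "is_maximal R P \<Longrightarrow> 1 \<notin> P"
  by (simp_all add: is_maximal_def)

lemma maximal_subset: "is_maximal R P \<Longrightarrow> x \<in> P \<Longrightarrow> x \<in> R"
  using maximal_ideal is_idealD(1) by blast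

lemma maximal_multD:
  "is_maximal R P \<Longrightarrow> x \<in> R \<Longrightarrow> y \<in> R \<Longrightarrow> x * y \<in> P \<Longrightarrow> x \<in> P \<or> y \<in> P"
  using maximal_imp_prime[OF subring] unfolding is_prime_def by blast

lemma maximal_eqI: "is_maximal R P \<Longrightarrow> is_maximal R Q \<Longrightarrow> P \<subseteq> Q \<Longrightarrow> Q = P"
  unfolding is_maximal_def by blast

lemma add_principal_ideal:
  assumes "is_ideal R I" "a \<in> R"
  shows "is_ideal R {i + r * a | i r. i \<in> I \<and> r \<in> R}"
  unfolding is_ideal_def
proof (intro conjI ballI)
  show "{i + r * a | i r. i \<in> I \<and> r \<in> R} \<subseteq> R"
    using is_idealD(1)[OF assms(1)] assms(2) by (auto intro!: R_intros)
  have "0 + 0 * a \<in> {i + r * a | i r. i \<in> I \<and> r \<in> R}"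
    using is_idealD(2)[OF assms(1)] subring_0[OF subring] by blast
  thus "0 \<in> {i + r * a | i r. i \<in> I \<and> r \<in> R}" by simp
next
  fix x y assume "x \<in> {i + r * a | i r. i \<in> I \<and> r \<in> R}" "y \<in> {i + r * a | i r. i \<in> I \<and> r \<in> R}"
  then obtain i r j s where *: "x = i + r * a" "y = j + s * a" "i \<in> I" "j \<in> I" "r \<in> R" "s \<in> R" by blast
  have "x + y = (i + j) + (r + s) * a" by (simp add: * algebra_simps)
  moreover have "i + j \<in> I" "r + s \<in> R"
    using * by (auto intro: is_idealD(3)[OF assms(1)] subring_add[OF subring])
  ultimately show "x + y \<in> {i + r * a | i r. i \<in> I \<and> r \<in> R}" by blast
next
  fix c x assume c: "c \<in> R" and "x \<in> {i + r * a | i r. i \<in> I \<and> r \<in> R}"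
  then obtain i r where *: "x = i + r * a" "i \<in> I" "r \<in> R" by blast
  have "c * x = c * i + (c * r) * a" by (simp add: * algebra_simps)
  moreover have "c * i \<in> I" "c * r \<in> R"
    using * c by (auto intro: is_idealD(4)[OF assms(1)] subring_mult[OF subring])
  ultimately show "c * x \<in> {i + r * a | i r. i \<in> I \<and> r \<in> R}" by blast
qed

text \<open>Noetherian induction: an ideal maximal among the counterexamples would be prime.\<close>

lemma finite_maximal_over:
  assumes "x \<in> R" "x \<noteq> 0"
  shows "finite {P. is_maximal R P \<and> x \<in> P}"
proof (rule ccontr)
  assume inf: "infinite {P. is_maximal R P \<and> x \<in> P}"
  define F where "F = {I. is_ideal R I \<and> x \<in> I \<and> infinite {P. is_maximal R P \<and> I \<subseteq> P}}"
  define I0 where "I0 = {i + r * x | i r. i \<in> {0} \<and> r \<in> R}"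
  have "is_ideal R {0}" by (auto simp: is_ideal_def intro: R_intros)
  hence I0: "is_ideal R I0" unfolding I0_def by (rule add_principal_ideal) fact
  have "0 + r * x \<in> P" if "is_maximal R P" "x \<in> P" "r \<in> R" for r P
    using is_idealD(4)[OF maximal_ideal[OF that(1)] that(3,2)] by simp
  hence "{P. is_maximal R P \<and> x \<in> P} \<subseteq> {P. is_maximal R P \<and> I0 \<subseteq> P}"
    unfolding I0_def by blast
  hence "infinite {P. is_maximal R P \<and> I0 \<subseteq> P}"
    using inf finite_subset by blast
  moreover have "0 + 1 * x \<in> I0"
    unfolding I0_def using subring_1[OF subring] by blast
  ultimately have "I0 \<in> F" using I0 by (simp add: F_def)
  hence "F \<noteq> {}" by blast
  have "is_ideal R J" if "J \<in> F" for J using that by (simp add: F_def)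
  from noetherian_has_maximal[OF subring noeth \<open>F \<noteq> {}\<close> this]
  obtain M where M: "M \<in> F" "\<forall>J\<in>F. M \<subseteq> J \<longrightarrow> J = M" ..
  have I: "is_ideal R M" "x \<in> M" and inf_M: "infinite {P. is_maximal R P \<and> M \<subseteq> P}"
    using M(1) by (auto simp: F_def)
  have "1 \<notin> M"
  proof
    assume "1 \<in> M"
    hence "{P. is_maximal R P \<and> M \<subseteq> P} = {}" using maximal_not_1 by blast
    thus False using inf_M by (metis finite.emptyI)
  qed
  \<comment> \<open>\<open>M + R a\<close> is strictly larger than \<open>M\<close> and hence no
    counterexample; the maximal ideals containing it are those that contain both \<open>M\<close>
    and \<open>a\<close>.\<close>
  have larger: "finite {P. is_maximal R P \<and> M \<subseteq> P \<and> a \<in> P}" if a: "a \<in> R" "a \<notin> M" for a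
  proof (rule ccontr)
    assume inf: "infinite {P. is_maximal R P \<and> M \<subseteq> P \<and> a \<in> P}"
    define J where "J = {i + r * a | i r. i \<in> M \<and> r \<in> R}"
    have J: "is_ideal R J" unfolding J_def by (rule add_principal_ideal[OF I(1) a(1)])
    have MJ: "M \<subseteq> J"
    proof
      fix i assume "i \<in> M"
      hence "i + 0 * a \<in> J" unfolding J_def using subring_0[OF subring] by blast
      thus "i \<in> J" by simp
    qed
    have "0 + 1 * a \<in> J" unfolding J_def using subring_1[OF subring] is_idealD(2)[OF I(1)] by blast
    hence aJ: "a \<in> J" by simp
    have "i + r * a \<in> P" if "is_maximal R P" "M \<subseteq> P" "a \<in> P" "i \<in> M" "r \<in> R" for P i r
      using that is_idealD(3,4)[OF maximal_ideal[OF that(1)]] by blast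
    hence "{P. is_maximal R P \<and> M \<subseteq> P \<and> a \<in> P} \<subseteq> {P. is_maximal R P \<and> J \<subseteq> P}"
      unfolding J_def by blast
    hence "infinite {P. is_maximal R P \<and> J \<subseteq> P}" using inf finite_subset by blast
    hence "J \<in> F" using J MJ I(2) unfolding F_def by blast
    hence "J = M" using M(2) MJ by blast
    thus False using aJ a(2) by simp
  qed
  have "is_prime R M"
    unfolding is_prime_def
  proof (intro conjI ballI impI I(1) \<open>1 \<notin> M\<close>)
    fix a b assume ab: "a \<in> R" "b \<in> R" "a * b \<in> M"
    show "a \<in> M \<or> b \<in> M"
    proof (rule ccontr)
      assume "\<not> (a \<in> M \<or> b \<in> M)"
      hence "finite ({P. is_maximal R P \<and> M \<subseteq> P \<and> a \<in> P} \<union> {P. is_maximal R P \<and> M \<subseteq> P \<and> b \<in> P})"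
        using larger ab by simp
      moreover have "{P. is_maximal R P \<and> M \<subseteq> P} \<subseteq>
          {P. is_maximal R P \<and> M \<subseteq> P \<and> a \<in> P} \<union> {P. is_maximal R P \<and> M \<subseteq> P \<and> b \<in> P}"
        using maximal_multD ab by blast
      ultimately show False using inf_M finite_subset by blast
    qed
  qed
  \<comment> \<open>Dimension one enters here: the prime \<open>M\<close> contains
    \<open>x \<noteq> 0\<close>, so it is maximal, and only one maximal ideal contains it.\<close>
  hence "is_maximal R M" using I(2) assms(2) by (rule prime_maximal)
  hence "{P. is_maximal R P \<and> M \<subseteq> P} \<subseteq> {M}" using maximal_eqI by blast
  thus False using inf_M finite_subset by blast
qed

text \<open>Distinct maximal ideals are not nested, so each \<open>Q\<close> has an element outside
  \<open>P\<close>; a product of such elements stays outside \<open>P\<close>, which is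
  prime.\<close>

lemma maximal_separation:
  assumes P: "is_maximal R P" and F: "finite F" "\<And>Q. Q \<in> F \<Longrightarrow> is_maximal R Q \<and> Q \<noteq> P"
  shows "\<exists>y. y \<in> R \<and> y \<notin> P \<and> (\<forall>Q\<in>F. y \<in> Q)"
  using F
proof (induction F rule: finite_induct)
  case empty
  thus ?case using maximal_not_1[OF P] subring_1[OF subring] by blast
next
  case (insert Q F)
  then obtain y where y: "y \<in> R" "y \<notin> P" "\<forall>Q\<in>F. y \<in> Q" by blast
  have Q: "is_maximal R Q" "Q \<noteq> P" using insert.prems by blast+
  then obtain z where z: "z \<in> Q" "z \<notin> P" using maximal_eqI[OF Q(1) P] by blast
  hence zR: "z \<in> R" using maximal_subset[OF Q(1)] by blast
  have "y * z \<notin> P" using maximal_multD[OF P y(1) zR] y(2) z(2) by blast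
  moreover have "y * z \<in> Q" using is_idealD(4)[OF maximal_ideal[OF Q(1)] y(1) z(1)] .
  moreover have "y * z \<in> Q'" if "Q' \<in> F" for Q'
    using is_idealD(5)[OF maximal_ideal, of Q' z y] insert.prems y(3) zR that by blast
  ultimately show ?case using subring_mult[OF subring y(1) zR] by blast
qed

section \<open>Local rings at maximal ideals\<close>

lemma local_ringI: "x \<in> R \<Longrightarrow> y \<in> R \<Longrightarrow> y \<notin> P \<Longrightarrow> x / y \<in> local_ring R P"
  unfolding local_ring_def by blast

lemma local_ringE:
  assumes "f \<in> local_ring R P"
  obtains x y where "f = x / y" "x \<in> R" "y \<in> R" "y \<notin> P"
  using assms unfolding local_ring_def by blast

lemmas frac_field_incl = frac_field_contains[OF subring]
lemmas frac_field_subring = frac_field_is_subring[OF subring]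
lemmas frac_field_inverse = inverse_frac_field[OF subring]

lemmas frac_intros = subring_intros[OF frac_field_subring] frac_field_inverse

lemma frac_powi: "f \<in> frac_field R \<Longrightarrow> f powi n \<in> frac_field R"
  by (auto simp: power_int_def intro: frac_intros)

context
  fixes P assumes P: "is_maximal R P"
begin

lemma zero_in_P: "0 \<in> P" using is_idealD(2)[OF maximal_ideal[OF P]] .

lemma not_P_mult: "x \<in> R \<Longrightarrow> x \<notin> P \<Longrightarrow> y \<in> R \<Longrightarrow> y \<notin> P \<Longrightarrow> x * y \<notin> P"
  using maximal_multD[OF P] by blast

lemma not_P_nonzero: "x \<notin> P \<Longrightarrow> x \<noteq> 0"
  using zero_in_P by blast

lemma local_ring_subring: "is_subring (local_ring R P)"
  unfolding is_subring_def
proof (intro conjI ballI)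
  show "1 \<in> local_ring R P"
    using local_ringI[of 1 1 P] subring_1[OF subring] maximal_not_1[OF P] by simp
  fix f g assume "f \<in> local_ring R P" "g \<in> local_ring R P"
  then obtain x y z w where *: "f = x / y" "x \<in> R" "y \<in> R" "y \<notin> P" "g = z / w" "z \<in> R" "w \<in> R" "w \<notin> P"
    by (metis local_ringE)
  have "f - g = (x * w - z * y) / (y * w)" "f * g = (x * z) / (y * w)"
    using * not_P_nonzero by (auto simp: field_simps)
  thus "f - g \<in> local_ring R P" "f * g \<in> local_ring R P"
    using * not_P_mult by (auto intro!: local_ringI R_intros)
qed

lemma local_ring_incl: "x \<in> R \<Longrightarrow> x \<in> local_ring R P"
  using local_ringI[of x 1 P] subring_1[OF subring] maximal_not_1[OF P] by simp

lemma local_ring_frac: "f \<in> local_ring R P \<Longrightarrow> f \<in> frac_field R"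
  using not_P_nonzero by (elim local_ringE) (auto intro!: frac_fieldI)

lemma inverse_local: "x \<in> R \<Longrightarrow> x \<notin> P \<Longrightarrow> inverse x \<in> local_ring R P"
  using local_ringI[of 1 x P] subring_1[OF subring] by (simp add: inverse_eq_divide)

end

end

section \<open>Orders at the points of a smooth curve\<close>

locale dedekind = noetherian_dim1 +
  assumes uniformizer_exists: "\<And>P. is_maximal R P \<Longrightarrow> \<exists>\<pi>. uniformizer R P \<pi>"
begin

text \<open>The units of the local ring at \<open>P\<close>; these three conditions appear unfolded
  in \<open>ord_at\<close>.\<close>

definition lunit :: "'a set \<Rightarrow> 'a \<Rightarrow> bool" where
  "lunit P g \<longleftrightarrow> g \<noteq> 0 \<and> g \<in> local_ring R P \<and> inverse g \<in> local_ring R P"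

context
  fixes P assumes P: "is_maximal R P"
begin

lemmas loc_intros = subring_intros[OF local_ring_subring[OF P]]

lemma lunit_1: "lunit P 1"
  using loc_intros(2) by (simp add: lunit_def)

lemma lunit_mult: "lunit P g \<Longrightarrow> lunit P h \<Longrightarrow> lunit P (g * h)"
  by (auto simp: lunit_def intro: loc_intros)

lemma lunit_inverse: "lunit P g \<Longrightarrow> lunit P (inverse g)"
  by (auto simp: lunit_def)

lemma lunit_powi: "lunit P g \<Longrightarrow> lunit P (g powi n)"
  by (auto simp: lunit_def power_int_def intro: loc_intros simp flip: power_inverse)

lemma lunit_R: "x \<in> R \<Longrightarrow> x \<notin> P \<Longrightarrow> lunit P x"
  unfolding lunit_def using local_ring_incl[OF P] inverse_local[OF P] not_P_nonzero[OF P] by blast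

context
  fixes \<pi> assumes \<pi>: "uniformizer R P \<pi>"
begin

lemma unif_mult_local: "g \<in> local_ring R P \<Longrightarrow> \<exists>x y. \<pi> * g = x / y \<and> x \<in> P \<and> y \<in> R \<and> y \<notin> P"
  using \<pi> unfolding uniformizer_def by blast

lemma unif_div: "x \<in> P \<Longrightarrow> y \<in> R \<Longrightarrow> y \<notin> P \<Longrightarrow> \<exists>g\<in>local_ring R P. x / y = \<pi> * g"
  using \<pi> unfolding uniformizer_def by blast

lemma unif_div_P: "x \<in> P \<Longrightarrow> \<exists>g\<in>local_ring R P. x = \<pi> * g"
  using unif_div[of x 1] subring_1[OF subring] maximal_not_1[OF P] by simp

lemma unif_form: "\<exists>x y. \<pi> = x / y \<and> x \<in> P \<and> y \<in> R \<and> y \<notin> P"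
  using unif_mult_local[OF loc_intros(2)] by simp

lemma unif_local: "\<pi> \<in> local_ring R P"
proof -
  obtain x y where "\<pi> = x / y" "x \<in> P" "y \<in> R" "y \<notin> P" using unif_form by blast
  thus ?thesis using local_ringI maximal_subset[OF P] by simp
qed

lemma unif_nonzero: "\<pi> \<noteq> 0"
proof
  assume "\<pi> = 0"
  moreover obtain x where "x \<in> P" "x \<noteq> 0" using maximal_nonzero[OF P] by blast
  ultimately show False using unif_div_P[of x] by simp
qed

lemma unif_mult_in_R:
  assumes "x \<in> R" "g \<in> local_ring R P" "x = \<pi> * g"
  shows "x \<in> P"
proof -
  obtain z y where *: "\<pi> * g = z / y" "z \<in> P" "y \<in> R" "y \<notin> P"
    using unif_mult_local[OF assms(2)] by blast
  hence "x * y = z" using assms(3) not_P_nonzero[OF P, of y] by simp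
  hence "x * y \<in> P" using *(2) by simp
  thus ?thesis using maximal_multD[OF P assms(1) *(3)] *(4) by blast
qed

lemma one_not_unif_mult: "g \<in> local_ring R P \<Longrightarrow> 1 \<noteq> \<pi> * g"
  using unif_mult_in_R[of 1 g] subring_1[OF subring] maximal_not_1[OF P] by blast

lemma lunit_or_unif_mult:
  assumes "g \<in> local_ring R P"
  shows "lunit P g \<or> (\<exists>h\<in>local_ring R P. g = \<pi> * h)"
proof -
  obtain x y where *: "g = x / y" "x \<in> R" "y \<in> R" "y \<notin> P" by (rule local_ringE[OF assms])
  show ?thesis
  proof (cases "x \<in> P")
    case True
    thus ?thesis using unif_div[of x y] * by simp
  next
    case False
    have "lunit P (x * inverse y)"
      by (intro lunit_mult lunit_inverse lunit_R * False)
    thus ?thesis using * by (simp add: field_simps)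
  qed
qed

lemma unif_power_not_unit: "k > 0 \<Longrightarrow> \<not> lunit P (\<pi> powi k)"
proof
  assume k: "k > 0" and u: "lunit P (\<pi> powi k)"
  have "k = 1 + int (nat (k - 1))" using k by simp
  hence "\<pi> powi k = \<pi> * \<pi> ^ nat (k - 1)"
    using power_int_add[of \<pi> 1 "int (nat (k - 1))"] unif_nonzero
    by (simp only: power_int_of_nat power_int_1_right) simp
  hence "1 = \<pi> * (\<pi> ^ nat (k - 1) * inverse (\<pi> powi k))"
    using unif_nonzero by (simp add: field_simps)
  moreover have "\<pi> ^ nat (k - 1) * inverse (\<pi> powi k) \<in> local_ring R P"
    using u unif_local unfolding lunit_def by (intro loc_intros) auto
  ultimately show False using one_not_unif_mult by blast
qed

text \<open>The intersection of the powers of a principal maximal ideal is prime.\<close>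

lemma factorization_R:
  assumes "f \<in> R" "f \<noteq> 0"
  shows "\<exists>n::nat. \<exists>g. lunit P g \<and> f = \<pi> ^ n * g"
proof -
  \<comment> \<open>The trace on \<open>R\<close> of the intersection of all powers of the maximal
    ideal of the local ring. Elements outside \<open>I\<close> have a well-defined order, so the aim
    is to show that \<open>I\<close> contains no nonzero element.\<close>
  define I where "I = {a \<in> R. \<forall>n. \<exists>g\<in>local_ring R P. a = \<pi> ^ n * g}"
  have fact: "\<exists>n::nat. \<exists>g. lunit P g \<and> a = \<pi> ^ n * g" if a: "a \<in> R" "a \<notin> I" for a
  proof -
    define N where "N = (LEAST n. \<not> (\<exists>g\<in>local_ring R P. a = \<pi> ^ n * g))"
    have ex: "\<exists>n. \<not> (\<exists>g\<in>local_ring R P. a = \<pi> ^ n * g)" using a by (simp add: I_def)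
    have N: "\<not> (\<exists>g\<in>local_ring R P. a = \<pi> ^ N * g)"
      unfolding N_def by (rule LeastI_ex[OF ex])
    have "N \<noteq> 0"
    proof
      assume "N = 0"
      thus False using N local_ring_incl[OF P a(1)] by simp
    qed
    then obtain n where n: "N = Suc n" using not0_implies_Suc by blast
    have "\<exists>g\<in>local_ring R P. a = \<pi> ^ n * g"
      using not_less_Least[of n "\<lambda>n. \<not> (\<exists>g\<in>local_ring R P. a = \<pi> ^ n * g)"] n by (simp add: N_def)
    then obtain g where g: "g \<in> local_ring R P" "a = \<pi> ^ n * g" by blast
    have "\<not> (\<exists>h\<in>local_ring R P. g = \<pi> * h)"
    proof
      assume "\<exists>h\<in>local_ring R P. g = \<pi> * h"
      then obtain h where "h \<in> local_ring R P" "g = \<pi> * h" by blast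
      thus False using N g(2) n by (auto simp: algebra_simps)
    qed
    thus ?thesis using lunit_or_unif_mult[OF g(1)] g(2) by blast
  qed
  have I: "is_ideal R I" unfolding is_ideal_def
  proof (intro conjI ballI)
    show "I \<subseteq> R" by (auto simp: I_def)
    show "0 \<in> I" using subring_0[OF subring] loc_intros(1) by (auto simp: I_def intro!: bexI[of _ 0])
  next
    fix a b assume ab: "a \<in> I" "b \<in> I"
    have "\<exists>g\<in>local_ring R P. a + b = \<pi> ^ n * g" for n
    proof -
      obtain g h where "g \<in> local_ring R P" "h \<in> local_ring R P" "a = \<pi> ^ n * g" "b = \<pi> ^ n * h"
        using ab unfolding I_def by blast
      thus ?thesis by (intro bexI[of _ "g + h"]) (auto simp: distrib_left intro: loc_intros)
    qed
    thus "a + b \<in> I" using ab by (auto simp: I_def intro: R_intros)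
  next
    fix r a assume ra: "r \<in> R" "a \<in> I"
    have "\<exists>g\<in>local_ring R P. r * a = \<pi> ^ n * g" for n
    proof -
      obtain g where "g \<in> local_ring R P" "a = \<pi> ^ n * g" using ra unfolding I_def by blast
      thus ?thesis using local_ring_incl[OF P ra(1)]
        by (intro bexI[of _ "r * g"]) (auto intro: loc_intros)
    qed
    thus "r * a \<in> I" using ra by (auto simp: I_def intro: R_intros)
  qed
  have not_I: "a \<notin> I" if a: "a = \<pi> ^ n * g" "lunit P g" for a n g
  proof
    assume "a \<in> I"
    then obtain k where k: "k \<in> local_ring R P" "a = \<pi> ^ Suc n * k" unfolding I_def by blast
    hence "g = \<pi> * k" using a(1) unif_nonzero by simp
    hence "1 = \<pi> * (k * inverse g)" using a(2) by (simp add: lunit_def field_simps)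
    moreover have "k * inverse g \<in> local_ring R P"
      using k(1) a(2) by (auto simp: lunit_def intro: loc_intros)
    ultimately show False using one_not_unif_mult by blast
  qed
  have "1 \<notin> I" using not_I[of 1 0 1] lunit_1 by simp
  have "is_prime R I" unfolding is_prime_def
  proof (intro conjI ballI impI I \<open>1 \<notin> I\<close>)
    fix a b assume ab: "a \<in> R" "b \<in> R" "a * b \<in> I"
    show "a \<in> I \<or> b \<in> I"
    proof (rule ccontr)
      assume "\<not> (a \<in> I \<or> b \<in> I)"
      then obtain i j g h where "a = \<pi> ^ i * g" "b = \<pi> ^ j * h" "lunit P g" "lunit P h"
        using fact ab by metis
      hence "a * b = \<pi> ^ (i + j) * (g * h)" "lunit P (g * h)"
        by (auto simp: power_add lunit_mult)
      thus False using not_I ab(3) by blast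
    qed
  qed
  have "f \<notin> I"
  proof
    assume "f \<in> I"
    hence "is_maximal R I" using prime_maximal \<open>is_prime R I\<close> assms(2) by blast
    moreover have "I \<subseteq> P"
    proof
      fix a assume a: "a \<in> I"
      then obtain g where "g \<in> local_ring R P" "a = \<pi> ^ 1 * g" unfolding I_def by blast
      thus "a \<in> P" using unif_mult_in_R[of a g] a by (simp add: I_def)
    qed
    ultimately have "P = I" using maximal_eqI P by blast
    \<comment> \<open>Since \<open>P = I\<close>, the numerator of \<open>\<pi> = x / y\<close> is
      divisible by \<open>\<pi> ^ 2\<close>; cancelling one factor makes \<open>y\<close> a multiple
      of \<pi>, although \<open>y\<close> is outside \<open>P\<close>.\<close>
    obtain x y where *: "\<pi> = x / y" "x \<in> P" "y \<in> R" "y \<notin> P" using unif_form by blast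
    then obtain g where g: "g \<in> local_ring R P" "x = \<pi> ^ 2 * g" using \<open>P = I\<close> unfolding I_def by blast
    have "x = \<pi> * y" using * not_P_nonzero[OF P, of y] by simp
    hence "y = \<pi> * g" using g(2) unif_nonzero by (simp add: power2_eq_square)
    thus False using unif_mult_in_R[OF *(3) g(1)] *(4) by blast
  qed
  thus ?thesis using fact assms(1) by blast
qed

lemma factorization:
  assumes "f \<in> frac_field R" "f \<noteq> 0"
  shows "\<exists>n g. lunit P g \<and> f = \<pi> powi n * g"
proof -
  obtain x y where xy: "f = x / y" "x \<in> R" "y \<in> R" "y \<noteq> 0" by (rule frac_fieldE[OF assms(1)])
  hence "x \<noteq> 0" using assms(2) by auto
  obtain m g where g: "lunit P g" "x = \<pi> ^ m * g" using factorization_R[OF xy(2) \<open>x \<noteq> 0\<close>] by blast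
  obtain n h where h: "lunit P h" "y = \<pi> ^ n * h" using factorization_R[OF xy(3,4)] by blast
  have "f = \<pi> powi (int m - int n) * (g * inverse h)"
    using g h xy unif_nonzero by (simp add: power_int_diff field_simps)
  thus ?thesis using g(1) h(1) lunit_mult lunit_inverse by blast
qed

end

lemma uniformizer_unique:
  assumes \<pi>: "uniformizer R P \<pi>" and \<rho>: "uniformizer R P \<rho>"
  shows "\<exists>u. lunit P u \<and> \<pi> = \<rho> * u"
proof -
  have 1: "\<exists>u\<in>local_ring R P. \<pi> = \<rho> * u" if "uniformizer R P \<pi>" "uniformizer R P \<rho>" for \<pi> \<rho>
    using unif_form[OF that(1)] unif_div[OF that(2)] by metis
  obtain u where u: "u \<in> local_ring R P" "\<pi> = \<rho> * u" using 1[OF \<pi> \<rho>] by blast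
  obtain v where v: "v \<in> local_ring R P" "\<rho> = \<pi> * v" using 1[OF \<rho> \<pi>] by blast
  have "\<pi> \<noteq> 0" by (rule unif_nonzero[OF \<pi>])
  hence "u * v = 1" using u(2) v(2) by (metis mult.assoc mult_cancel_left2)
  hence "u \<noteq> 0" "inverse u = v" by (auto simp: inverse_unique)
  thus ?thesis using u v unfolding lunit_def by auto
qed

text \<open>Shows that the \<open>THE\<close> in \<open>ord_at\<close> is well defined: another
  uniformizer differs from \<pi> by a local unit, which is absorbed into \<open>g\<close>, and no
  nonzero power of a uniformizer is a unit.\<close>

lemma ord_eqI:
  assumes \<pi>: "uniformizer R P \<pi>" and g: "lunit P g" and f: "f = \<pi> powi n * g"
  shows "ord_at R P f = n"
proof -
  have "m = n" if "uniformizer R P \<rho>" "h \<in> local_ring R P" "h \<noteq> 0" "inverse h \<in> local_ring R P"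
    "f = \<rho> powi m * h" for m \<rho> h
  proof -
    obtain u where u: "lunit P u" "\<pi> = \<rho> * u" using uniformizer_unique[OF \<pi> \<open>uniformizer R P \<rho>\<close>] by blast
    have \<rho>0: "\<rho> \<noteq> 0" by (rule unif_nonzero[OF that(1)])
    have h: "lunit P h" using that by (simp add: lunit_def)
    have "\<rho> powi m * h = \<rho> powi n * (u powi n * g)"
      using f that(5) u(2) by (simp add: power_int_mult_distrib)
    hence eq: "\<rho> powi (m - n) = u powi n * g * inverse h" "\<rho> powi (n - m) = h * inverse (u powi n * g)"
      using \<rho>0 h g u(1) by (auto simp: power_int_diff lunit_def field_simps)
    have "lunit P (\<rho> powi (m - n))" "lunit P (\<rho> powi (n - m))"
      unfolding eq by (intro lunit_mult lunit_inverse lunit_powi u g h)+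
    hence "\<not> m - n > 0" "\<not> n - m > 0" using unif_power_not_unit[OF that(1)] by blast+
    thus "m = n" by simp
  qed
  moreover have "\<exists>\<pi> g. uniformizer R P \<pi> \<and> g \<in> local_ring R P \<and> g \<noteq> 0 \<and> inverse g \<in> local_ring R P \<and> f = \<pi> powi n * g"
    using assms unfolding lunit_def by blast
  ultimately show ?thesis unfolding ord_at_def by (intro the_equality) blast+
qed

lemma ordE:
  assumes "uniformizer R P \<pi>" "f \<in> frac_field R" "f \<noteq> 0"
  obtains g where "lunit P g" "f = \<pi> powi ord_at R P f * g"
  using factorization[OF assms] ord_eqI[OF assms(1)] by metis

lemma ord_lunit: "lunit P g \<Longrightarrow> ord_at R P g = 0"
  using uniformizer_exists[OF P] ord_eqI[of _ g g 0] by auto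

lemma ord_unif: "uniformizer R P \<pi> \<Longrightarrow> ord_at R P \<pi> = 1"
  using ord_eqI[of \<pi> 1 \<pi> 1] lunit_1 by simp

lemma ord_mult:
  assumes "f \<in> frac_field R" "f \<noteq> 0" "g \<in> frac_field R" "g \<noteq> 0"
  shows "ord_at R P (f * g) = ord_at R P f + ord_at R P g"
proof -
  obtain \<pi> where \<pi>: "uniformizer R P \<pi>" using uniformizer_exists[OF P] by blast
  obtain u where u: "lunit P u" "f = \<pi> powi ord_at R P f * u" by (rule ordE[OF \<pi> assms(1,2)])
  obtain v where v: "lunit P v" "g = \<pi> powi ord_at R P g * v" by (rule ordE[OF \<pi> assms(3,4)])
  have "f * g = (\<pi> powi ord_at R P f * u) * (\<pi> powi ord_at R P g * v)" using u(2) v(2) by simp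
  hence "f * g = \<pi> powi (ord_at R P f + ord_at R P g) * (u * v)"
    using unif_nonzero[OF \<pi>] by (simp add: power_int_add mult_ac)
  thus ?thesis by (rule ord_eqI[OF \<pi> lunit_mult[OF u(1) v(1)]])
qed

lemma ord_1: "ord_at R P 1 = 0"
  by (rule ord_lunit[OF lunit_1])

lemma ord_inverse:
  assumes "f \<in> frac_field R" "f \<noteq> 0"
  shows "ord_at R P (inverse f) = - ord_at R P f"
  using ord_mult[OF assms frac_field_inverse[OF assms(1)]] assms(2) ord_1 by simp

lemma ord_power:
  assumes "f \<in> frac_field R" "f \<noteq> 0"
  shows "ord_at R P (f ^ n) = int n * ord_at R P f"
  using assms by (induction n) (auto simp: ord_1 ord_mult frac_intros algebra_simps)

lemma ord_powi:
  assumes "f \<in> frac_field R" "f \<noteq> 0"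
  shows "ord_at R P (f powi n) = n * ord_at R P f"
  using assms ord_power[OF frac_field_inverse[OF assms(1)], of "nat (- n)"]
  by (auto simp: power_int_def ord_power ord_inverse)

lemma ord_ge_0_iff:
  assumes "f \<in> frac_field R" "f \<noteq> 0"
  shows "0 \<le> ord_at R P f \<longleftrightarrow> f \<in> local_ring R P"
proof -
  obtain \<pi> where \<pi>: "uniformizer R P \<pi>" using uniformizer_exists[OF P] by blast
  obtain u where u: "lunit P u" "f = \<pi> powi ord_at R P f * u" by (rule ordE[OF \<pi> assms])
  show ?thesis
  proof
    assume "0 \<le> ord_at R P f"
    hence "\<pi> powi ord_at R P f \<in> local_ring R P"
      using unif_local[OF \<pi>] by (auto simp: power_int_def intro: loc_intros)
    thus "f \<in> local_ring R P" using u by (metis loc_intros(4) lunit_def)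
  next
    assume f: "f \<in> local_ring R P"
    show "0 \<le> ord_at R P f"
    proof (rule ccontr)
      assume neg: "\<not> 0 \<le> ord_at R P f"
      have "inverse f \<in> local_ring R P"
      proof -
        have "inverse f = \<pi> ^ nat (- ord_at R P f) * inverse u"
          using neg by (subst u(2)) (simp add: power_int_def power_inverse)
        thus ?thesis using u(1) unif_local[OF \<pi>] by (auto simp: lunit_def intro: loc_intros)
      qed
      hence "lunit P f" using f assms(2) by (simp add: lunit_def)
      thus False using ord_lunit neg by simp
    qed
  qed
qed

lemma ord_R_ge_0: "x \<in> R \<Longrightarrow> x \<noteq> 0 \<Longrightarrow> 0 \<le> ord_at R P x"
  by (simp add: ord_ge_0_iff frac_field_incl local_ring_incl[OF P])

lemma ord_R_pos_iff:
  assumes "x \<in> R" "x \<noteq> 0"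
  shows "0 < ord_at R P x \<longleftrightarrow> x \<in> P"
proof
  assume "0 < ord_at R P x"
  thus "x \<in> P" using lunit_R[OF assms(1)] ord_lunit by fastforce
next
  assume "x \<in> P"
  obtain \<pi> where \<pi>: "uniformizer R P \<pi>" using uniformizer_exists[OF P] by blast
  obtain g where g: "g \<in> local_ring R P" "x = \<pi> * g" using unif_div_P[OF \<pi> \<open>x \<in> P\<close>] by blast
  have "g \<noteq> 0" using g assms(2) by auto
  have "ord_at R P x = ord_at R P \<pi> + ord_at R P g"
    unfolding g(2) using local_ring_frac[OF P] unif_local[OF \<pi>] unif_nonzero[OF \<pi>] g \<open>g \<noteq> 0\<close>
    by (intro ord_mult) auto
  thus "0 < ord_at R P x"
    using ord_unif[OF \<pi>] ord_ge_0_iff[OF local_ring_frac[OF P g(1)] \<open>g \<noteq> 0\<close>] g(1) by simp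
qed

text \<open>If \<open>f\<close> has the smaller order, write \<open>f + g = f * (1 + g / f)\<close>;
  the second factor lies in the local ring.\<close>

lemma ord_add_ge:
  assumes "f \<in> frac_field R" "f \<noteq> 0" "g \<in> frac_field R" "g \<noteq> 0" "f + g \<noteq> 0"
  shows "min (ord_at R P f) (ord_at R P g) \<le> ord_at R P (f + g)"
proof -
  have *: "ord_at R P f \<le> ord_at R P (f + g)"
    if "f \<in> frac_field R" "f \<noteq> 0" "g \<in> frac_field R" "g \<noteq> 0" "f + g \<noteq> 0" "ord_at R P f \<le> ord_at R P g" for f g
  proof -
    have inv: "inverse f \<in> frac_field R" "inverse f \<noteq> 0" using that by (auto intro: frac_intros)
    have "ord_at R P (g * inverse f) \<ge> 0"
      using ord_mult[OF that(3,4) inv] ord_inverse[OF that(1,2)] that(6) by simp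
    hence "g * inverse f \<in> local_ring R P"
      using that inv by (subst (asm) ord_ge_0_iff) (auto intro: subring_mult[OF frac_field_subring])
    hence "1 + g * inverse f \<in> local_ring R P"
      by (rule subring_add[OF local_ring_subring[OF P] loc_intros(2)])
    moreover have eq: "f * (1 + g * inverse f) = f + g" using that(2) by (simp add: field_simps)
    moreover have nz: "1 + g * inverse f \<noteq> 0" using eq that(5) by auto
    moreover have fr: "1 + g * inverse f \<in> frac_field R" using that inv by (auto intro: frac_intros)
    ultimately show ?thesis
      using ord_mult[OF that(1,2) fr nz] ord_ge_0_iff[OF fr nz] by simp
  qed
  show ?thesis
    using *[OF assms] *[of g f] assms by (cases "ord_at R P f \<le> ord_at R P g") (auto simp: add.commute)
qed

end

text \<open>\<open>R\<close> is the intersection of its local rings: the denominators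
  \<open>a\<close> with \<open>a * f\<close> in \<open>R\<close> form an ideal that no maximal ideal
  contains. The same device recurs in \<open>section_integral\<close>.\<close>

lemma in_R_if_ord_ge_0:
  assumes "f \<in> frac_field R" "f \<noteq> 0" "\<And>P. is_maximal R P \<Longrightarrow> 0 \<le> ord_at R P f"
  shows "f \<in> R"
proof -
  define I where "I = {a \<in> R. a * f \<in> R}"
  have I: "is_ideal R I"
    unfolding is_ideal_def I_def by (auto intro: R_intros simp: distrib_right mult.assoc)
  have "1 \<in> I"
  proof (rule ccontr)
    assume "1 \<notin> I"
    then obtain P where P: "is_maximal R P" "I \<subseteq> P"
      using exists_maximal_ideal[OF subring noeth I] by blast
    hence "f \<in> local_ring R P" using assms(3)[OF P(1)] ord_ge_0_iff[OF P(1) assms(1,2)] by simp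
    then obtain x y where xy: "f = x / y" "x \<in> R" "y \<in> R" "y \<notin> P" by (rule local_ringE)
    hence "y \<in> I" using not_P_nonzero[OF P(1), of y] by (simp add: I_def)
    thus False using P(2) xy(4) by blast
  qed
  thus ?thesis by (simp add: I_def)
qed

lemma finite_ord_nonzero:
  assumes "f \<in> frac_field R" "f \<noteq> 0"
  shows "finite {P. is_maximal R P \<and> ord_at R P f \<noteq> 0}"
proof -
  obtain x y where xy: "f = x / y" "x \<in> R" "y \<in> R" "y \<noteq> 0" by (rule frac_fieldE[OF assms(1)])
  hence "x \<noteq> 0" using assms(2) by auto
  have "ord_at R P f = 0" if P: "is_maximal R P" "x \<notin> P" "y \<notin> P" for P
  proof -
    have "lunit P (x * inverse y)"
      using xy P by (intro lunit_mult[OF P(1)] lunit_inverse[OF P(1)] lunit_R[OF P(1)])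
    thus ?thesis using ord_lunit[OF P(1)] xy(1) by (simp add: divide_inverse)
  qed
  hence "{P. is_maximal R P \<and> ord_at R P f \<noteq> 0} \<subseteq>
         {P. is_maximal R P \<and> x \<in> P} \<union> {P. is_maximal R P \<and> y \<in> P}" by blast
  thus ?thesis
    using finite_maximal_over[OF xy(2) \<open>x \<noteq> 0\<close>] finite_maximal_over[OF xy(3,4)]
    by (auto intro: finite_subset)
qed

text \<open>If \<open>f\<close> had negative order at \<open>P\<close>, its inverse would lie in the
  local ring, and the monic equation divided by \<open>f ^ (n - 1)\<close> would express
  \<open>f\<close> as a polynomial in that inverse.\<close>

lemma integrally_closed:
  assumes "f \<in> frac_field R" "integral_over R f"
  shows "f \<in> R"
proof (cases "f = 0")
  case True
  thus ?thesis using R_intros(1) by simp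
next
  case False
  show ?thesis
  proof (rule in_R_if_ord_ge_0[OF assms(1) False])
    fix P assume P: "is_maximal R P"
    note loc = subring_intros[OF local_ring_subring[OF P]]
    show "0 \<le> ord_at R P f"
    proof (rule ccontr)
      assume neg: "\<not> 0 \<le> ord_at R P f"
      have inv: "inverse f \<in> local_ring R P"
        using neg ord_ge_0_iff[OF P frac_field_inverse[OF assms(1)]] ord_inverse[OF P assms(1) False] False by simp
      obtain p where p: "lead_coeff p = 1" "poly_over R p" "poly p f = 0"
        using assms(2) by (auto simp: integral_over_def)
      define n where "n = degree p"
      have "n \<noteq> 0"
      proof
        assume "n = 0"
        then obtain c where "p = [:c:]" using degree_eq_zeroE n_def by metis
        thus False using p(1,3) by simp
      qed
      have "(\<Sum>i<n. coeff p i * f ^ i) + f ^ n = (\<Sum>i\<le>n. coeff p i * f ^ i)"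
        using p(1) by (simp add: n_def lessThan_Suc_atMost[symmetric])
      also have "\<dots> = 0" using p(3) by (simp add: poly_altdef n_def)
      finally have "f ^ n = - (\<Sum>i<n. coeff p i * f ^ i)"
        by (metis add.commute eq_neg_iff_add_eq_0)
      hence "f ^ n * inverse f ^ (n - 1) = - (\<Sum>i<n. coeff p i * (f ^ i * inverse f ^ (n - 1)))"
        by (simp add: sum_distrib_right mult.assoc)
      also have "(\<Sum>i<n. coeff p i * (f ^ i * inverse f ^ (n - 1))) = (\<Sum>i<n. coeff p i * inverse f ^ (n - 1 - i))"
      proof (intro sum.cong refl)
        fix i assume "i \<in> {..<n}"
        hence "inverse f ^ (n - 1) = inverse f ^ i * inverse f ^ (n - 1 - i)" by (simp flip: power_add)
        hence "f ^ i * inverse f ^ (n - 1) = (f * inverse f) ^ i * inverse f ^ (n - 1 - i)"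
          by (simp only: power_mult_distrib mult.assoc)
        thus "coeff p i * (f ^ i * inverse f ^ (n - 1)) = coeff p i * inverse f ^ (n - 1 - i)"
          using False by simp
      qed
      also have "f ^ n * inverse f ^ (n - 1) = f"
        using \<open>n \<noteq> 0\<close> False by (cases n) (auto simp: field_simps)
      finally have "f = - (\<Sum>i<n. coeff p i * inverse f ^ (n - 1 - i))" .
      moreover have "- (\<Sum>i<n. coeff p i * inverse f ^ (n - 1 - i)) \<in> local_ring R P"
        using p(2) inv local_ring_incl[OF P] by (intro loc) (auto simp: poly_over_def)
      ultimately have "f \<in> local_ring R P" by simp
      thus False using neg ord_ge_0_iff[OF P assms(1) False] by simp
    qed
  qed
qed

end

section \<open>Integrally closed one-dimensional Noetherian domains\<close>

context noetherian_dim1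
begin

text \<open>From normality to regularity in dimension one. For a nonzero \<open>f\<close> in
  \<open>Q\<close>, the ideal \<open>Q\<close> is itself a quotient ideal \<open>(f R : g)\<close>,
  so \<open>y = g / f\<close> is outside \<open>R\<close> but multiplies \<open>Q\<close> into
  \<open>R\<close>. If it multiplied \<open>Q\<close> into \<open>Q\<close>, it would be integral
  and lie in \<open>R\<close>. Hence \<open>y * \<pi>\<close> is a local unit for some \<pi> in
  \<open>Q\<close>, and this \<pi> is a uniformizer.\<close>

lemma uniformizer_if_integrally_closed:
  assumes closed: "\<And>f. f \<in> frac_field R \<Longrightarrow> integral_over R f \<Longrightarrow> f \<in> R"
    and Q: "is_maximal R Q"
  shows "\<exists>\<pi>. uniformizer R Q \<pi>"
proof -
  obtain f where f: "f \<in> Q" "f \<noteq> 0" using maximal_nonzero[OF Q] by blast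
  have fR: "f \<in> R" using maximal_subset[OF Q f(1)] .
  define ann where "ann g = {a \<in> R. a * g / f \<in> R}" for g
  have ann_ideal: "is_ideal R (ann g)" for g
    unfolding is_ideal_def ann_def
    by (auto intro: R_intros simp: distrib_right add_divide_distrib mult.assoc)
       (metis R_intros(4) times_divide_eq_right)
  \<comment> \<open>Restricting the competition to quotient ideals inside \<open>Q\<close> takes the
    place of localising at \<open>Q\<close>.\<close>
  define F where "F = {ann g | g. g \<in> R \<and> ann g \<subseteq> Q}"
  have "ann 1 \<subseteq> Q"
  proof
    fix a assume "a \<in> ann 1"
    hence "a / f \<in> R" by (simp add: ann_def)
    hence "a / f * f \<in> Q" using f(1) is_idealD(4)[OF maximal_ideal[OF Q]] by blast
    thus "a \<in> Q" using f(2) by simp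
  qed
  hence "F \<noteq> {}" using R_intros(2) unfolding F_def by blast
  have "is_ideal R J" if "J \<in> F" for J using that ann_ideal by (auto simp: F_def)
  from noetherian_has_maximal[OF subring noeth \<open>F \<noteq> {}\<close> this]
  obtain M where M: "M \<in> F" "\<forall>J\<in>F. M \<subseteq> J \<longrightarrow> J = M" ..
  then obtain g where g: "g \<in> R" "ann g \<subseteq> Q" "M = ann g" unfolding F_def by blast
  have ann_mono: "ann g \<subseteq> ann (g * c)" if "c \<in> R" for c
  proof
    fix a assume "a \<in> ann g"
    hence "a \<in> R" "a * g / f * c \<in> R" using that by (auto simp: ann_def intro: R_intros simp del: times_divide_eq_left)
    thus "a \<in> ann (g * c)" by (simp add: ann_def mult.assoc)
  qed
  have max_eq: "ann (g * c) = ann g" if "c \<in> R" "ann (g * c) \<subseteq> Q" for c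
  proof -
    have "ann (g * c) \<in> F" unfolding F_def using that g(1) R_intros(4) by blast
    thus ?thesis using M(2) ann_mono[OF that(1)] g(3) by blast
  qed
  have "1 \<notin> ann g" using g(2) maximal_not_1[OF Q] by blast
  have "is_prime R (ann g)" unfolding is_prime_def
  proof (intro conjI ballI impI ann_ideal \<open>1 \<notin> ann g\<close>)
    fix a b assume ab: "a \<in> R" "b \<in> R" "a * b \<in> ann g"
    show "a \<in> ann g \<or> b \<in> ann g"
    proof (rule ccontr)
      assume not: "\<not> (a \<in> ann g \<or> b \<in> ann g)"
      have "b \<in> ann (g * a)" using ab by (simp add: ann_def mult_ac)
      \<comment> \<open>By maximality \<open>g * a\<close> is not a competitor. A witness
        \<open>c\<close> outside \<open>Q\<close> behaves like a unit: passing from \<open>g\<close>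
        to \<open>g * c\<close> keeps the ideal inside \<open>Q\<close>, hence unchanged, yet the
        new ideal contains \<open>a\<close>.\<close>
      hence "\<not> ann (g * a) \<subseteq> Q" using not max_eq[OF ab(1)] by blast
      then obtain c where c: "c \<in> ann (g * a)" "c \<notin> Q" by blast
      have cR: "c \<in> R" using c(1) by (simp add: ann_def)
      have "ann (g * c) \<subseteq> Q"
      proof
        fix e assume e: "e \<in> ann (g * c)"
        hence "e \<in> R" "e * c \<in> ann g" using cR by (auto simp: ann_def mult_ac intro: R_intros)
        thus "e \<in> Q" using g(2) maximal_multD[OF Q _ cR] c(2) by blast
      qed
      moreover have "a \<in> ann (g * c)" using c(1) ab(1) by (simp add: ann_def mult_ac)
      ultimately show False using max_eq[OF cR] not by blast
    qed
  qed
  moreover have "f \<in> ann g" using fR f(2) g(1) by (simp add: ann_def)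
  ultimately have "is_maximal R (ann g)" using f(2) by (intro prime_maximal)
  hence ann_Q: "ann g = Q" using maximal_eqI Q g(2) by blast
  define y where "y = g / f"
  have yQ: "y * z \<in> R" if "z \<in> Q" for z
  proof -
    have "z \<in> ann g" using that ann_Q by simp
    thus ?thesis by (simp add: ann_def y_def mult.commute)
  qed
  have "y \<notin> R" using \<open>1 \<notin> ann g\<close> R_intros(2) by (simp add: ann_def y_def)
  have "\<exists>\<pi>\<in>Q. y * \<pi> \<notin> Q"
  proof (rule ccontr)
    assume "\<not> (\<exists>\<pi>\<in>Q. y * \<pi> \<notin> Q)"
    hence stab: "y * z \<in> Q" if "z \<in> Q" for z using that by blast
    note T = polys_at_subring[OF subring, of y]
    \<comment> \<open>\<open>f * R[y]\<close> is contained in \<open>Q\<close>, so it is an ideal of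
      the Noetherian ring \<open>R\<close>; its generators divided by \<open>f\<close> generate
      \<open>R[y]\<close> as an \<open>R\<close>-module.\<close>
    define J where "J = {f * x | x. x \<in> polys_at R y}"
    have JQ: "f * poly p y \<in> Q" if "poly_over R p" for p
    proof -
      have "z * poly p y \<in> Q" if "z \<in> Q" for z
        using \<open>poly_over R p\<close> that
      proof (induction p arbitrary: z)
        case 0
        thus ?case using zero_in_P[OF Q] by simp
      next
        case (pCons a p)
        have "a * z + (y * z) * poly p y \<in> Q"
        proof (rule is_idealD(3)[OF maximal_ideal[OF Q]])
          show "a * z \<in> Q"
            using pCons.prems by (intro is_idealD(4)[OF maximal_ideal[OF Q]]) (auto simp: poly_over_pCons[OF subring])
          show "(y * z) * poly p y \<in> Q"
            using pCons.prems stab by (intro pCons.IH) (auto simp: poly_over_pCons[OF subring])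
        qed
        thus ?case by (simp add: algebra_simps)
      qed
      thus ?thesis using f(1) by blast
    qed
    have J: "is_ideal R J" unfolding is_ideal_def
    proof (intro conjI ballI)
      show "J \<subseteq> R" using JQ maximal_subset[OF Q] by (auto simp: J_def polys_at_def)
      show "0 \<in> J" unfolding J_def using subring_0[OF T] by (intro CollectI exI[of _ 0]) simp
    next
      fix a b assume "a \<in> J" "b \<in> J"
      then obtain p q where "a = f * p" "b = f * q" "p \<in> polys_at R y" "q \<in> polys_at R y" by (auto simp: J_def)
      thus "a + b \<in> J" unfolding J_def
        by (intro CollectI exI[of _ "p + q"]) (auto simp: distrib_left intro: subring_add[OF T])
    next
      fix r a assume "r \<in> R" "a \<in> J"
      then obtain p where "a = f * p" "p \<in> polys_at R y" "r \<in> polys_at R y"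
        using polys_at_incl[OF subring, of y] by (auto simp: J_def)
      thus "r * a \<in> J" unfolding J_def
        by (intro CollectI exI[of _ "r * p"]) (auto intro: subring_mult[OF T])
    qed
    then obtain S where S: "finite S" "S \<subseteq> J" "J = lspan R S"
      using noeth unfolding noetherian_def by blast
    have "polys_at R y = lspan R ((\<lambda>x. x / f) ` S)"
    proof (intro equalityI subsetI)
      fix x assume "x \<in> polys_at R y"
      hence "f * x \<in> lspan R S" using S(3) by (auto simp: J_def)
      moreover have "lspan R S \<subseteq> {z. z / f \<in> lspan R ((\<lambda>x. x / f) ` S)}"
      proof (rule lspan_least[OF subring])
        show "S \<subseteq> {z. z / f \<in> lspan R ((\<lambda>x. x / f) ` S)}"
          using S(1) by (auto intro: lspan_gen[OF subring])
        show "r * x \<in> {z. z / f \<in> lspan R ((\<lambda>x. x / f) ` S)}"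
          if "r \<in> R" "x \<in> {z. z / f \<in> lspan R ((\<lambda>x. x / f) ` S)}" for r x
          using lspan_scale[OF subring that(1), of "x / f"] that(2) by simp
      qed (auto simp: add_divide_distrib intro: lspan_0[OF subring] lspan_add[OF subring])
      ultimately have "f * x / f \<in> lspan R ((\<lambda>x. x / f) ` S)" by blast
      thus "x \<in> lspan R ((\<lambda>x. x / f) ` S)" using f(2) by simp
    next
      fix x assume x: "x \<in> lspan R ((\<lambda>x. x / f) ` S)"
      have "lspan R ((\<lambda>x. x / f) ` S) \<subseteq> polys_at R y"
      proof (rule lspan_least[OF subring])
        show "(\<lambda>x. x / f) ` S \<subseteq> polys_at R y"
        proof clarify
          fix s assume "s \<in> S"
          then obtain p where "s = f * p" "p \<in> polys_at R y" using S(2) by (auto simp: J_def)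
          thus "s / f \<in> polys_at R y" using f(2) by simp
        qed
      qed (use polys_at_incl[OF subring, of y] in \<open>auto intro: subring_intros[OF T]\<close>)
      thus "x \<in> polys_at R y" using x by blast
    qed
    hence "module_finite R (polys_at R y)"
      unfolding module_finite_def using S(1) T polys_at_incl[OF subring] by blast
    hence "integral_over R y"
      using module_finite_imp_integral[OF subring] polys_at_gen[OF subring] by blast
    thus False using closed[of y] \<open>y \<notin> R\<close> frac_fieldI[OF g(1) fR f(2)] by (simp add: y_def)
  qed
  then obtain \<pi> where \<pi>: "\<pi> \<in> Q" "y * \<pi> \<notin> Q" by blast
  define e where "e = y * \<pi>"
  have e: "e \<in> R" "e \<notin> Q" using yQ[OF \<pi>(1)] \<pi>(2) by (simp_all add: e_def)
  have "e \<noteq> 0" by (rule not_P_nonzero[OF Q e(2)])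
  have "{x / z | x z. x \<in> Q \<and> z \<in> R - Q} = {\<pi> * h | h. h \<in> local_ring R Q}"
  proof (intro equalityI subsetI)
    fix q assume "q \<in> {x / z | x z. x \<in> Q \<and> z \<in> R - Q}"
    then obtain x z where xz: "q = x / z" "x \<in> Q" "z \<in> R" "z \<notin> Q" by blast
    have "q = \<pi> * ((y * x) / (e * z))"
      using xz \<open>e \<noteq> 0\<close> by (auto simp: e_def)
    moreover have "(y * x) / (e * z) \<in> local_ring R Q"
      using yQ xz e not_P_mult[OF Q] by (intro local_ringI) (auto intro: R_intros)
    ultimately show "q \<in> {\<pi> * h | h. h \<in> local_ring R Q}" by blast
  next
    fix q assume "q \<in> {\<pi> * h | h. h \<in> local_ring R Q}"
    then obtain h where h: "q = \<pi> * h" "h \<in> local_ring R Q" by blast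
    obtain x z where xz: "h = x / z" "x \<in> R" "z \<in> R" "z \<notin> Q" by (rule local_ringE[OF h(2)])
    have "q = (\<pi> * x) / z" "\<pi> * x \<in> Q"
      using h(1) xz is_idealD(5)[OF maximal_ideal[OF Q] xz(2) \<pi>(1)] by auto
    thus "q \<in> {x / z | x z. x \<in> Q \<and> z \<in> R - Q}" using xz by blast
  qed
  thus ?thesis unfolding uniformizer_def by blast
qed

end

section \<open>Radical extensions in the presence of roots of unity\<close>

text \<open>\<open>s\<close> is an arbitrary \<open>k\<close>-th root, with no irreducibility of
  \<open>T ^ k - t\<close>. The embedding \<iota> of the complex numbers supplies the roots of unity
  that Kummer theory requires.\<close>

locale radical_extension =
  h: field_hom h + \<iota>: field_hom \<iota>
  for h :: "'a::field \<Rightarrow> 'b::alg_closed_field" and \<iota> :: "complex \<Rightarrow> 'a" +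
  fixes s :: 'b and t :: 'a and k :: nat
  assumes k_pos: "k > 0" and t_nonzero: "t \<noteq> 0" and s_power: "s ^ k = h t"
begin

definition ev :: "'a poly \<Rightarrow> 'b \<Rightarrow> 'b" where
  "ev p x = poly (map_poly h p) x"

lemma ev_simps [simp]:
  "ev 0 x = 0" "ev 1 x = 1" "ev (pCons a p) x = h a + x * ev p x" "ev (p + q) x = ev p x + ev q x"
  "ev (p - q) x = ev p x - ev q x" "ev (p * q) x = ev p x * ev q x" "ev (monom a n) x = h a * x ^ n"
proof -
  interpret map_poly_comm_ring_hom h ..
  show "ev 0 x = 0" "ev 1 x = 1" "ev (pCons a p) x = h a + x * ev p x" "ev (p + q) x = ev p x + ev q x"
    "ev (p - q) x = ev p x - ev q x" "ev (p * q) x = ev p x * ev q x" "ev (monom a n) x = h a * x ^ n"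
    by (simp_all add: ev_def hom_distribs poly_monom)
qed

lemma ev_altdef: "degree p < n \<Longrightarrow> ev p x = (\<Sum>i<n. h (coeff p i) * x ^ i)"
proof -
  assume "degree p < n"
  hence "(\<Sum>i<n. h (coeff p i) * x ^ i) = (\<Sum>i\<le>degree p. h (coeff p i) * x ^ i)"
    by (intro sum.mono_neutral_right) (auto simp: coeff_eq_0)
  thus ?thesis by (simp add: ev_def poly_altdef)
qed

lemma range_h_subring: "is_subring (range h)"
  by (rule subring_image[OF h.field_hom_axioms]) (simp add: is_subring_def)

lemmas poly_over_range_h = poly_over_image[OF h.field_hom_axioms]

lemma s_nonzero: "s \<noteq> 0"
proof
  assume "s = 0"
  hence "h t = 0" using s_power k_pos by (simp add: power_0_left)
  thus False using t_nonzero by simp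
qed

text \<open>The complex numbers already contribute \<open>n\<close> distinct roots of
  \<open>T ^ n - 1\<close>, as many as any field can contain.\<close>

lemma root_of_unity_in_range:
  assumes "x ^ n = (1::'b)" "n > 0"
  shows "\<exists>z. x = h (\<iota> z) \<and> z ^ n = 1"
proof -
  define p where "p = monom 1 n - (1 :: 'b poly)"
  have deg: "degree p = n"
    unfolding p_def using degree_add_eq_left[of "-1" "monom (1::'b) n"] assms(2)
    by (simp add: degree_monom_eq)
  have p: "poly p y = 0 \<longleftrightarrow> y ^ n = 1" for y
    by (simp add: p_def poly_monom)
  have "p \<noteq> 0" using deg assms(2) by auto
  have fin: "finite {y. poly p y = 0}" by (rule poly_roots_finite[OF \<open>p \<noteq> 0\<close>])
  have inj: "inj (\<lambda>z. h (\<iota> z))"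
    using h.inj_f \<iota>.inj_f by (auto simp: inj_def)
  have sub: "(\<lambda>z. h (\<iota> z)) ` {z. z ^ n = 1} \<subseteq> {y. poly p y = 0}"
    by (auto simp: p simp flip: h.hom_power \<iota>.hom_power)
  have "card {y. poly p y = 0} \<le> n"
    using card_poly_roots_bound[OF \<open>p \<noteq> 0\<close>] deg by simp
  also have "n = card ((\<lambda>z. h (\<iota> z)) ` {z. z ^ n = 1})"
    using card_image[OF inj_on_subset[OF inj subset_UNIV]] card_roots_unity_eq[OF assms(2)] by metis
  finally have "(\<lambda>z. h (\<iota> z)) ` {z. z ^ n = 1} = {y. poly p y = 0}"
    by (intro card_seteq fin sub)
  moreover have "x \<in> {y. poly p y = 0}" using assms(1) p by simp
  ultimately show ?thesis by blast
qed

text \<open>By \<open>rdeg_le_degree\<close> this is the degree of \<open>s\<close> over the base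
  field. It may be smaller than \<open>k\<close>.\<close>

definition rdeg :: nat where
  "rdeg = (LEAST m. m > 0 \<and> s ^ m \<in> range h)"

lemma rdeg: "rdeg > 0" "s ^ rdeg \<in> range h"
  using LeastI[of "\<lambda>m. m > 0 \<and> s ^ m \<in> range h" k] k_pos s_power unfolding rdeg_def by auto

lemma rdeg_least: "m > 0 \<Longrightarrow> s ^ m \<in> range h \<Longrightarrow> rdeg \<le> m"
  unfolding rdeg_def by (rule Least_le) simp

text \<open>The conjugates of \<open>s\<close> are its multiples by roots of unity, so the constant coefficient of its
  minimal polynomial is, up to an element of the base field, a power of \<open>s\<close>.\<close>

lemma rdeg_le_degree:
  assumes "p \<noteq> 0" "ev p s = 0"
  shows "rdeg \<le> degree p"
proof -
  obtain q where q: "q \<noteq> 0" "ev q s = 0" and q_min: "\<And>r. r \<noteq> 0 \<Longrightarrow> ev r s = 0 \<Longrightarrow> degree q \<le> degree r"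
    using ex_has_least_nat[of "\<lambda>p. p \<noteq> 0 \<and> ev p s = 0" p degree] assms by blast
  define f where "f = monom 1 k - [:t:]"
  have ev_f: "ev f x = x ^ k - h t" for x by (simp add: f_def)
  have "q dvd f"
  proof (rule ccontr)
    assume "\<not> q dvd f"
    hence nz: "f mod q \<noteq> 0" by auto
    have "ev f s = ev (f div q * q + f mod q) s" by simp
    hence "ev (f mod q) s = 0" unfolding ev_simps using q(2) ev_f s_power by simp
    hence "degree q \<le> degree (f mod q)" using q_min nz by blast
    thus False using degree_mod_less[OF q(1), of f] nz by simp
  qed
  then obtain e where e: "f = q * e" by (rule dvdE)
  have "map_poly h q \<noteq> 0" using q(1) by simp
  then obtain A where A: "size A = degree (map_poly h q)"
    "map_poly h q = Polynomial.smult (lead_coeff (map_poly h q)) (\<Prod>x\<in>#A. [:-x, 1:])"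
    using alg_closed_imp_factorization by metis
  have "\<exists>a. a \<noteq> 0 \<and> x = h a * s" if "x \<in># A" for x
  proof -
    have "poly (\<Prod>x\<in>#A. [:-x, 1:]) x = 0" using that by (simp add: poly_prod_mset)
    hence "ev q x = 0" unfolding ev_def by (subst A(2)) simp
    hence "x ^ k = s ^ k" using ev_f[of x] s_power by (simp add: e)
    hence "(x / s) ^ k = 1" using s_nonzero by (simp add: power_divide)
    then obtain z where z: "x / s = h (\<iota> z)" "z ^ k = 1"
      using root_of_unity_in_range k_pos by blast
    have "z \<noteq> 0" using z(2) k_pos by (auto simp: power_0_left)
    thus ?thesis using z(1) s_nonzero by (intro exI[of _ "\<iota> z"]) (auto simp: field_simps)
  qed
  hence "\<exists>a. a \<noteq> 0 \<and> (\<Prod>x\<in>#A. - x) = h a * s ^ size A"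
  proof (induction A)
    case empty
    thus ?case by (intro exI[of _ 1]) simp
  next
    case (add x A)
    then obtain a b where "a \<noteq> 0" "(\<Prod>x\<in>#A. - x) = h a * s ^ size A" "b \<noteq> 0" "x = h b * s"
      by (metis union_single_eq_member union_iff add_mset_add_single)
    thus ?case by (intro exI[of _ "- a * b"]) (simp add: hom_distribs)
  qed
  then obtain a where a: "a \<noteq> 0" "(\<Prod>x\<in>#A. - x) = h a * s ^ size A" by blast
  have "h (coeff q 0) = poly (map_poly h q) 0" by (simp add: poly_0_coeff_0)
  also have "\<dots> = h (lead_coeff q) * (h a * s ^ size A)"
    unfolding a(2)[symmetric] by (subst A(2)) (simp add: poly_prod_mset)
  finally have "s ^ degree q = h (coeff q 0 / (lead_coeff q * a))"
    using a(1) q(1) A(1) by (simp add: hom_distribs field_simps)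
  moreover have "degree q > 0"
  proof (rule ccontr)
    assume "\<not> degree q > 0"
    then obtain c where "q = [:c:]" using degree_eq_zeroE by blast
    thus False using q by simp
  qed
  ultimately have "rdeg \<le> degree q" using rdeg_least by blast
  thus ?thesis using q_min[OF assms] by simp
qed

definition radicand :: 'a where "radicand = (SOME c. s ^ rdeg = h c)"

lemma radicand: "s ^ rdeg = h radicand"
  unfolding radicand_def by (rule someI_ex) (use rdeg(2) in blast)

lemma radicand_nonzero: "radicand \<noteq> 0"
  using radicand s_nonzero by (metis h.hom_zero power_eq_0_iff)

definition minpoly :: "'a poly" where "minpoly = monom 1 rdeg - [:radicand:]"

lemma degree_minpoly: "degree minpoly = rdeg"
  unfolding minpoly_def using degree_add_eq_left[of "- [:radicand:]" "monom 1 rdeg"] rdeg(1)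
  by (simp add: degree_monom_eq del: minus_pCons)

lemma minpoly_nonzero: "minpoly \<noteq> 0"
  using degree_minpoly rdeg(1) by auto

lemma ev_minpoly: "ev minpoly x = x ^ rdeg - h radicand"
  by (simp add: minpoly_def)

lemma minpoly_dvd:
  assumes "ev g s = 0"
  shows "minpoly dvd g"
proof (rule ccontr)
  assume "\<not> minpoly dvd g"
  hence nz: "g mod minpoly \<noteq> 0" by auto
  have "ev g s = ev (g div minpoly * minpoly + g mod minpoly) s" by (simp only: div_mult_mod_eq)
  hence "ev (g mod minpoly) s = 0" unfolding ev_simps using assms ev_minpoly radicand by simp
  hence "rdeg \<le> degree (g mod minpoly)" using rdeg_le_degree nz by blast
  thus False using degree_mod_less[OF minpoly_nonzero, of g] nz degree_minpoly by simp
qed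

definition radical_field :: "'b set" where
  "radical_field = polys_at (range h) s"

lemma radical_field_subring: "is_subring radical_field"
  unfolding radical_field_def by (rule polys_at_subring[OF range_h_subring])

lemma range_h_radical_field: "h x \<in> radical_field"
  unfolding radical_field_def using polys_at_incl[OF range_h_subring] by blast

lemma s_radical_field: "s \<in> radical_field"
  unfolding radical_field_def by (rule polys_at_gen[OF range_h_subring])

lemmas radical_intros = subring_intros[OF radical_field_subring] range_h_radical_field s_radical_field

lemma radical_fieldE:
  assumes "x \<in> radical_field"
  obtains F where "degree F < rdeg" "x = ev F s"
proof -
  obtain p where p: "poly_over (range h) p" "x = poly p s"
    using assms by (auto simp: radical_field_def polys_at_def)
  obtain q where q: "p = map_poly h q" using poly_over_range_h p(1) by blast
  have "ev q s = ev (q div minpoly * minpoly + q mod minpoly) s" by (simp only: div_mult_mod_eq)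
  hence "x = ev (q mod minpoly) s" unfolding ev_simps using p(2) q ev_minpoly radicand by (simp add: ev_def)
  moreover have "degree (q mod minpoly) < rdeg"
    using degree_mod_less[OF minpoly_nonzero, of q] degree_minpoly rdeg(1) by auto
  ultimately show ?thesis using that by blast
qed

lemma range_h_inverse: "x \<in> range h \<Longrightarrow> inverse x \<in> range h"
  by (auto simp flip: h.hom_inverse)

lemma radical_field_integral:
  assumes "x \<in> radical_field"
  shows "integral_over (range h) x"
proof -
  note I = integral_closure_subring[OF range_h_subring]
  have "integral_over (range h) s"
    using integral_root[OF range_h_subring k_pos] integral_incl[OF range_h_subring] s_power by auto
  hence "radical_field \<subseteq> {x. integral_over (range h) x}"
    unfolding radical_field_def
    by (intro polys_at_least[OF range_h_subring I]) (auto intro: integral_incl[OF range_h_subring])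
  thus ?thesis using assms by blast
qed

text \<open>An equation with constant term \<open>c \<noteq> 0\<close> has the form
  \<open>c + x * q(x) = 0\<close>, which displays the inverse as a polynomial in
  \<open>x\<close>.\<close>

lemma radical_field_inverse:
  assumes "x \<in> radical_field"
  shows "inverse x \<in> radical_field"
proof (cases "x = 0")
  case True
  thus ?thesis using radical_intros(1) by simp
next
  case False
  obtain p where p: "poly_over (range h) p" "poly p x = 0" "coeff p 0 \<noteq> 0"
    using integral_nonzero_const[OF radical_field_integral[OF assms] False] by blast
  obtain c q where cq: "p = pCons c q" by (cases p)
  have c: "c \<noteq> 0" "c \<in> range h" and q: "poly_over (range h) q"
    using p cq by (auto simp: poly_over_pCons[OF range_h_subring])
  have "x * poly q x = - c" using p(2) cq by (simp add: add_eq_0_iff)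
  hence "x * (- (inverse c * poly q x)) = 1" using c by (simp add: field_simps)
  hence "inverse x = - (inverse c * poly q x)" by (rule inverse_unique)
  moreover have "poly q x \<in> radical_field"
  proof (rule poly_in_subring[OF radical_field_subring _ assms])
    have "range h \<subseteq> radical_field" using range_h_radical_field by blast
    thus "poly_over radical_field q" using q unfolding poly_over_def by blast
  qed
  moreover have "inverse c \<in> radical_field"
    using range_h_inverse[OF c(2)] range_h_radical_field by auto
  ultimately show ?thesis by (auto intro: radical_intros)
qed

text \<open>The substitution \<open>s \<mapsto> \<zeta> s\<close> is a conjugation over the base field, hence preserves integrality.\<close>

lemma integral_conjugate:
  assumes R: "is_subring R" and "integral_over (h ` R) (ev F s)" "z ^ rdeg = 1"
  shows "integral_over (h ` R) (ev F (z * s))"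
proof -
  obtain P where P: "lead_coeff P = 1" "poly_over (h ` R) P" "poly P (ev F s) = 0"
    using assms(2) by (auto simp: integral_over_def)
  obtain P0 where P0: "P = map_poly h P0" using poly_over_range_h[OF P(2)] by blast
  \<comment> \<open>\<open>P(F(T))\<close> has coefficients in the base field and vanishes at
    \<open>s\<close>. It is therefore a multiple of \<open>minpoly\<close>, of which
    \<open>z * s\<close> is another root.\<close>
  define G where "G = pcompose P0 F"
  have ev_G: "ev G x = poly P (ev F x)" for x
    by (simp add: G_def ev_def P0 h.map_poly_pcompose poly_pcompose)
  have "minpoly dvd G" by (rule minpoly_dvd) (simp add: ev_G P(3))
  then obtain q where q: "G = minpoly * q" by (rule dvdE)
  have "ev minpoly (z * s) = 0"
    using assms(3) radicand by (simp add: ev_minpoly power_mult_distrib)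
  hence "poly P (ev F (z * s)) = 0" using ev_G[of "z * s"] q by simp
  thus ?thesis using P(1,2) unfolding integral_over_def by blast
qed

text \<open>All conjugates \<open>F(\<zeta> s)\<close> are integral, and discrete Fourier inversion
  over the roots of unity of order dividing \<open>rdeg\<close> recovers the single term of index
  \<open>i\<close>.\<close>

lemma integral_component:
  assumes R: "is_subring R" "range \<iota> \<subseteq> R" and F: "degree F < rdeg" "integral_over (h ` R) (ev F s)"
    and i: "i < rdeg"
  shows "integral_over (h ` R) (h (coeff F i) * s ^ i)"
proof -
  define w where "w = cis (2 * pi / real rdeg)"
  have w_pow: "w ^ j = cis (2 * pi * real j / real rdeg)" for j
    by (simp add: w_def DeMoivre mult_ac)
  have w_inj: "w ^ i = w ^ j \<longleftrightarrow> i = j" if "i < rdeg" "j < rdeg" for i j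
    using bij_betw_roots_unity[OF rdeg(1)] that unfolding w_pow bij_betw_def inj_on_def by blast
  have "w ^ rdeg = 1" using rdeg(1) by (simp add: w_pow)
  have "w \<noteq> 0" by (simp add: w_def)
  \<comment> \<open>Orthogonality of the characters of a cyclic group: for
    \<open>l \<noteq> i\<close> the ratio \<open>q\<close> is a nontrivial root of unity, and its
    geometric sum vanishes.\<close>
  have sum_w: "(\<Sum>j<rdeg. inverse w ^ (i * j) * w ^ (j * l)) = (if l = i then of_nat rdeg else 0)"
    if "l < rdeg" for l
  proof -
    define q where "q = w ^ l * inverse w ^ i"
    have "inverse w ^ (i * j) * w ^ (j * l) = q ^ j" for j
      by (simp add: q_def power_mult_distrib power_mult mult.commute flip: power_mult)
    hence eq: "(\<Sum>j<rdeg. inverse w ^ (i * j) * w ^ (j * l)) = (\<Sum>j<rdeg. q ^ j)" by simp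
    show ?thesis
    proof (cases "l = i")
      case True
      hence "q = 1" using \<open>w \<noteq> 0\<close> by (simp add: q_def flip: power_mult_distrib)
      thus ?thesis using eq True by simp
    next
      case False
      hence "w ^ l \<noteq> w ^ i" using w_inj that i by blast
      hence "q \<noteq> 1" using \<open>w \<noteq> 0\<close> by (simp add: q_def field_simps)
      moreover have "q ^ rdeg = (w ^ rdeg) ^ l * inverse ((w ^ rdeg) ^ i)"
        by (simp add: q_def power_mult_distrib power_inverse mult.commute flip: power_mult)
      hence "q ^ rdeg = 1" using \<open>w ^ rdeg = 1\<close> by simp
      ultimately have "(\<Sum>j<rdeg. q ^ j) = 0" by (simp add: geometric_sum)
      thus ?thesis using eq False by simp
    qed
  qed
  define e where "e z = h (\<iota> z)" for z
  have e_simps: "e (x * y) = e x * e y" "e (x ^ n) = e x ^ n" "e (sum f A) = (\<Sum>a\<in>A. e (f a))"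
    "e 0 = 0" "e 1 = 1" "e (of_nat n) = of_nat n" for x y n A and f :: "nat \<Rightarrow> complex"
    by (simp_all add: e_def hom_distribs)
  note hR = subring_image[OF h.field_hom_axioms R(1)]
  note I = integral_closure_subring[OF hR]
  have e_int: "integral_over (h ` R) (e z)" for z
    using R(2) by (intro integral_incl[OF hR]) (auto simp: e_def)
  have conj: "integral_over (h ` R) (ev F (e (w ^ j) * s))" for j
  proof (rule integral_conjugate[OF R(1) F(2)])
    have "w ^ (j * rdeg) = (w ^ rdeg) ^ j" by (simp add: mult.commute flip: power_mult)
    thus "e (w ^ j) ^ rdeg = 1" using \<open>w ^ rdeg = 1\<close>
      by (simp add: e_simps(5) flip: e_simps(2) power_mult)
  qed
  have "(\<Sum>j<rdeg. e (inverse w ^ (i * j)) * ev F (e (w ^ j) * s)) =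
        (\<Sum>j<rdeg. \<Sum>l<rdeg. h (coeff F l) * s ^ l * e (inverse w ^ (i * j) * w ^ (j * l)))"
    unfolding ev_altdef[OF F(1)] sum_distrib_left
    by (intro sum.cong refl) (simp add: e_simps power_mult_distrib power_mult mult_ac)
  also have "\<dots> = (\<Sum>l<rdeg. h (coeff F l) * s ^ l * e (\<Sum>j<rdeg. inverse w ^ (i * j) * w ^ (j * l)))"
    unfolding e_simps(3) sum_distrib_left by (rule sum.swap)
  also have "\<dots> = (\<Sum>l<rdeg. if l = i then h (coeff F l) * s ^ l * of_nat rdeg else 0)"
    by (intro sum.cong refl) (simp add: sum_w e_simps)
  also have "\<dots> = h (coeff F i) * s ^ i * of_nat rdeg" using i by simp
  finally have sum_eq: "(\<Sum>j<rdeg. e (inverse w ^ (i * j)) * ev F (e (w ^ j) * s)) =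
    h (coeff F i) * s ^ i * e (of_nat rdeg)" by (simp add: e_simps)
  \<comment> \<open>Division by \<open>rdeg\<close> preserves integrality because \<open>R\<close>
    contains the complex constants.\<close>
  have "e (inverse (of_nat rdeg)) * (\<Sum>j<rdeg. e (inverse w ^ (i * j)) * ev F (e (w ^ j) * s)) \<in> {x. integral_over (h ` R) x}"
    using conj e_int by (intro subring_mult[OF I] subring_sum[OF I]) auto
  also have "e (inverse (of_nat rdeg)) * (\<Sum>j<rdeg. e (inverse w ^ (i * j)) * ev F (e (w ^ j) * s)) =
      h (coeff F i) * s ^ i * e (inverse (of_nat rdeg) * of_nat rdeg)"
    unfolding sum_eq by (simp only: e_simps mult_ac)
  also have "inverse (of_nat rdeg) * of_nat rdeg = (1::complex)" using rdeg(1) by simp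
  finally show ?thesis by (simp add: e_simps)
qed

end

section \<open>The integral closure in a radical extension\<close>

locale curve_extension =
  radical_extension h \<iota> s t k + A: dedekind R
  for h :: "'a::field \<Rightarrow> 'b::alg_closed_field" and \<iota> s t k and R :: "'a set" +
  fixes S :: "'a set"
  assumes frac_R: "frac_field R = UNIV"
    and S: "finite S" "R = generate_ring ring_of_type_algebra (range \<iota> \<union> S)"
begin

lemma range_iota_R: "range \<iota> \<subseteq> R"
  unfolding S(2) using generate_ring_incl[of "range \<iota> \<union> S"] by blast

lemmas hR_subring = subring_image[OF h.field_hom_axioms A.subring]

lemmas int_closure = integral_closure_subring[OF hR_subring]

definition ext :: "'b set" where
  "ext = {x \<in> radical_field. integral_over (h ` R) x}"

lemma extI: "x \<in> radical_field \<Longrightarrow> integral_over (h ` R) x \<Longrightarrow> x \<in> ext"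
  and ext_radical: "x \<in> ext \<Longrightarrow> x \<in> radical_field"
  and ext_integral: "x \<in> ext \<Longrightarrow> integral_over (h ` R) x"
  by (auto simp: ext_def)

lemma ext_subring: "is_subring ext"
  using radical_field_subring int_closure unfolding is_subring_def ext_def by blast

lemmas ext_intros = subring_intros[OF ext_subring]

lemma h_ext: "x \<in> R \<Longrightarrow> h x \<in> ext"
  by (intro extI range_h_radical_field integral_incl[OF hR_subring]) auto

lemma h_ext_iff: "h x \<in> ext \<longleftrightarrow> x \<in> R"
proof
  assume "h x \<in> ext"
  hence "integral_over R x" by (intro integral_hom_reflect[OF h.field_hom_axioms] ext_integral)
  thus "x \<in> R" using A.integrally_closed frac_R by simp
qed (rule h_ext)

text \<open>The \<open>rdeg\<close>-th power of \<open>f s^i\<close> is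
  \<open>f ^ rdeg * radicand ^ i\<close>, an element of \<open>R\<close>. Multiplying it by
  \<open>y ^ (rdeg - i) * z ^ i\<close> gives \<open>(y * f) ^ rdeg\<close>, so \<open>y * f\<close>
  is integral over \<open>R\<close>. The denominator \<open>y\<close> serves all \<open>i\<close> at
  once.\<close>

lemma component_denominator:
  assumes "y \<in> R" "z \<in> R" "y \<noteq> 0" "z \<noteq> 0" "radicand = y / z" "i < rdeg" "h f * s ^ i \<in> ext"
  shows "y * f \<in> R"
proof -
  have "integral_over (h ` R) ((h f * s ^ i) ^ rdeg)"
    using assms(7) subring_power[OF int_closure] ext_integral by blast
  also have "(h f * s ^ i) ^ rdeg = h (f ^ rdeg * radicand ^ i)"
    using radicand by (simp add: power_mult_distrib hom_distribs mult.commute[of i] flip: power_mult)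
       (metis mult.commute power_mult)
  finally have "f ^ rdeg * radicand ^ i \<in> R"
    using A.integrally_closed frac_R by (metis UNIV_I h.field_hom_axioms integral_hom_reflect)
  moreover have "y ^ (rdeg - i) * z ^ i \<in> R" using assms by (intro A.R_intros)
  ultimately have "(f ^ rdeg * radicand ^ i) * (y ^ (rdeg - i) * z ^ i) \<in> R"
    by (rule A.R_intros(4))
  also have "(f ^ rdeg * radicand ^ i) * (y ^ (rdeg - i) * z ^ i) =
      f ^ rdeg * ((radicand * z) ^ i * y ^ (rdeg - i))"
    by (simp add: power_mult_distrib mult_ac)
  also have "radicand * z = y" using assms by simp
  also have "f ^ rdeg * (y ^ i * y ^ (rdeg - i)) = (y * f) ^ rdeg"
    using assms(6) by (simp add: power_mult_distrib mult.commute flip: power_add)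
  finally have "integral_over R (y * f)"
    using integral_root[OF A.subring rdeg(1)] integral_incl[OF A.subring] by blast
  thus ?thesis using A.integrally_closed frac_R by simp
qed

lemma ext_component:
  assumes "degree F < rdeg" "ev F s \<in> ext" "i < rdeg"
  shows "h (coeff F i) * s ^ i \<in> ext"
  by (intro extI integral_component[OF A.subring range_iota_R assms(1) ext_integral[OF assms(2)] assms(3)])
     (auto intro: radical_intros)

text \<open>Each homogeneous component of \<open>ext\<close> becomes, after multiplication by the
  common denominator \<open>y\<close>, an ideal \<open>J i\<close> of the Noetherian ring
  \<open>R\<close>. Generators of these ideals, together with those of \<open>R\<close>, generate
  \<open>ext\<close>.\<close>

lemma ext_generated: "\<exists>T. finite T \<and> ext = generate_ring ring_of_type_algebra (range (h \<circ> \<iota>) \<union> T)"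
proof -
  obtain y z where yz: "radicand = y / z" "y \<in> R" "z \<in> R" "z \<noteq> 0"
    using frac_fieldE[of radicand R] frac_R by blast
  have "y \<noteq> 0" using yz(1) radicand_nonzero by auto
  define J where "J i = {y * f | f. h f * s ^ i \<in> ext}" for i
  have J_ideal: "is_ideal R (J i)" if "i < rdeg" for i
    unfolding is_ideal_def
  proof (intro conjI ballI)
    show "J i \<subseteq> R"
      using component_denominator[OF yz(2,3) \<open>y \<noteq> 0\<close> yz(4,1) that] by (auto simp: J_def)
    show "0 \<in> J i" unfolding J_def using ext_intros(1) by (intro CollectI exI[of _ 0]) simp
  next
    fix a b assume "a \<in> J i" "b \<in> J i"
    then obtain f g where *: "a = y * f" "b = y * g" "h f * s ^ i \<in> ext" "h g * s ^ i \<in> ext"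
      by (auto simp: J_def)
    have "h (f + g) * s ^ i \<in> ext"
      using ext_intros(3)[OF *(3,4)] by (simp add: hom_distribs distrib_right)
    thus "a + b \<in> J i" unfolding J_def using * by (intro CollectI exI[of _ "f + g"]) (simp add: distrib_left)
  next
    fix r a assume r: "r \<in> R" and "a \<in> J i"
    then obtain f where *: "a = y * f" "h f * s ^ i \<in> ext" by (auto simp: J_def)
    have "h (r * f) * s ^ i \<in> ext"
      using ext_intros(4)[OF h_ext[OF r] *(2)] by (simp add: hom_distribs mult.assoc)
    thus "r * a \<in> J i" unfolding J_def using * by (intro CollectI exI[of _ "r * f"]) simp
  qed
  have "\<exists>T. finite T \<and> T \<subseteq> J i \<and> J i = lspan R T" if "i < rdeg" for i
    using A.noeth J_ideal[OF that] unfolding noetherian_def by blast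
  hence "\<forall>i. \<exists>T. i < rdeg \<longrightarrow> finite T \<and> T \<subseteq> J i \<and> J i = lspan R T" by blast
  from choice[OF this] obtain T where
    "\<forall>i. i < rdeg \<longrightarrow> finite (T i) \<and> T i \<subseteq> J i \<and> J i = lspan R (T i)" ..
  hence T: "i < rdeg \<Longrightarrow> finite (T i)" "i < rdeg \<Longrightarrow> T i \<subseteq> J i" "i < rdeg \<Longrightarrow> J i = lspan R (T i)" for i
    by blast+
  define U where "U = h ` S \<union> (\<Union>i<rdeg. (\<lambda>g. h (g / y) * s ^ i) ` T i)"
  define G where "G = generate_ring ring_of_type_algebra (range (h \<circ> \<iota>) \<union> U)"
  have G: "is_subring G" unfolding G_def by (rule generate_ring_subring)
  have GI: "x \<in> range (h \<circ> \<iota>) \<union> U \<Longrightarrow> x \<in> G" for x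
    unfolding G_def by (rule subsetD[OF generate_ring_incl])
  have finU: "finite U" using S(1) T(1) by (auto simp: U_def)
  have "is_subring {r. h r \<in> G}"
    using subring_1[OF G] subring_diff[OF G] subring_mult[OF G]
    unfolding is_subring_def by (auto simp: hom_distribs)
  hence "R \<subseteq> {r. h r \<in> G}"
    unfolding S(2) by (rule generate_ring_least) (use GI in \<open>auto simp: U_def\<close>)
  hence hR_G: "h r \<in> G" if "r \<in> R" for r using that by blast
  have "U \<subseteq> ext"
  proof
    fix x assume "x \<in> U"
    then consider r where "x = h r" "r \<in> S" | i g where "i < rdeg" "g \<in> T i" "x = h (g / y) * s ^ i"
      by (auto simp: U_def)
    thus "x \<in> ext"
    proof cases
      case 1
      thus ?thesis using h_ext generate_ring_incl[of "range \<iota> \<union> S"] S(2) by blast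
    next
      case 2
      then obtain f where "g = y * f" "h f * s ^ i \<in> ext" using T(2) by (auto simp: J_def)
      thus ?thesis using 2 \<open>y \<noteq> 0\<close> by simp
    qed
  qed
  moreover have "range (h \<circ> \<iota>) \<subseteq> ext" using range_iota_R h_ext by auto
  ultimately have "G \<subseteq> ext"
    unfolding G_def by (intro generate_ring_least[OF ext_subring]) blast
  moreover have "ext \<subseteq> G"
  proof
    fix x assume x: "x \<in> ext"
    obtain F where F: "degree F < rdeg" "x = ev F s" by (rule radical_fieldE[OF ext_radical[OF x]])
    have "h (coeff F i) * s ^ i \<in> G" if i: "i < rdeg" for i
    proof -
      have "h (coeff F i) * s ^ i \<in> ext" using ext_component[OF F(1) _ i] F(2) x by simp
      hence "y * coeff F i \<in> lspan R (T i)" using T(3)[OF i] by (auto simp: J_def)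
      then obtain c where c: "y * coeff F i = (\<Sum>g\<in>T i. c g * g)" "\<And>g. g \<in> T i \<Longrightarrow> c g \<in> R"
        by (auto simp: lspan_def)
      have "coeff F i = (\<Sum>g\<in>T i. c g * (g / y))"
        using c(1) \<open>y \<noteq> 0\<close> by (simp add: field_simps flip: sum_divide_distrib)
      hence "h (coeff F i) * s ^ i = (\<Sum>g\<in>T i. h (c g) * (h (g / y) * s ^ i))"
        by (simp add: h.hom_sum h.hom_mult sum_distrib_right mult.assoc del: times_divide_eq_right)
      also have "\<dots> \<in> G"
      proof (rule subring_sum[OF G], rule subring_mult[OF G])
        fix g assume g: "g \<in> T i"
        show "h (c g) \<in> G" by (rule hR_G[OF c(2)[OF g]])
        show "h (g / y) * s ^ i \<in> G" using g i by (intro GI) (auto simp: U_def)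
      qed
      finally show ?thesis .
    qed
    thus "x \<in> G" unfolding F(2) ev_altdef[OF F(1)] by (intro subring_sum[OF G]) auto
  qed
  ultimately show ?thesis using finU unfolding G_def by blast
qed

lemma ext_noetherian: "noetherian ext"
proof -
  obtain T where T: "finite T" "ext = generate_ring ring_of_type_algebra (range (h \<circ> \<iota>) \<union> T)"
    using ext_generated by blast
  have F: "is_subring (range (h \<circ> \<iota>))"
    unfolding is_subring_def
    by (auto simp flip: h.hom_minus h.hom_mult \<iota>.hom_minus \<iota>.hom_mult)
  have "inverse x \<in> range (h \<circ> \<iota>)" if "x \<in> range (h \<circ> \<iota>)" for x
    using that by (auto simp flip: h.hom_inverse \<iota>.hom_inverse)
  thus ?thesis unfolding T(2) by (rule noetherian_finitely_generated[OF F _ T(1)])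
qed

section \<open>Contraction of ideals from \<open>ext\<close> to \<open>R\<close>\<close>

definition contract :: "'b set \<Rightarrow> 'a set" where
  "contract Q = {x \<in> R. h x \<in> Q}"

lemma contract_ideal:
  assumes "is_ideal ext J"
  shows "is_ideal R (contract J)"
  unfolding is_ideal_def contract_def
proof (intro conjI ballI)
  fix r x assume "r \<in> R" "x \<in> {x \<in> R. h x \<in> J}"
  thus "r * x \<in> {x \<in> R. h x \<in> J}"
    using is_idealD(4)[OF assms h_ext] by (auto simp: hom_distribs intro: A.R_intros)
qed (use is_idealD(2,3)[OF assms] in \<open>auto simp: hom_distribs intro: A.R_intros\<close>)

text \<open>The nonzero constant term of an equation for \<open>x\<close> is a multiple of
  \<open>x\<close>, hence a nonzero element of \<open>Q\<close> coming from \<open>R\<close>; the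
  contraction is a nonzero prime.\<close>

lemma contract_prime:
  assumes "is_prime ext Q" "x \<in> Q" "x \<noteq> 0"
  shows "is_maximal R (contract Q)"
proof -
  have Q: "is_ideal ext Q" "1 \<notin> Q" using assms(1) by (auto simp: is_prime_def)
  have x: "x \<in> ext" using is_idealD(1)[OF Q(1)] assms(2) by blast
  obtain p where p: "poly_over (h ` R) p" "poly p x = 0" "coeff p 0 \<noteq> 0"
    using integral_nonzero_const[OF ext_integral[OF x] assms(3)] by blast
  obtain c q where cq: "p = pCons c q" by (cases p)
  have c: "c \<noteq> 0" "c \<in> h ` R" and q: "poly_over (h ` R) q"
    using p cq by (auto simp: poly_over_pCons[OF hR_subring])
  have "h ` R \<subseteq> ext" using h_ext by blast
  hence "poly_over ext q" using q by (auto simp: poly_over_def)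
  hence qx: "poly q x \<in> ext" by (rule poly_in_subring[OF ext_subring]) fact
  have "c = - (poly q x * x)" using p(2) cq by (simp add: add_eq_0_iff mult.commute)
  hence "c \<in> Q"
    using ideal_uminus[OF Q(1) ext_subring is_idealD(4)[OF Q(1) qx assms(2)]] by simp
  then obtain r where r: "r \<in> contract Q" "r \<noteq> 0"
    using c by (auto simp: contract_def)
  have "is_prime R (contract Q)"
    unfolding is_prime_def
  proof (intro conjI ballI impI contract_ideal[OF Q(1)])
    show "1 \<notin> contract Q" using Q(2) by (simp add: contract_def)
    fix a b assume "a \<in> R" "b \<in> R" "a * b \<in> contract Q"
    moreover from this have "h a * h b \<in> Q" by (simp add: contract_def hom_distribs)
    ultimately show "a \<in> contract Q \<or> b \<in> contract Q"
      using assms(1) h_ext unfolding is_prime_def contract_def by blast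
  qed
  thus ?thesis using A.prime_maximal r by blast
qed

text \<open>Incomparability in integral extensions: a proper ideal \<open>J\<close> above
  \<open>Q\<close> has the same contraction, since that of \<open>Q\<close> is maximal, and an
  element of \<open>J\<close> outside \<open>Q\<close> would contradict its integral
  equation.\<close>

lemma ext_prime_maximal:
  assumes "is_prime ext Q" "x \<in> Q" "x \<noteq> 0"
  shows "is_maximal ext Q"
  unfolding is_maximal_def
proof (intro conjI allI impI)
  show Q: "is_ideal ext Q" and "1 \<notin> Q" using assms(1) by (auto simp: is_prime_def)
  fix J assume J: "is_ideal ext J" "Q \<subseteq> J" "1 \<notin> J"
  have P: "is_maximal R (contract Q)" by (rule contract_prime[OF assms])
  have "1 \<notin> contract J" using J(3) by (simp add: contract_def)
  moreover have "contract Q \<subseteq> contract J" using J(2) by (auto simp: contract_def)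
  ultimately have contract_eq: "contract J = contract Q"
    using P contract_ideal[OF J(1)] unfolding is_maximal_def by blast
  have "y \<in> Q" if y: "y \<in> J" for y
  proof (rule ccontr)
    assume "y \<notin> Q"
    have yext: "y \<in> ext" using is_idealD(1)[OF J(1)] y by blast
    \<comment> \<open>The induction runs over all monic polynomials over \<open>R\<close>. If a
      value lay in \<open>Q\<close>, the constant term would lie in \<open>J\<close>, hence in
      \<open>Q\<close> by equality of the contractions; then \<open>y\<close> could be cancelled by
      primality, leaving a polynomial of lower degree.\<close>
    have "poly p y \<notin> Q" if "lead_coeff p = 1" "poly_over (h ` R) p" for p
      using that
    proof (induction p)
      case (pCons c q)
      have c: "c \<in> h ` R" and q: "poly_over (h ` R) q"
        using pCons.prems(2) by (auto simp: poly_over_pCons[OF hR_subring])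
      show ?case
      proof (cases "q = 0")
        case True
        thus ?thesis using pCons.prems(1) \<open>1 \<notin> Q\<close> by simp
      next
        case False
        hence IH: "poly q y \<notin> Q" using pCons q by simp
        have "h ` R \<subseteq> ext" using h_ext by blast
        hence "poly_over ext q" using q by (auto simp: poly_over_def)
        hence qy: "poly q y \<in> ext" by (rule poly_in_subring[OF ext_subring]) fact
        show ?thesis
        proof
          assume *: "poly (pCons c q) y \<in> Q"
          have "c = poly (pCons c q) y + - (poly q y * y)" by (simp add: mult.commute)
          also have "\<dots> \<in> J"
            using * J(2) is_idealD(4)[OF J(1) qy y]
            by (intro is_idealD(3)[OF J(1)] ideal_uminus[OF J(1) ext_subring]) auto
          finally have "c \<in> Q" using c contract_eq by (auto simp: contract_def)
          hence "poly (pCons c q) y + - c \<in> Q"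
            using * by (intro is_idealD(3)[OF Q] ideal_uminus[OF Q ext_subring])
          hence "y * poly q y \<in> Q" by simp
          thus False using assms(1) yext qy IH \<open>y \<notin> Q\<close> unfolding is_prime_def by blast
        qed
      qed
    qed simp
    moreover have "0 \<in> Q" using is_idealD(2)[OF Q] .
    ultimately show False using ext_integral[OF yext] unfolding integral_over_def by metis
  qed
  thus "J = Q" using J(2) by blast
qed

lemma exists_maximal_R: "\<exists>P. is_maximal R P"
proof -
  have "is_ideal R {0}" by (auto simp: is_ideal_def intro: A.R_intros)
  thus ?thesis using exists_maximal_ideal[OF A.subring A.noeth, of "{0}"] by auto
qed

lemma principal_ext_ideal: "x \<in> ext \<Longrightarrow> is_ideal ext {r * x | r. r \<in> ext}"
  unfolding is_ideal_def
proof (intro conjI ballI)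
  assume x: "x \<in> ext"
  show "{r * x | r. r \<in> ext} \<subseteq> ext" using x ext_intros(4) by blast
  show "0 \<in> {r * x | r. r \<in> ext}" using ext_intros(1) by force
  fix a b assume "a \<in> {r * x | r. r \<in> ext}" "b \<in> {r * x | r. r \<in> ext}"
  then obtain r r' where "a = r * x" "b = r' * x" "r \<in> ext" "r' \<in> ext" by blast
  thus "a + b \<in> {r * x | r. r \<in> ext}"
    using ext_intros(3) by (intro CollectI exI[of _ "r + r'"]) (auto simp: distrib_right)
next
  fix c a assume "c \<in> ext" "a \<in> {r * x | r. r \<in> ext}"
  then obtain r where "a = r * x" "r \<in> ext" by blast
  thus "c * a \<in> {r * x | r. r \<in> ext}"
    using ext_intros(4)[OF \<open>c \<in> ext\<close>] by (intro CollectI exI[of _ "c * r"]) (auto simp: mult.assoc)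
qed

text \<open>Otherwise \<open>ext\<close> would be a field; the inverse of a nonzero \<open>a\<close>
  in some maximal \<open>P\<close> would then lie in \<open>ext\<close>, and by integral closedness
  in \<open>R\<close>.\<close>

lemma zero_not_maximal: "\<not> is_maximal ext {0}"
proof
  assume max: "is_maximal ext {0}"
  obtain P where P: "is_maximal R P" using exists_maximal_R by blast
  then obtain a where a: "a \<in> P" "a \<noteq> 0" using A.maximal_nonzero by blast
  have aR: "a \<in> R" using A.maximal_subset[OF P a(1)] .
  define J where "J = {r * h a | r. r \<in> ext}"
  have J: "is_ideal ext J" unfolding J_def by (rule principal_ext_ideal[OF h_ext[OF aR]])
  have "1 * h a \<in> J" unfolding J_def using ext_intros(2) by blast
  hence "h a \<in> J" by simp
  hence "J \<noteq> {0}" using a(2) by auto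
  moreover have "{0} \<subseteq> J" using is_idealD(2)[OF J] by simp
  ultimately have "1 \<in> J" using max J unfolding is_maximal_def by blast
  then obtain r where r: "r \<in> ext" "1 = r * h a" by (auto simp: J_def)
  hence "r = h (inverse a)" using a(2) by (simp add: hom_distribs field_simps)
  hence "inverse a \<in> R" using r(1) h_ext_iff by blast
  hence "inverse a * a \<in> P" using a(1) is_idealD(4)[OF A.maximal_ideal[OF P]] by blast
  thus False using a(2) A.maximal_not_1[OF P] by simp
qed

lemma ext_maximal_nonzero: "is_maximal ext Q \<Longrightarrow> \<exists>x\<in>Q. x \<noteq> 0"
  using zero_not_maximal is_idealD(2)[of ext Q] unfolding is_maximal_def by (metis equalityI insert_subset singletonD subsetI)

text \<open>The interpretation is in two stages: uniformizers for \<open>ext\<close> are obtained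
  from integral closedness, whose proof uses the facts about fractions available after this
  stage.\<close>

sublocale B0: noetherian_dim1 ext
  by unfold_locales (auto intro: ext_subring ext_noetherian ext_maximal_nonzero ext_prime_maximal)

text \<open>With \<open>t = y / z\<close>, the \<open>k\<close>-th power of \<open>z * s\<close> is
  \<open>z ^ (k - 1) * y\<close>, so \<open>z * s\<close> is integral and \<open>s\<close> is a
  quotient of elements of \<open>ext\<close>.\<close>

lemma frac_ext: "frac_field ext = radical_field"
proof
  show "frac_field ext \<subseteq> radical_field"
    unfolding frac_field_def divide_inverse
    by (blast intro: radical_intros(4) radical_field_inverse ext_radical)
  have h_frac: "h x \<in> frac_field ext" for x
  proof -
    obtain y z where "x = y / z" "y \<in> R" "z \<in> R" "z \<noteq> 0" using frac_fieldE[of x R] frac_R by blast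
    thus ?thesis using frac_fieldI[OF h_ext h_ext, of y z] by (simp add: hom_distribs)
  qed
  obtain y z where yz: "t = y / z" "y \<in> R" "z \<in> R" "z \<noteq> 0" using frac_fieldE[of t R] frac_R by blast
  have "(h z * s) ^ k = h (z ^ (k - 1) * y)"
    using s_power yz k_pos by (cases k) (auto simp: power_mult_distrib hom_distribs)
  moreover have "z ^ (k - 1) * y \<in> R" using yz by (intro A.R_intros)
  ultimately have "integral_over (h ` R) ((h z * s) ^ k)"
    using integral_incl[OF hR_subring] by (metis imageI)
  hence "h z * s \<in> ext"
    using integral_root[OF hR_subring k_pos] by (intro extI) (auto intro: radical_intros)
  hence "(h z * s) * inverse (h z) \<in> frac_field ext"
    by (rule B0.frac_intros(4)[OF B0.frac_field_incl B0.frac_field_inverse[OF h_frac]])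
  hence "s \<in> frac_field ext" using yz(4) by (simp add: field_simps)
  thus "radical_field \<subseteq> frac_field ext"
    unfolding radical_field_def using h_frac
    by (intro polys_at_least[OF range_h_subring B0.frac_field_subring]) auto
qed

lemma ext_integrally_closed:
  assumes "f \<in> frac_field ext" "integral_over ext f"
  shows "f \<in> ext"
proof (rule extI)
  show "f \<in> radical_field" using assms(1) frac_ext by simp
  show "integral_over (h ` R) f" using integral_trans[OF hR_subring] ext_integral assms(2) by blast
qed

sublocale B: dedekind ext
  by unfold_locales (rule B0.uniformizer_if_integrally_closed[OF ext_integrally_closed])

lemma contract_maximal: "is_maximal ext Q \<Longrightarrow> is_maximal R (contract Q)"
  using contract_prime maximal_imp_prime[OF ext_subring] ext_maximal_nonzero by metis

section \<open>Orders under pullback and ramification\<close>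

lemma h_frac_ext: "h f \<in> frac_field ext"
  using frac_ext range_h_radical_field by simp

lemma s_frac_ext: "s \<in> frac_field ext"
  using frac_ext s_radical_field by simp

context
  fixes Q assumes Q: "is_maximal ext Q"
begin

lemmas P = contract_maximal[OF Q]

lemma h_local_ring: "g \<in> local_ring R (contract Q) \<Longrightarrow> h g \<in> local_ring ext Q"
proof (erule A.local_ringE)
  fix x y assume "g = x / y" "x \<in> R" "y \<in> R" "y \<notin> contract Q"
  thus "h g \<in> local_ring ext Q"
    using B0.local_ringI[of "h x" "h y" Q] h_ext by (simp add: contract_def hom_distribs)
qed

lemma h_lunit: "A.lunit (contract Q) g \<Longrightarrow> B.lunit Q (h g)"
  using h_local_ring by (auto simp: A.lunit_def B.lunit_def simp flip: h.hom_inverse)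

text \<open>Local units at \<open>contract Q\<close> map to local units at \<open>Q\<close>, so only
  the power of \<pi> contributes.\<close>

lemma ord_h:
  assumes \<pi>: "uniformizer R (contract Q) \<pi>" and f: "f \<noteq> 0"
  shows "ord_at ext Q (h f) = ord_at ext Q (h \<pi>) * ord_at R (contract Q) f"
proof -
  have "f \<in> frac_field R" using frac_R by simp
  then obtain g where g: "A.lunit (contract Q) g" "f = \<pi> powi ord_at R (contract Q) f * g"
    by (rule A.ordE[OF P \<pi> _ f])
  define n where "n = ord_at R (contract Q) f"
  have "g \<noteq> 0" using g(1) by (simp add: A.lunit_def)
  have "\<pi> \<noteq> 0" by (rule A.unif_nonzero[OF P \<pi>])
  have powi: "h (\<pi> powi n) = h \<pi> powi n" for n
    by (simp add: power_int_def hom_distribs)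
  have "h f = h \<pi> powi n * h g" using g(2) n_def powi by (metis h.hom_mult)
  moreover have "ord_at ext Q (h \<pi> powi n * h g) = ord_at ext Q (h \<pi> powi n) + ord_at ext Q (h g)"
    using \<open>g \<noteq> 0\<close> \<open>\<pi> \<noteq> 0\<close> by (intro B.ord_mult[OF Q] B0.frac_powi h_frac_ext) auto
  moreover have "ord_at ext Q (h g) = 0" by (rule B.ord_lunit[OF Q h_lunit[OF g(1)]])
  moreover have "ord_at ext Q (h \<pi> powi n) = n * ord_at ext Q (h \<pi>)"
    using \<open>\<pi> \<noteq> 0\<close> by (intro B.ord_powi[OF Q h_frac_ext]) simp
  ultimately show ?thesis by (simp add: n_def)
qed

text \<open>The \<open>THE\<close> is well defined: every uniformizer has order one, so by
  \<open>ord_h\<close> its image has the same order as that of \<pi>.\<close>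

lemma ramification_index_eq:
  assumes \<pi>: "uniformizer R (contract Q) \<pi>"
  shows "ramification_index h R ext Q = ord_at ext Q (h \<pi>)"
  unfolding ramification_index_def contract_def[symmetric]
proof (rule the_equality)
  show "\<exists>\<pi>'. uniformizer R (contract Q) \<pi>' \<and> ord_at ext Q (h \<pi>) = ord_at ext Q (h \<pi>')" using \<pi> by blast
  fix e assume "\<exists>\<rho>. uniformizer R (contract Q) \<rho> \<and> e = ord_at ext Q (h \<rho>)"
  then obtain \<rho> where \<rho>: "uniformizer R (contract Q) \<rho>" "e = ord_at ext Q (h \<rho>)" by blast
  show "e = ord_at ext Q (h \<pi>)"
    using ord_h[OF \<pi> A.unif_nonzero[OF P \<rho>(1)]] A.ord_unif[OF P \<rho>(1)] \<rho>(2) by simp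
qed

lemma ord_pullback:
  assumes "f \<noteq> 0"
  shows "ord_at ext Q (h f) = ramification_index h R ext Q * ord_at R (contract Q) f"
  using A.uniformizer_exists[OF P] ord_h[OF _ assms] ramification_index_eq by metis

lemma ramification_index_nonneg: "0 \<le> ramification_index h R ext Q"
proof -
  obtain \<pi> where \<pi>: "uniformizer R (contract Q) \<pi>" using A.uniformizer_exists[OF P] by blast
  have "h \<pi> \<noteq> 0" using A.unif_nonzero[OF P \<pi>] by simp
  moreover have "h \<pi> \<in> local_ring ext Q" by (rule h_local_ring[OF A.unif_local[OF P \<pi>]])
  ultimately have "0 \<le> ord_at ext Q (h \<pi>)" using B.ord_ge_0_iff[OF Q h_frac_ext] by blast
  thus ?thesis using ramification_index_eq[OF \<pi>] by simp
qed

end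

text \<open>All points over \<open>P\<close> contain the image of one fixed nonzero element of
  \<open>P\<close>.\<close>

lemma finite_fibre:
  assumes "is_maximal R P"
  shows "finite {Q. is_maximal ext Q \<and> contract Q = P}"
proof -
  obtain a where a: "a \<in> P" "a \<noteq> 0" using A.maximal_nonzero[OF assms] by blast
  have aR: "a \<in> R" using A.maximal_subset[OF assms a(1)] .
  have "{Q. is_maximal ext Q \<and> contract Q = P} \<subseteq> {Q. is_maximal ext Q \<and> h a \<in> Q}"
    using a(1) by (auto simp: contract_def)
  moreover have "finite {Q. is_maximal ext Q \<and> h a \<in> Q}"
    using B0.finite_maximal_over[OF h_ext[OF aR]] a(2) by simp
  ultimately show ?thesis by (rule finite_subset)
qed

end

section \<open>Laurent polynomials\<close>

definition laurent_eval :: "'a::field \<Rightarrow> (int \<Rightarrow>\<^sub>0 'a) \<Rightarrow> 'a" where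
  "laurent_eval w p = (\<Sum>n\<in>Poly_Mapping.keys p. Poly_Mapping.lookup p n * w powi n)"

lemma laurent_eval_superset:
  "finite A \<Longrightarrow> Poly_Mapping.keys p \<subseteq> A \<Longrightarrow> laurent_eval w p = (\<Sum>n\<in>A. Poly_Mapping.lookup p n * w powi n)"
  unfolding laurent_eval_def by (rule sum.mono_neutral_left) (auto simp: in_keys_iff)

lemma laurent_eval_0 [simp]: "laurent_eval w 0 = 0"
  by (simp add: laurent_eval_def)

lemma laurent_eval_single [simp]: "laurent_eval w (Poly_Mapping.single n c) = c * w powi n"
  by (subst laurent_eval_superset[of "{n}"]) (auto simp: keys_single)

lemma laurent_eval_add: "laurent_eval w (p + q) = laurent_eval w p + laurent_eval w q"
proof -
  define A where "A = Poly_Mapping.keys p \<union> Poly_Mapping.keys q"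
  have "Poly_Mapping.keys (p + q) \<subseteq> A" using Poly_Mapping.keys_add[of p q] by (simp add: A_def)
  thus ?thesis
    using laurent_eval_superset[of A p w] laurent_eval_superset[of A q w] laurent_eval_superset[of A "p + q" w]
    by (simp add: A_def lookup_add distrib_right sum.distrib)
qed

lemma laurent_eval_sum: "laurent_eval w (\<Sum>i\<in>I. f i) = (\<Sum>i\<in>I. laurent_eval w (f i))"
  by (induction I rule: infinite_finite_induct) (auto simp: laurent_eval_add)

lemma laurent_eval_1 [simp]: "laurent_eval w 1 = 1"
  using laurent_eval_single[of w 0 1] by (simp del: laurent_eval_single)

lemma sum_singles:
  fixes p :: "int \<Rightarrow>\<^sub>0 'a::comm_monoid_add"
  shows "(\<Sum>n\<in>Poly_Mapping.keys p. Poly_Mapping.single n (Poly_Mapping.lookup p n)) = p"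
proof (rule poly_mapping_eqI)
  fix m
  show "Poly_Mapping.lookup (\<Sum>n\<in>Poly_Mapping.keys p. Poly_Mapping.single n (Poly_Mapping.lookup p n)) m =
        Poly_Mapping.lookup p m"
    by (cases "m \<in> Poly_Mapping.keys p")
       (auto simp: lookup_sum lookup_single when_def in_keys_iff sum.delta cong: if_cong)
qed

lemma mult_singles:
  fixes p q :: "int \<Rightarrow>\<^sub>0 'a::comm_semiring_0"
  shows "p * q = (\<Sum>i\<in>Poly_Mapping.keys p. \<Sum>j\<in>Poly_Mapping.keys q.
    Poly_Mapping.single (i + j) (Poly_Mapping.lookup p i * Poly_Mapping.lookup q j))"
  by (subst (1 2) sum_singles[symmetric]) (simp add: sum_product mult_single)

lemma laurent_eval_mult:
  assumes "w \<noteq> 0"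
  shows "laurent_eval w (p * q) = laurent_eval w p * laurent_eval w q"
proof -
  have "laurent_eval w (p * q) = (\<Sum>i\<in>Poly_Mapping.keys p. \<Sum>j\<in>Poly_Mapping.keys q.
      (Poly_Mapping.lookup p i * w powi i) * (Poly_Mapping.lookup q j * w powi j))"
    unfolding mult_singles[of p q] laurent_eval_sum using assms
    by (intro sum.cong refl) (simp add: power_int_add mult_ac)
  thus ?thesis by (simp add: laurent_eval_def sum_product)
qed

lemma laurent_eval_power: "w \<noteq> 0 \<Longrightarrow> laurent_eval w (p ^ n) = laurent_eval w p ^ n"
  by (induction n) (auto simp: laurent_eval_mult)

lemma laurent_eval_uminus: "laurent_eval w (- p) = - laurent_eval w p"
proof -
  have "laurent_eval w p + laurent_eval w (- p) = 0" by (simp flip: laurent_eval_add)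
  thus ?thesis by (simp add: add_eq_0_iff)
qed

lemma laurent_eval_diff: "laurent_eval w (p - q) = laurent_eval w p - laurent_eval w q"
  using laurent_eval_add[of w p "- q"] laurent_eval_uminus[of w q] by simp

lemma lookup_mult_eq:
  fixes p q :: "int \<Rightarrow>\<^sub>0 'a::comm_semiring_0"
  shows "Poly_Mapping.lookup (p * q) n =
    (\<Sum>i\<in>Poly_Mapping.keys p. Poly_Mapping.lookup p i * Poly_Mapping.lookup q (n - i))"
proof -
  have "(\<Sum>j\<in>Poly_Mapping.keys q. Poly_Mapping.lookup (Poly_Mapping.single (i + j) (Poly_Mapping.lookup p i * Poly_Mapping.lookup q j)) n) =
        Poly_Mapping.lookup p i * Poly_Mapping.lookup q (n - i)" for i
  proof -
    have "(\<Sum>j\<in>Poly_Mapping.keys q. Poly_Mapping.lookup (Poly_Mapping.single (i + j) (Poly_Mapping.lookup p i * Poly_Mapping.lookup q j)) n) =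
      (\<Sum>j\<in>Poly_Mapping.keys q. if j = n - i then Poly_Mapping.lookup p i * Poly_Mapping.lookup q j else 0)"
      by (intro sum.cong refl) (auto simp: lookup_single when_def)
    thus ?thesis by (simp add: in_keys_iff)
  qed
  thus ?thesis by (simp add: mult_singles[of p q] lookup_sum)
qed

definition laurent_over :: "'a::comm_ring_1 set \<Rightarrow> (int \<Rightarrow>\<^sub>0 'a) set" where
  "laurent_over K = {p. \<forall>n. Poly_Mapping.lookup p n \<in> K}"

lemma laurent_over_subring:
  assumes "is_subring K"
  shows "is_subring (laurent_over K)"
  unfolding is_subring_def laurent_over_def
  by (auto simp: lookup_one when_def lookup_minus lookup_mult_eq intro!: subring_intros[OF assms])

lemma laurent_over_single: "is_subring K \<Longrightarrow> c \<in> K \<Longrightarrow> Poly_Mapping.single n c \<in> laurent_over K"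
  by (auto simp: laurent_over_def lookup_single when_def intro: subring_0)

lemma integral_over_field:
  fixes K :: "'a::field set"
  assumes K: "is_subring K" "\<And>x. x \<in> K \<Longrightarrow> inverse x \<in> K"
    and p: "p \<noteq> 0" "poly_over K p" "poly p x = 0"
  shows "integral_over K x"
proof -
  have "poly_over K (Polynomial.smult (inverse (lead_coeff p)) p)"
    using K p by (intro poly_over_smult) (auto simp: poly_over_def)
  thus ?thesis
    unfolding integral_over_def using p by (intro exI[of _ "Polynomial.smult (inverse (lead_coeff p)) p"]) auto
qed

text \<open>Multiplication by \<open>w powi (- N)\<close>, with \<open>N\<close> the least exponent,
  turns the relation into a nonzero polynomial equation, which is made monic over the field
  \<open>K\<close>.\<close>

lemma laurent_relation_integral:
  fixes K :: "'a::field set"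
  assumes K: "is_subring K" "\<And>x. x \<in> K \<Longrightarrow> inverse x \<in> K"
    and p: "p \<in> laurent_over K" "p \<noteq> 0" "laurent_eval w p = 0" and w: "w \<noteq> 0"
  shows "integral_over K w"
proof -
  let ?A = "Poly_Mapping.keys p"
  have "?A \<noteq> {}" using p(2) by (metis poly_mapping_eqI lookup_zero in_keys_iff empty_iff)
  define N where "N = Min ?A"
  have N: "N \<le> n" if "n \<in> ?A" for n using that by (simp add: N_def)
  obtain M where M: "M \<in> ?A" using \<open>?A \<noteq> {}\<close> by blast
  define P where "P = (\<Sum>n\<in>?A. monom (Poly_Mapping.lookup p n) (nat (n - N)))"
  have "poly P w = (\<Sum>n\<in>?A. w powi (- N) * (Poly_Mapping.lookup p n * w powi n))"
    unfolding P_def poly_sum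
  proof (intro sum.cong refl)
    fix n assume "n \<in> ?A"
    hence "w ^ nat (n - N) = w powi (n - N)" using N by (simp add: power_int_def)
    also have "\<dots> = w powi (- N) * w powi n" using w power_int_add[of w "- N" n] by simp
    finally show "poly (monom (Poly_Mapping.lookup p n) (nat (n - N))) w =
        w powi (- N) * (Poly_Mapping.lookup p n * w powi n)" by (simp add: poly_monom)
  qed
  also have "\<dots> = w powi (- N) * laurent_eval w p" by (simp add: laurent_eval_def sum_distrib_left)
  finally have "poly P w = 0" using p(3) by simp
  moreover have "poly_over K P"
    unfolding P_def using p(1) by (intro poly_over_sum[OF K(1)] poly_over_monom[OF K(1)]) (auto simp: laurent_over_def)
  moreover have "coeff P (nat (M - N)) = (\<Sum>n\<in>?A. if n = M then Poly_Mapping.lookup p n else 0)"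
    unfolding P_def coeff_sum using N M by (intro sum.cong refl) (auto simp: eq_nat_nat_iff)
  hence "coeff P (nat (M - N)) \<noteq> 0" using M by (simp add: in_keys_iff)
  hence "P \<noteq> 0" by auto
  ultimately show ?thesis using integral_over_field[OF K] by blast
qed

section \<open>Monomial valuations on Laurent polynomials\<close>

context dedekind
begin

text \<open>The value at the single term of index \<open>n\<close> of the valuation that extends the
  order at \<open>P\<close> and gives the indeterminate the value \<open>r\<close>.\<close>

definition mval :: "'a set \<Rightarrow> rat \<Rightarrow> (int \<Rightarrow>\<^sub>0 'a) \<Rightarrow> int \<Rightarrow> rat" where
  "mval P r p n = of_int (ord_at R P (Poly_Mapping.lookup p n)) + of_int n * r"

text \<open>A condition on the nonzero terms instead of a minimum, so that the zero polynomial needs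
  no infinite value.\<close>

definition mval_ge :: "'a set \<Rightarrow> rat \<Rightarrow> rat \<Rightarrow> (int \<Rightarrow>\<^sub>0 'a) \<Rightarrow> bool" where
  "mval_ge P r c p \<longleftrightarrow> (\<forall>n. Poly_Mapping.lookup p n \<noteq> 0 \<longrightarrow> c \<le> mval P r p n)"

text \<open>The index \<open>n\<close> is the least one at which the valuation is attained; such indices add up
  under multiplication, without cancellation.\<close>

definition leads_at :: "'a set \<Rightarrow> rat \<Rightarrow> (int \<Rightarrow>\<^sub>0 'a) \<Rightarrow> int \<Rightarrow> bool" where
  "leads_at P r p n \<longleftrightarrow> Poly_Mapping.lookup p n \<noteq> 0 \<and>
    (\<forall>m. Poly_Mapping.lookup p m \<noteq> 0 \<longrightarrow> mval P r p n \<le> mval P r p m \<and> (m < n \<longrightarrow> mval P r p n < mval P r p m))"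

context
  fixes P assumes P: "is_maximal R P"
begin

lemma ord_sum_bound:
  assumes "finite A" "\<And>a. a \<in> A \<Longrightarrow> f a \<in> frac_field R" "(\<Sum>a\<in>A. f a) \<noteq> 0"
  shows "\<exists>a\<in>A. f a \<noteq> 0 \<and> ord_at R P (f a) \<le> ord_at R P (\<Sum>a\<in>A. f a)"
  using assms
proof (induction A rule: finite_induct)
  case (insert a A)
  let ?s = "\<Sum>a\<in>A. f a"
  have s: "?s \<in> frac_field R" using insert.prems(1) by (intro frac_intros) auto
  have fa: "f a \<in> frac_field R" using insert.prems(1) by simp
  show ?case
  proof (cases "?s = 0")
    case True
    thus ?thesis using insert by auto
  next
    case False
    then obtain c where c: "c \<in> A" "f c \<noteq> 0" "ord_at R P (f c) \<le> ord_at R P ?s"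
      using insert by auto
    show ?thesis
    proof (cases "f a = 0")
      case True
      thus ?thesis using c insert.hyps by auto
    next
      case nz: False
      have "f a + ?s \<noteq> 0" using insert by simp
      hence "min (ord_at R P (f a)) (ord_at R P ?s) \<le> ord_at R P (f a + ?s)"
        by (rule ord_add_ge[OF P fa nz s False])
      hence "ord_at R P (f a) \<le> ord_at R P (f a + ?s) \<or> ord_at R P (f c) \<le> ord_at R P (f a + ?s)"
        using c(3) by linarith
      thus ?thesis using c nz insert.hyps by auto
    qed
  qed
qed simp

lemma ord_uminus:
  assumes "f \<in> frac_field R" "f \<noteq> 0"
  shows "ord_at R P (- f) = ord_at R P f"
proof -
  have "lunit P (- 1)"
    using loc_intros(6)[OF P loc_intros(2)[OF P]] by (simp add: lunit_def)
  hence "ord_at R P (- 1) = 0" by (rule ord_lunit[OF P])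
  thus ?thesis
    using ord_mult[OF P _ _ assms, of "- 1"] frac_intros(6)[OF frac_intros(2)] by simp
qed

lemma ord_add_eq:
  assumes "f \<in> frac_field R" "f \<noteq> 0" "g \<in> frac_field R" "g \<noteq> 0" "ord_at R P f < ord_at R P g"
  shows "f + g \<noteq> 0" "ord_at R P (f + g) = ord_at R P f"
proof -
  show nz: "f + g \<noteq> 0"
  proof
    assume "f + g = 0"
    hence "g = - f" by (simp add: add_eq_0_iff)
    thus False using ord_uminus[OF assms(1,2)] assms(5) by simp
  qed
  have "ord_at R P f \<le> ord_at R P (f + g)"
    using ord_add_ge[OF P assms(1-4) nz] assms(5) by simp
  moreover have "ord_at R P (f + g) \<le> ord_at R P f"
  proof (rule ccontr)
    assume *: "\<not> ord_at R P (f + g) \<le> ord_at R P f"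
    have "min (ord_at R P (f + g)) (ord_at R P (- g)) \<le> ord_at R P (f + g + - g)"
      using assms nz by (intro ord_add_ge[OF P]) (auto intro: frac_intros)
    thus False using * ord_uminus[OF assms(3,4)] assms(5) by simp
  qed
  ultimately show "ord_at R P (f + g) = ord_at R P f" by simp
qed

lemma leads_at_exists:
  assumes "p \<noteq> 0"
  shows "\<exists>n. leads_at P r p n"
proof -
  let ?K = "Poly_Mapping.keys p"
  have "?K \<noteq> {}" using assms by (metis poly_mapping_eqI lookup_zero in_keys_iff empty_iff)
  define V where "V = Min (mval P r p ` ?K)"
  have V: "V \<in> mval P r p ` ?K" "\<And>m. m \<in> ?K \<Longrightarrow> V \<le> mval P r p m"
    using \<open>?K \<noteq> {}\<close> by (auto simp: V_def intro: Min_in)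
  define N where "N = {n \<in> ?K. mval P r p n = V}"
  have N: "finite N" "N \<noteq> {}" using V(1) by (auto simp: N_def)
  define n where "n = Min N"
  have n: "n \<in> N" "\<And>m. m \<in> N \<Longrightarrow> n \<le> m" using N by (auto simp: n_def)
  have "mval P r p n < mval P r p m" if "m \<in> ?K" "m < n" for m
  proof -
    have "m \<notin> N" using n(2)[of m] that(2) by force
    hence "mval P r p m \<noteq> V" using that(1) by (simp add: N_def)
    thus ?thesis using V(2)[OF that(1)] n(1) by (simp add: N_def)
  qed
  hence "leads_at P r p n" using n(1) V(2) by (auto simp: leads_at_def N_def in_keys_iff)
  thus ?thesis by blast
qed

lemma mval_term:
  assumes "p \<in> laurent_over (frac_field R)" "q \<in> laurent_over (frac_field R)"
    and "Poly_Mapping.lookup p a \<noteq> 0" "Poly_Mapping.lookup q b \<noteq> 0"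
  shows "of_int (ord_at R P (Poly_Mapping.lookup p a * Poly_Mapping.lookup q b)) + of_int (a + b) * r =
    mval P r p a + mval P r q b"
  using assms ord_mult[OF P, of "Poly_Mapping.lookup p a" "Poly_Mapping.lookup q b"]
  by (simp add: laurent_over_def mval_def algebra_simps)

lemma mval_mult_bound:
  assumes pq: "p \<in> laurent_over (frac_field R)" "q \<in> laurent_over (frac_field R)"
    and nz: "Poly_Mapping.lookup (p * q) n \<noteq> 0"
  shows "\<exists>a. Poly_Mapping.lookup p a \<noteq> 0 \<and> Poly_Mapping.lookup q (n - a) \<noteq> 0 \<and>
    mval P r p a + mval P r q (n - a) \<le> mval P r (p * q) n"
proof -
  have "\<exists>a\<in>Poly_Mapping.keys p. Poly_Mapping.lookup p a * Poly_Mapping.lookup q (n - a) \<noteq> 0 \<and>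
      ord_at R P (Poly_Mapping.lookup p a * Poly_Mapping.lookup q (n - a)) \<le> ord_at R P (Poly_Mapping.lookup (p * q) n)"
    unfolding lookup_mult_eq
    by (rule ord_sum_bound)
       (use pq nz in \<open>auto simp: laurent_over_def lookup_mult_eq intro: subring_mult[OF frac_field_subring]\<close>)
  then obtain a where a: "Poly_Mapping.lookup p a \<noteq> 0" "Poly_Mapping.lookup q (n - a) \<noteq> 0"
    "ord_at R P (Poly_Mapping.lookup p a * Poly_Mapping.lookup q (n - a)) \<le> ord_at R P (Poly_Mapping.lookup (p * q) n)"
    by auto
  hence "rat_of_int (ord_at R P (Poly_Mapping.lookup p a * Poly_Mapping.lookup q (n - a))) \<le>
         rat_of_int (ord_at R P (Poly_Mapping.lookup (p * q) n))" by (simp only: of_int_le_iff)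
  hence "mval P r p a + mval P r q (n - a) \<le> mval P r (p * q) n"
    using mval_term[OF pq a(1,2), of r] unfolding mval_def[of P r "p * q"] by simp
  thus ?thesis using a by blast
qed

lemma leads_at_mult:
  assumes pq: "p \<in> laurent_over (frac_field R)" "q \<in> laurent_over (frac_field R)"
    and "leads_at P r p i" "leads_at P r q j"
  shows "leads_at P r (p * q) (i + j)" "mval P r (p * q) (i + j) = mval P r p i + mval P r q j"
proof -
  let ?p = "Poly_Mapping.lookup p" and ?q = "Poly_Mapping.lookup q"
  have pi: "?p i \<noteq> 0" and qj: "?q j \<noteq> 0" using assms by (auto simp: leads_at_def)
  have p_ge: "mval P r p i \<le> mval P r p a" "a < i \<Longrightarrow> mval P r p i < mval P r p a" if "?p a \<noteq> 0" for a
    using assms(3) that by (auto simp: leads_at_def)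
  have q_ge: "mval P r q j \<le> mval P r q a" "a < j \<Longrightarrow> mval P r q j < mval P r q a" if "?q a \<noteq> 0" for a
    using assms(4) that by (auto simp: leads_at_def)
  have fr: "?p a * ?q c \<in> frac_field R" for a c
    using pq by (auto simp: laurent_over_def intro: subring_mult[OF frac_field_subring])
  define rest where "rest = (\<Sum>a\<in>Poly_Mapping.keys p - {i}. ?p a * ?q (i + j - a))"
  have eq: "Poly_Mapping.lookup (p * q) (i + j) = ?p i * ?q j + rest"
    unfolding lookup_mult_eq rest_def using pi by (subst sum.remove[of _ i]) (auto simp: in_keys_iff)
  have "Poly_Mapping.lookup (p * q) (i + j) \<noteq> 0 \<and>
      ord_at R P (Poly_Mapping.lookup (p * q) (i + j)) = ord_at R P (?p i * ?q j)"
  proof (cases "rest = 0")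
    case True
    thus ?thesis using eq pi qj by simp
  next
    case False
    have "\<exists>a\<in>Poly_Mapping.keys p - {i}. ?p a * ?q (i + j - a) \<noteq> 0 \<and> ord_at R P (?p a * ?q (i + j - a)) \<le> ord_at R P rest"
      unfolding rest_def by (rule ord_sum_bound) (use False fr in \<open>auto simp: rest_def\<close>)
    then obtain a where a: "a \<noteq> i" "?p a \<noteq> 0" "?q (i + j - a) \<noteq> 0"
      "ord_at R P (?p a * ?q (i + j - a)) \<le> ord_at R P rest" by auto
    \<comment> \<open>In every other product that contributes to index \<open>i + j\<close>, one
      factor has an index strictly below its leading one, and there the inequality is
      strict.\<close>
    have "mval P r p i + mval P r q j < mval P r p a + mval P r q (i + j - a)"
    proof (cases "a < i")
      case True
      thus ?thesis using p_ge(2)[OF a(2)] q_ge(1)[OF a(3)] by linarith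
    next
      case False
      hence "i + j - a < j" using a(1) by simp
      thus ?thesis using p_ge(1)[OF a(2)] q_ge(2)[OF a(3)] by linarith
    qed
    hence "ord_at R P (?p i * ?q j) < ord_at R P (?p a * ?q (i + j - a))"
      using mval_term[OF pq pi qj, of r] mval_term[OF pq a(2,3), of r] by simp
    hence "ord_at R P (?p i * ?q j) < ord_at R P rest" using a(4) by simp
    moreover have "rest \<in> frac_field R" unfolding rest_def by (rule subring_sum[OF frac_field_subring fr])
    ultimately show ?thesis
      using ord_add_eq[OF fr _ _ False, of i j] pi qj eq by simp
  qed
  hence nz: "Poly_Mapping.lookup (p * q) (i + j) \<noteq> 0"
    and ord_eq: "ord_at R P (Poly_Mapping.lookup (p * q) (i + j)) = ord_at R P (?p i * ?q j)" by auto
  show val_eq: "mval P r (p * q) (i + j) = mval P r p i + mval P r q j"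
    using mval_term[OF pq pi qj, of r] ord_eq by (simp add: mval_def)
  show "leads_at P r (p * q) (i + j)"
    unfolding leads_at_def
  proof (intro conjI allI impI nz)
    fix m assume "Poly_Mapping.lookup (p * q) m \<noteq> 0"
    then obtain a where a: "?p a \<noteq> 0" "?q (m - a) \<noteq> 0" "mval P r p a + mval P r q (m - a) \<le> mval P r (p * q) m"
      using mval_mult_bound[OF pq] by blast
    show "mval P r (p * q) (i + j) \<le> mval P r (p * q) m"
      using p_ge(1)[OF a(1)] q_ge(1)[OF a(2)] a(3) val_eq by linarith
    show "mval P r (p * q) (i + j) < mval P r (p * q) m" if "m < i + j"
    proof (cases "a < i")
      case True
      thus ?thesis using p_ge(2)[OF a(1)] q_ge(1)[OF a(2)] a(3) val_eq by linarith
    next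
      case False
      hence "m - a < j" using that by simp
      thus ?thesis using p_ge(1)[OF a(1)] q_ge(2)[OF a(2)] a(3) val_eq by linarith
    qed
  qed
qed

lemma mval_ge_mult:
  assumes pq: "p \<in> laurent_over (frac_field R)" "q \<in> laurent_over (frac_field R)"
    and "mval_ge P r c p" "mval_ge P r d q"
  shows "mval_ge P r (c + d) (p * q)"
  unfolding mval_ge_def
proof (intro allI impI)
  fix n assume "Poly_Mapping.lookup (p * q) n \<noteq> 0"
  then obtain a where a: "Poly_Mapping.lookup p a \<noteq> 0" "Poly_Mapping.lookup q (n - a) \<noteq> 0"
    "mval P r p a + mval P r q (n - a) \<le> mval P r (p * q) n" using mval_mult_bound[OF pq] by blast
  have "c \<le> mval P r p a" "d \<le> mval P r q (n - a)" using assms(3,4) a by (auto simp: mval_ge_def)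
  thus "c + d \<le> mval P r (p * q) n" using a(3) by linarith
qed

lemmas laurent_frac_subring = laurent_over_subring[OF frac_field_subring]

lemma mval_ge_1: "mval_ge P r 0 1"
  by (auto simp: mval_ge_def mval_def lookup_one when_def ord_1[OF P])

lemma mval_ge_power:
  assumes "p \<in> laurent_over (frac_field R)" "mval_ge P r c p"
  shows "mval_ge P r (of_nat n * c) (p ^ n)"
proof (induction n)
  case (Suc n)
  have "mval_ge P r (c + of_nat n * c) (p * p ^ n)"
    by (rule mval_ge_mult[OF assms(1) _ assms(2) Suc]) (rule subring_power[OF laurent_frac_subring assms(1)])
  thus ?case by (simp add: algebra_simps)
qed (simp add: mval_ge_1)

lemma leads_at_power:
  assumes "p \<in> laurent_over (frac_field R)" "leads_at P r p i"
  shows "leads_at P r (p ^ n) (int n * i) \<and> mval P r (p ^ n) (int n * i) = of_nat n * mval P r p i"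
proof (induction n)
  case 0
  show ?case by (auto simp: leads_at_def mval_def lookup_one when_def ord_1[OF P])
next
  case (Suc n)
  have "p ^ n \<in> laurent_over (frac_field R)" by (rule subring_power[OF laurent_frac_subring assms(1)])
  from leads_at_mult[OF assms(1) this assms(2), of "int n * i"] Suc show ?case
    by (simp add: algebra_simps)
qed

lemma mval_ge_sum:
  assumes "finite A" "\<And>a. a \<in> A \<Longrightarrow> f a \<in> laurent_over (frac_field R)" "\<And>a. a \<in> A \<Longrightarrow> mval_ge P r c (f a)"
  shows "mval_ge P r c (\<Sum>a\<in>A. f a)"
  unfolding mval_ge_def
proof (intro allI impI)
  fix n assume nz: "Poly_Mapping.lookup (\<Sum>a\<in>A. f a) n \<noteq> 0"
  have "\<exists>a\<in>A. Poly_Mapping.lookup (f a) n \<noteq> 0 \<and>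
      ord_at R P (Poly_Mapping.lookup (f a) n) \<le> ord_at R P (\<Sum>a\<in>A. Poly_Mapping.lookup (f a) n)"
    by (rule ord_sum_bound[OF assms(1)]) (use assms(2) nz in \<open>auto simp: laurent_over_def lookup_sum\<close>)
  then obtain a where a: "a \<in> A" "Poly_Mapping.lookup (f a) n \<noteq> 0"
    "ord_at R P (Poly_Mapping.lookup (f a) n) \<le> ord_at R P (\<Sum>a\<in>A. Poly_Mapping.lookup (f a) n)" by blast
  have "c \<le> mval P r (f a) n" using assms(3)[OF a(1)] a(2) by (simp add: mval_ge_def)
  moreover have "mval P r (f a) n \<le> mval P r (\<Sum>a\<in>A. f a) n" using a(3) by (simp add: mval_def lookup_sum)
  ultimately show "c \<le> mval P r (\<Sum>a\<in>A. f a) n" by linarith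
qed

lemma mval_ge_mono: "mval_ge P r c p \<Longrightarrow> c' \<le> c \<Longrightarrow> mval_ge P r c' p"
  unfolding mval_ge_def by force

text \<open>Let \<open>c < 0\<close> be the value of \<open>p\<close>. Then \<open>p ^ n\<close>
  attains the value \<open>n c\<close>, whereas every remaining term of the equation has value at
  least \<open>(n - 1) c\<close>, which is larger; the two cannot cancel.\<close>

lemma mval_ge_integral:
  assumes p: "p \<in> laurent_over (frac_field R)"
    and q: "\<And>i. i < n \<Longrightarrow> q i \<in> laurent_over (frac_field R)" "\<And>i. i < n \<Longrightarrow> mval_ge P r 0 (q i)"
    and eq: "p ^ n + (\<Sum>i<n. q i * p ^ i) = 0"
  shows "mval_ge P r 0 p"
proof (rule ccontr)
  assume neg: "\<not> mval_ge P r 0 p"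
  hence "p \<noteq> 0" by (auto simp: mval_ge_def)
  then obtain m where m: "leads_at P r p m" using leads_at_exists by blast
  define c where "c = mval P r p m"
  have ge: "mval_ge P r c p" using m by (auto simp: mval_ge_def leads_at_def c_def)
  have "c < 0" using neg ge mval_ge_mono[OF ge, of 0] by force
  have pw: "p ^ i \<in> laurent_over (frac_field R)" for i by (rule subring_power[OF laurent_frac_subring p])
  have "mval_ge P r (of_nat n * c - c) (q i * p ^ i)" if i: "i < n" for i
  proof (rule mval_ge_mono[OF mval_ge_mult[OF q(1)[OF i] pw q(2)[OF i] mval_ge_power[OF p ge]]])
    have "of_nat i \<le> (of_nat n - 1 :: rat)" using i by (simp add: le_diff_eq flip: of_nat_Suc)
    hence "(of_nat n - 1) * c \<le> of_nat i * c" using \<open>c < 0\<close> by (intro mult_right_mono_neg) auto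
    thus "of_nat n * c - c \<le> 0 + of_nat i * c" by (simp add: algebra_simps)
  qed
  hence ge_sum: "mval_ge P r (of_nat n * c - c) (\<Sum>i<n. q i * p ^ i)"
    using q(1) pw by (intro mval_ge_sum) (auto intro: subring_mult[OF laurent_frac_subring])
  have pn: "leads_at P r (p ^ n) (int n * m)" "mval P r (p ^ n) (int n * m) = of_nat n * c"
    using leads_at_power[OF p m] by (auto simp: c_def)
  let ?k = "int n * m"
  have "(\<Sum>i<n. q i * p ^ i) = - (p ^ n)" using eq by (simp add: add_eq_0_iff)
  hence lookup_eq: "Poly_Mapping.lookup (\<Sum>i<n. q i * p ^ i) ?k = - Poly_Mapping.lookup (p ^ n) ?k" by simp
  have nz: "Poly_Mapping.lookup (p ^ n) ?k \<noteq> 0" using pn(1) by (simp add: leads_at_def)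
  have "Poly_Mapping.lookup (p ^ n) ?k \<in> frac_field R" using pw by (simp add: laurent_over_def)
  from ord_uminus[OF this nz] have "mval P r (\<Sum>i<n. q i * p ^ i) ?k = mval P r (p ^ n) ?k"
    unfolding mval_def lookup_eq by (rule arg_cong)
  moreover have "of_nat n * c - c \<le> mval P r (\<Sum>i<n. q i * p ^ i) ?k"
  proof -
    have "Poly_Mapping.lookup (\<Sum>i<n. q i * p ^ i) ?k \<noteq> 0" unfolding lookup_eq using nz by simp
    thus ?thesis using ge_sum unfolding mval_ge_def by blast
  qed
  ultimately have "of_nat n * c - c \<le> of_nat n * c" using pn(2) by (simp only:)
  thus False using \<open>c < 0\<close> by simp
qed

end

end

section \<open>Embedding the Laurent polynomials\<close>

lemma laurent_emb_0 [simp]: "laurent_emb 0 = 0"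
  by (simp add: laurent_emb_def Zero_fract_def[symmetric])

lemma laurent_emb_1 [simp]: "laurent_emb 1 = 1"
  by (simp add: laurent_emb_def One_fract_def[symmetric])

lemma laurent_emb_add: "laurent_emb (p + q) = laurent_emb p + laurent_emb q"
  by (simp add: laurent_emb_def flip: to_ac_add)

lemma laurent_emb_mult: "laurent_emb (p * q) = laurent_emb p * laurent_emb q"
  by (simp add: laurent_emb_def flip: to_ac_mult)

lemma laurent_emb_eq_0_iff: "laurent_emb p = 0 \<longleftrightarrow> p = 0"
  by (simp add: laurent_emb_def eq_fract Zero_fract_def)

lemma laurent_emb_uminus: "laurent_emb (- p) = - laurent_emb p"
proof -
  have "laurent_emb p + laurent_emb (- p) = 0" by (simp flip: laurent_emb_add)
  thus ?thesis by (simp add: add_eq_0_iff)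
qed

lemma laurent_emb_diff: "laurent_emb (p - q) = laurent_emb p - laurent_emb q"
  using laurent_emb_add[of p "- q"] laurent_emb_uminus[of q] by simp

lemma laurent_emb_sum: "laurent_emb (\<Sum>i\<in>I. f i) = (\<Sum>i\<in>I. laurent_emb (f i))"
  by (induction I rule: infinite_finite_induct) (auto simp: laurent_emb_add)

lemma const_emb_field_hom: "field_hom const_emb"
  by unfold_locales
     (simp_all add: const_emb_def single_add laurent_emb_add mult_single flip: laurent_emb_mult)

lemma u_var_nonzero: "(u_var :: 'k::field laurent_closure) \<noteq> 0"
proof -
  have "Poly_Mapping.lookup (Poly_Mapping.single 1 1 :: int \<Rightarrow>\<^sub>0 'k) 1 \<noteq> 0" by simp
  hence "(Poly_Mapping.single 1 1 :: int \<Rightarrow>\<^sub>0 'k) \<noteq> 0" by fastforce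
  thus ?thesis by (simp add: u_var_def laurent_emb_eq_0_iff)
qed

lemma laurent_emb_single:
  fixes c :: "'k::field"
  shows "laurent_emb (Poly_Mapping.single n c) = const_emb c * u_var powi n"
proof -
  have nat: "laurent_emb (Poly_Mapping.single (int m) (1::'k)) = u_var ^ m" for m
  proof (induction m)
    case (Suc m)
    have "Poly_Mapping.single (int (Suc m)) (1::'k) = Poly_Mapping.single 1 1 * Poly_Mapping.single (int m) 1"
      by (simp add: mult_single)
    thus ?case using Suc by (simp only: laurent_emb_mult u_var_def power_Suc)
  qed simp
  have "laurent_emb (Poly_Mapping.single n (1::'k)) = u_var powi n"
  proof (cases "n \<ge> 0")
    case True
    thus ?thesis using nat[of "nat n"] by (simp add: power_int_def)
  next
    case False
    have "Poly_Mapping.single n (1::'k) * Poly_Mapping.single (- n) 1 = 1" by (simp add: mult_single)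
    hence "laurent_emb (Poly_Mapping.single n (1::'k)) * laurent_emb (Poly_Mapping.single (- n) 1) = 1"
      by (simp flip: laurent_emb_mult)
    hence "laurent_emb (Poly_Mapping.single n (1::'k)) * u_var ^ nat (- n) = 1"
      using nat[of "nat (- n)"] False by simp
    thus ?thesis using False by (metis inverse_unique mult.commute power_int_def power_inverse)
  qed
  moreover have "Poly_Mapping.single n c = Poly_Mapping.single 0 c * Poly_Mapping.single n 1"
    by (simp add: mult_single)
  ultimately show ?thesis by (simp add: laurent_emb_mult const_emb_def)
qed

lemma laurent_emb_eq_sum:
  "laurent_emb p = (\<Sum>n\<in>Poly_Mapping.keys p. const_emb (Poly_Mapping.lookup p n) * u_var powi n)"
proof -
  have "laurent_emb p = laurent_emb (\<Sum>n\<in>Poly_Mapping.keys p. Poly_Mapping.single n (Poly_Mapping.lookup p n))"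
    by (simp only: sum_singles)
  thus ?thesis by (simp only: laurent_emb_sum laurent_emb_single)
qed

section \<open>The graded algebra as an intersection of valuation rings\<close>

context dedekind
begin

lemma global_sections_iff:
  "f \<in> global_sections R E \<longleftrightarrow> f \<in> frac_field R \<and> (f = 0 \<or> (\<forall>P. is_maximal R P \<longrightarrow> 0 \<le> ord_at R P f + E P))"
  unfolding global_sections_def by (auto simp: closed_points_iff[OF subring])

text \<open>Orders are integers, so rounding the divisor down does not change the condition. This is
  how the integral sections turn into valuations with rational slope.\<close>

lemma add_floor_nonneg_iff: "0 \<le> a + \<lfloor>x\<rfloor> \<longleftrightarrow> 0 \<le> of_int a + (x :: rat)"
proof -
  have "0 \<le> a + \<lfloor>x\<rfloor> \<longleftrightarrow> - a \<le> \<lfloor>x\<rfloor>" by linarith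
  also have "\<dots> \<longleftrightarrow> of_int (- a) \<le> x" by (rule le_floor_iff)
  finally show ?thesis by auto
qed

text \<open>By \<open>D\<^sub>+ + D\<^sub>- \<le> 0\<close>, of the two conditions \<open>ord + n D\<^sub>+ \<ge> 0\<close> and \<open>ord - n D\<^sub>- \<ge> 0\<close> the one that
  enters the definition implies the other.\<close>

lemma dpd_coeffs_iff:
  assumes "\<And>P. is_maximal R P \<Longrightarrow> Dp P + Dm P \<le> 0"
  shows "f \<in> dpd_coeffs R Dp Dm n \<longleftrightarrow> f \<in> frac_field R \<and> (f = 0 \<or> (\<forall>P. is_maximal R P \<longrightarrow>
    0 \<le> of_int (ord_at R P f) + of_int n * Dp P \<and> 0 \<le> of_int (ord_at R P f) + of_int n * (- Dm P)))"
proof (cases "n \<ge> 0")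
  case True
  have "of_int n * Dp P \<le> of_int n * (- Dm P)" if "is_maximal R P" for P
    using assms[OF that] True by (intro mult_left_mono) auto
  thus ?thesis
    using True unfolding dpd_coeffs_def by (auto simp: global_sections_iff add_floor_nonneg_iff) fastforce
next
  case False
  have "of_int n * (- Dm P) \<le> of_int n * Dp P" if "is_maximal R P" for P
    using assms[OF that] False by (intro mult_left_mono_neg) auto
  thus ?thesis
    using False unfolding dpd_coeffs_def by (auto simp: global_sections_iff add_floor_nonneg_iff) fastforce
qed

lemma dpd_algebra_iff:
  assumes "\<And>P. is_maximal R P \<Longrightarrow> Dp P + Dm P \<le> 0"
  shows "p \<in> dpd_algebra R Dp Dm \<longleftrightarrow> p \<in> laurent_over (frac_field R) \<and>
    (\<forall>P. is_maximal R P \<longrightarrow> mval_ge P (Dp P) 0 p \<and> mval_ge P (- Dm P) 0 p)"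
  unfolding dpd_algebra_def laurent_over_def mval_ge_def mval_def
  using dpd_coeffs_iff[of Dp Dm, OF assms] by blast

lemma dpd_algebra_subring:
  assumes D: "\<And>P. is_maximal R P \<Longrightarrow> Dp P + Dm P \<le> 0"
  shows "is_subring (dpd_algebra R Dp Dm)"
  unfolding is_subring_def
proof (intro conjI ballI)
  note L = laurent_over_subring[OF frac_field_subring]
  note iff = dpd_algebra_iff[of Dp Dm, OF D]
  show "1 \<in> dpd_algebra R Dp Dm" using mval_ge_1 subring_1[OF L] iff by blast
  have um: "mval_ge P r 0 (- q)" if "is_maximal R P" "q \<in> laurent_over (frac_field R)" "mval_ge P r 0 q" for P r q
    using that ord_uminus[OF that(1), of "Poly_Mapping.lookup q _"]
    by (simp add: mval_ge_def mval_def laurent_over_def)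
  fix p q assume pq: "p \<in> dpd_algebra R Dp Dm" "q \<in> dpd_algebra R Dp Dm"
  hence pL: "p \<in> laurent_over (frac_field R)" and qL: "q \<in> laurent_over (frac_field R)" using iff by blast+
  have "mval_ge P r 0 (p - q) \<and> mval_ge P r 0 (p * q)"
    if P: "is_maximal R P" "mval_ge P r 0 p" "mval_ge P r 0 q" for P r
  proof
    show "mval_ge P r 0 (p * q)" using mval_ge_mult[OF P(1) pL qL P(2,3)] by simp
    \<comment> \<open>Indexing by truth values makes \<open>mval_ge_sum\<close> applicable without
      merging the two summands when \<open>p = - q\<close>.\<close>
    have "mval_ge P r 0 (\<Sum>b\<in>{True, False}. if b then p else - q)"
      using um[OF P(1) qL P(3)] P pL subring_uminus[OF L qL] by (intro mval_ge_sum) auto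
    thus "mval_ge P r 0 (p - q)" by simp
  qed
  thus "p - q \<in> dpd_algebra R Dp Dm" "p * q \<in> dpd_algebra R Dp Dm"
    using pq subring_diff[OF L pL qL] subring_mult[OF L pL qL] iff by blast+
qed

end

section \<open>The homogeneous coordinate of the cyclic cover\<close>

text \<open>In the application \<open>b = k * b'\<close> and \<open>d = k * d'\<close>. The equation
  for \<open>v\<close> is encoded by \<open>s_eq\<close> together with
  \<open>s ^ k = const_emb t\<close>, and \<gamma> is the second Bezout coefficient.\<close>

locale cyclic_cover =
  curve_extension const_emb \<iota> s t k R S
  for \<iota> :: "complex \<Rightarrow> 'k::field" and s t k R S +
  fixes v :: "'k laurent_closure" and d' b' :: nat and \<beta> \<gamma> :: int and Dp Dm :: "'k set \<Rightarrow> rat"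
  assumes d'_pos: "d' > 0" and bezout: "\<beta> * int b' + \<gamma> * int d' = 1"
    and v_nonzero: "v \<noteq> 0" and s_eq: "s = v ^ d' / u_var ^ b'"
    and Dp: "qdivisor R Dp" and Dm: "qdivisor R Dm" and D_le: "\<And>P. Dp P + Dm P \<le> 0"
begin

definition w :: "'k laurent_closure" where
  "w = v powi \<beta> * u_var powi \<gamma>"

lemma w_nonzero: "w \<noteq> 0"
  using v_nonzero by (simp add: w_def u_var_nonzero)

lemma w_powi: "w powi n = v powi (\<beta> * n) * u_var powi (\<gamma> * n)"
  by (simp add: w_def power_int_mult_distrib flip: power_int_mult)

lemma s_powi: "s powi n = v powi (int d' * n) * u_var powi (- int b' * n)"
  by (simp add: s_eq divide_inverse power_int_mult_distrib power_int_mult power_int_minus power_int_inverse)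

text \<open>The exponents of \<open>u\<close> and \<open>v\<close> are transformed by an integer
  matrix of determinant \<open>-1\<close>, by the Bezout relation. Thus \<open>u\<close> and
  \<open>v\<close> generate the same multiplicative group as \<open>s\<close> and
  \<open>w\<close>.\<close>

lemma monomial_eq: "u_var powi i * v powi j = s powi (\<gamma> * j - \<beta> * i) * w powi (int d' * i + int b' * j)"
proof -
  have "s powi (\<gamma> * j - \<beta> * i) * w powi (int d' * i + int b' * j) =
    v powi (int d' * (\<gamma> * j - \<beta> * i) + \<beta> * (int d' * i + int b' * j)) *
    u_var powi (- int b' * (\<gamma> * j - \<beta> * i) + \<gamma> * (int d' * i + int b' * j))"
    by (simp only: s_powi w_powi power_int_add[OF disjI1[OF v_nonzero]]
        power_int_add[OF disjI1[OF u_var_nonzero]] mult_ac)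
  also have "int d' * (\<gamma> * j - \<beta> * i) + \<beta> * (int d' * i + int b' * j) = (\<beta> * int b' + \<gamma> * int d') * j"
    by (simp add: algebra_simps)
  also have "- int b' * (\<gamma> * j - \<beta> * i) + \<gamma> * (int d' * i + int b' * j) = (\<beta> * int b' + \<gamma> * int d') * i"
    by (simp add: algebra_simps)
  finally show ?thesis by (simp add: bezout mult.commute)
qed

lemma u_powi: "u_var powi n = s powi (- \<beta> * n) * w powi (int d' * n)"
  using monomial_eq[of n 0] by simp

lemma v_powi: "v powi n = s powi (\<gamma> * n) * w powi (int b' * n)"
  using monomial_eq[of 0 n] by simp

lemma radical_powi: "x \<in> radical_field \<Longrightarrow> x powi n \<in> radical_field"
  by (auto simp: power_int_def intro: radical_intros radical_field_inverse)

lemmas s_powi_radical = radical_powi[OF s_radical_field]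

text \<open>Were \<open>w\<close> algebraic over \<open>K\<close>, it would be algebraic over
  \<open>K\<^sub>0\<close>, and so would \<open>u = s powi (- \<beta>) * w ^ d'\<close>.\<close>

lemma transcendental:
  assumes p: "p \<in> laurent_over radical_field" "laurent_eval w p = 0"
  shows "p = 0"
proof (rule ccontr)
  assume "p \<noteq> 0"
  have "integral_over radical_field w"
    by (rule laurent_relation_integral[OF radical_field_subring radical_field_inverse p(1) \<open>p \<noteq> 0\<close> p(2) w_nonzero])
  hence w: "integral_over (range const_emb) w"
    using integral_trans[OF range_h_subring] radical_field_integral by blast
  note I = integral_closure_subring[OF range_h_subring]
  have "u_var = s powi (- \<beta>) * w ^ d'" using u_powi[of 1] by simp
  hence "integral_over (range const_emb) (u_var :: 'k laurent_closure)"
    using subring_mult[OF I, of "s powi (- \<beta>)" "w ^ d'"] subring_power[OF I, of w d']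
      radical_field_integral[OF s_powi_radical] w by auto
  then obtain P where P: "lead_coeff P = 1" "poly_over (range const_emb) P"
    "poly P (u_var :: 'k laurent_closure) = 0"
    by (auto simp: integral_over_def)
  obtain q where q: "P = map_poly const_emb q" using poly_over_range_h[OF P(2)] by blast
  \<comment> \<open>An equation for \<open>u\<close> over the constants is itself the image of a
    Laurent polynomial, and \<open>laurent_emb\<close> is injective.\<close>
  define a where "a = (\<Sum>i\<le>degree q. Poly_Mapping.single (int i) (coeff q i))"
  have "laurent_emb a = (\<Sum>i\<le>degree q. const_emb (coeff q i) * u_var ^ i)"
    by (simp add: a_def laurent_emb_sum laurent_emb_single)
  also have "\<dots> = poly P u_var" by (simp add: q poly_altdef)
  finally have "a = 0" using P(3) laurent_emb_eq_0_iff by metis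
  moreover have "Poly_Mapping.lookup a (int (degree q)) = (\<Sum>i\<le>degree q. if i = degree q then coeff q i else 0)"
    unfolding a_def lookup_sum by (intro sum.cong refl) (auto simp: lookup_single when_def)
  ultimately have "lead_coeff q = 0" by simp
  thus False using P(1) q by simp
qed

lemma laurent_eval_inj:
  assumes "p \<in> laurent_over radical_field" "q \<in> laurent_over radical_field" "laurent_eval w p = laurent_eval w q"
  shows "p = q"
proof -
  have "p - q = 0"
    using assms subring_diff[OF laurent_over_subring[OF radical_field_subring]]
    by (intro transcendental) (auto simp: laurent_eval_diff)
  thus ?thesis by simp
qed

text \<open>Substitutes \<open>u = s powi (- \<beta>) * w ^ d'\<close>.\<close>

definition lift :: "(int \<Rightarrow>\<^sub>0 'k) \<Rightarrow> (int \<Rightarrow>\<^sub>0 'k laurent_closure)" where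
  "lift a = (\<Sum>n\<in>Poly_Mapping.keys a.
     Poly_Mapping.single (int d' * n) (const_emb (Poly_Mapping.lookup a n) * s powi (- \<beta> * n)))"

lemma laurent_eval_lift: "laurent_eval w (lift a) = laurent_emb a"
  unfolding laurent_emb_eq_sum lift_def laurent_eval_sum u_powi
  by (simp add: mult.assoc)

text \<open>As \<open>d' > 0\<close>, distinct indices \<open>n\<close> have distinct images
  \<open>d' * n\<close>, so no two terms of \<open>a\<close> are merged.\<close>

lemma lookup_lift_nonzero:
  assumes "Poly_Mapping.lookup (lift a) m \<noteq> 0"
  shows "\<exists>n. m = int d' * n \<and> Poly_Mapping.lookup a n \<noteq> 0 \<and>
    Poly_Mapping.lookup (lift a) m = const_emb (Poly_Mapping.lookup a n) * s powi (- \<beta> * n)"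
proof -
  let ?f = "\<lambda>n. const_emb (Poly_Mapping.lookup a n) * s powi (- \<beta> * n)"
  have eq: "Poly_Mapping.lookup (lift a) m = (\<Sum>n\<in>Poly_Mapping.keys a. if int d' * n = m then ?f n else 0)"
    unfolding lift_def lookup_sum by (intro sum.cong refl) (auto simp: lookup_single when_def)
  have "\<exists>n\<in>Poly_Mapping.keys a. int d' * n = m"
  proof (rule ccontr)
    assume "\<not> (\<exists>n\<in>Poly_Mapping.keys a. int d' * n = m)"
    hence "(\<Sum>n\<in>Poly_Mapping.keys a. if int d' * n = m then ?f n else 0) = 0"
      by (intro sum.neutral) auto
    thus False using eq assms by simp
  qed
  then obtain n where n: "n \<in> Poly_Mapping.keys a" "int d' * n = m" by blast
  have "(\<Sum>n\<in>Poly_Mapping.keys a. if int d' * n = m then ?f n else 0) =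
        (\<Sum>n'\<in>Poly_Mapping.keys a. if n' = n then ?f n' else 0)"
    using n(2) d'_pos by (intro sum.cong refl) auto
  also have "\<dots> = ?f n" using n(1) by simp
  finally show ?thesis using eq n by (auto simp: in_keys_iff)
qed

lemma lift_laurent_over: "lift a \<in> laurent_over radical_field"
  unfolding lift_def
  by (intro subring_sum[OF laurent_over_subring[OF radical_field_subring]]
      laurent_over_single[OF radical_field_subring] radical_intros(4) range_h_radical_field s_powi_radical)

section \<open>The divisors on the cover and their valuations\<close>

definition Dp' :: "'k laurent_closure set \<Rightarrow> rat" where
  "Dp' Q = (pullback_divisor const_emb R ext Dp Q + of_int \<beta> * principal_divisor ext s Q) / of_nat d'"

definition Dm' :: "'k laurent_closure set \<Rightarrow> rat" where
  "Dm' Q = (pullback_divisor const_emb R ext Dm Q - of_int \<beta> * principal_divisor ext s Q) / of_nat d'"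

abbreviation eram :: "'k laurent_closure set \<Rightarrow> rat" where
  "eram Q \<equiv> of_int (ramification_index const_emb R ext Q)"

context
  fixes Q assumes Q: "is_maximal ext Q"
begin

lemma pullback_at: "pullback_divisor const_emb R ext D Q = eram Q * D (contract Q)"
  using Q closed_points_iff[OF ext_subring] by (simp add: pullback_divisor_def contract_def)

lemma principal_at: "principal_divisor ext s Q = of_int (ord_at ext Q s)"
  using Q closed_points_iff[OF ext_subring] by (simp add: principal_divisor_def)

lemma Dp'_at: "of_nat d' * Dp' Q = eram Q * Dp (contract Q) + of_int \<beta> * of_int (ord_at ext Q s)"
  using d'_pos by (simp add: Dp'_def pullback_at principal_at)

lemma Dm'_at: "of_nat d' * Dm' Q = eram Q * Dm (contract Q) - of_int \<beta> * of_int (ord_at ext Q s)"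
  using d'_pos by (simp add: Dm'_def pullback_at principal_at)

lemma ord_s_powi: "ord_at ext Q (s powi n) = n * ord_at ext Q s"
  by (rule B.ord_powi[OF Q s_frac_ext s_nonzero])

lemma ord_lift_term:
  assumes "c \<noteq> 0"
  shows "ord_at ext Q (const_emb c * s powi (- \<beta> * n)) =
    ramification_index const_emb R ext Q * ord_at R (contract Q) c - \<beta> * n * ord_at ext Q s"
proof -
  have "ord_at ext Q (const_emb c * s powi (- \<beta> * n)) = ord_at ext Q (const_emb c) + ord_at ext Q (s powi (- \<beta> * n))"
    using assms s_nonzero by (intro B.ord_mult[OF Q] h_frac_ext B0.frac_powi s_frac_ext) auto
  thus ?thesis unfolding ord_s_powi ord_pullback[OF Q assms] by simp
qed

text \<open>With this relation between \<open>r\<close> and \<open>r'\<close> the contributions of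
  \<open>s\<close> cancel, and the value of each term is multiplied by the ramification index. Both
  \<open>Dp'\<close> and \<open>- Dm'\<close> satisfy it, because \<beta> enters the two divisors
  with opposite signs.\<close>

lemma mval_ge_lift:
  assumes a: "A.mval_ge (contract Q) r 0 a"
    and r': "of_nat d' * r' = eram Q * r + of_int \<beta> * of_int (ord_at ext Q s)"
  shows "B.mval_ge Q r' 0 (lift a)"
  unfolding B.mval_ge_def
proof (intro allI impI)
  fix m assume "Poly_Mapping.lookup (lift a) m \<noteq> 0"
  then obtain n where n: "m = int d' * n" "Poly_Mapping.lookup a n \<noteq> 0"
    "Poly_Mapping.lookup (lift a) m = const_emb (Poly_Mapping.lookup a n) * s powi (- \<beta> * n)"
    using lookup_lift_nonzero by blast
  have "of_int m * r' = of_int n * (of_nat d' * r')" by (simp add: n(1) mult_ac)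
  hence "B.mval Q r' (lift a) m = eram Q * A.mval (contract Q) r a n"
    unfolding B.mval_def A.mval_def n(3) ord_lift_term[OF n(2)] r' by (simp add: algebra_simps)
  moreover have "0 \<le> A.mval (contract Q) r a n" using a n(2) by (simp add: A.mval_ge_def)
  ultimately show "0 \<le> B.mval Q r' (lift a) m"
    using ramification_index_nonneg[OF Q] by simp
qed

lemma D'_le: "Dp' Q + Dm' Q \<le> 0"
proof -
  have "of_nat d' * (Dp' Q + Dm' Q) = eram Q * (Dp (contract Q) + Dm (contract Q))"
    using Dp'_at Dm'_at by (simp add: algebra_simps)
  also have "\<dots> \<le> 0"
    using ramification_index_nonneg[OF Q] D_le[of "contract Q"] by (simp add: mult_nonneg_nonpos)
  finally show ?thesis using d'_pos by (simp add: mult_le_0_iff)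
qed

end

lemma D'_le_all: "Dp' Q + Dm' Q \<le> 0"
  using D'_le[of Q] closed_points_iff[OF ext_subring, of Q]
  by (cases "Q \<in> closed_points ext") (auto simp: Dp'_def Dm'_def pullback_divisor_def principal_divisor_def)

definition base_algebra :: "'k laurent_closure set" where
  "base_algebra = laurent_emb ` dpd_algebra R Dp Dm"

lemma base_algebra_subring: "is_subring base_algebra"
proof -
  note D = A.dpd_algebra_subring[of Dp Dm, OF D_le]
  show ?thesis
    unfolding is_subring_def base_algebra_def
    using subring_1[OF D] subring_diff[OF D] subring_mult[OF D]
    by (auto simp flip: laurent_emb_diff laurent_emb_mult) (metis imageI laurent_emb_1)
qed

text \<open>Transcendence of \<open>w\<close> turns the integral equation into an identity of
  Laurent polynomials. Its coefficients are lifts from \<open>A\<close> and have nonnegative values,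
  so \<open>mval_ge_integral\<close> applies to both valuations at every point.\<close>

lemma integral_imp_dpd_coeffs:
  assumes p: "p \<in> laurent_over radical_field" and int: "integral_over base_algebra (laurent_eval w p)"
  shows "p \<in> dpd_algebra ext Dp' Dm'"
proof -
  note L = laurent_over_subring[OF radical_field_subring]
  obtain P where P: "lead_coeff P = 1" "poly_over base_algebra P" "poly P (laurent_eval w p) = 0"
    using int by (auto simp: integral_over_def)
  have "\<forall>i. \<exists>a. a \<in> dpd_algebra R Dp Dm \<and> coeff P i = laurent_emb a"
    using P(2) by (auto simp: poly_over_def base_algebra_def)
  from choice[OF this] obtain a where a: "\<And>i. a i \<in> dpd_algebra R Dp Dm" "\<And>i. coeff P i = laurent_emb (a i)"
    by blast
  define n where "n = degree P"
  define q where "q i = lift (a i)" for i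
  have qL: "q i \<in> laurent_over radical_field" for i unfolding q_def by (rule lift_laurent_over)
  have "laurent_eval w (p ^ n + (\<Sum>i<n. q i * p ^ i)) = laurent_eval w p ^ n + (\<Sum>i<n. coeff P i * laurent_eval w p ^ i)"
    by (simp add: laurent_eval_add laurent_eval_sum laurent_eval_mult laurent_eval_power w_nonzero q_def laurent_eval_lift a(2))
  also have "\<dots> = (\<Sum>i\<le>n. coeff P i * laurent_eval w p ^ i)"
    using P(1) by (simp add: n_def lessThan_Suc_atMost[symmetric])
  also have "\<dots> = 0" using P(3) by (simp add: poly_altdef n_def)
  finally have "laurent_eval w (p ^ n + (\<Sum>i<n. q i * p ^ i)) = 0" .
  moreover have "p ^ n + (\<Sum>i<n. q i * p ^ i) \<in> laurent_over radical_field"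
    by (rule subring_add[OF L subring_power[OF L p] subring_sum[OF L subring_mult[OF L qL subring_power[OF L p]]]])
  ultimately have eq: "p ^ n + (\<Sum>i<n. q i * p ^ i) = 0" by (intro transcendental)
  have "B.mval_ge Q r 0 p" if Q: "is_maximal ext Q" and r: "r \<in> {Dp' Q, - Dm' Q}" for Q r
  proof (rule B.mval_ge_integral[OF Q _ _ _ eq])
    show "p \<in> laurent_over (frac_field ext)" using p frac_ext by simp
    show "q i \<in> laurent_over (frac_field ext)" for i using qL frac_ext by simp
    show "B.mval_ge Q r 0 (q i)" for i
    proof -
      have "A.mval_ge (contract Q) (Dp (contract Q)) 0 (a i)" "A.mval_ge (contract Q) (- Dm (contract Q)) 0 (a i)"
        using a(1)[of i] contract_maximal[OF Q] A.dpd_algebra_iff[of Dp Dm, OF D_le] by blast+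
      moreover have "of_nat d' * (- Dm' Q) = eram Q * (- Dm (contract Q)) + of_int \<beta> * of_int (ord_at ext Q s)"
        using Dm'_at[OF Q] by simp
      ultimately show ?thesis
        using r mval_ge_lift[OF Q _ Dp'_at[OF Q]] mval_ge_lift[OF Q, of "- Dm (contract Q)" "a i" "- Dm' Q"]
        unfolding q_def by blast
    qed
  qed
  thus ?thesis
    using p frac_ext by (subst B.dpd_algebra_iff) (auto intro: D'_le_all)
qed

end

section \<open>Uniform bounds for finitely many rationals\<close>

lemma common_denominator:
  assumes "finite (A :: rat set)"
  shows "\<exists>N>0. \<forall>x\<in>A. \<exists>z. of_nat N * x = of_int z"
  using assms
proof (induction A rule: finite_induct)
  case (insert x A)
  then obtain N where N: "N > 0" "\<forall>x\<in>A. \<exists>z. of_nat N * x = of_int z" by blast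
  obtain a b where ab: "quotient_of x = (a, b)" by fastforce
  have b: "b > 0" "x = of_int a / of_int b"
    using quotient_of_denom_pos[OF ab] quotient_of_div[OF ab] by auto
  have "\<exists>z. of_nat (N * nat b) * y = of_int z" if "y \<in> insert x A" for y
  proof (cases "y = x")
    case True
    have bx: "of_int b * x = of_int a" using b(1) by (subst b(2)) simp
    have "of_nat (N * nat b) * y = of_nat N * (of_int b * x)" using b(1) True by simp
    hence "of_nat (N * nat b) * y = of_int (int N * a)" unfolding bx of_int_mult of_int_of_nat_eq .
    thus ?thesis ..
  next
    case False
    hence "y \<in> A" using that by simp
    from bspec[OF N(2) this] obtain z where z: "of_nat N * y = of_int z" ..
    have "of_nat (N * nat b) * y = of_int b * (of_nat N * y)" using b(1) by simp
    also have "\<dots> = of_int (b * z)" unfolding z by simp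
    finally show ?thesis by (intro exI[of _ "b * z"])
  qed
  moreover have "N * nat b > 0" using N(1) b(1) by simp
  ultimately show ?case by blast
qed (auto intro: exI[of _ 1])

lemma uniform_lower_bound:
  assumes "finite A"
  shows "\<exists>M::nat. \<forall>x\<in>A. - of_nat M \<le> (f x :: rat)"
  using assms
proof (induction A rule: finite_induct)
  case (insert x A)
  then obtain M where M: "\<forall>x\<in>A. - of_nat M \<le> f x" by blast
  obtain n :: nat where n: "- f x \<le> of_nat n" using of_nat_ceiling by blast
  have "- of_nat (max M n) \<le> f y" if "y \<in> insert x A" for y
  proof (cases "y = x")
    case True
    have "of_nat n \<le> (of_nat (max M n) :: rat)" by simp
    thus ?thesis using n unfolding True by linarith
  next
    case False
    have "of_nat M \<le> (of_nat (max M n) :: rat)" by simp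
    moreover have "- of_nat M \<le> f y" using False that M by blast
    ultimately show ?thesis by linarith
  qed
  thus ?case by blast
qed simp

context cyclic_cover
begin

section \<open>Homogeneous integral elements\<close>

lemma dpd_algebra_single:
  assumes "c \<noteq> 0" "\<And>P. is_maximal R P \<Longrightarrow>
    0 \<le> of_int (ord_at R P c) + (if n \<ge> 0 then of_int n * Dp P else of_int (- n) * Dm P)"
  shows "Poly_Mapping.single n c \<in> dpd_algebra R Dp Dm"
proof -
  have "c \<in> dpd_coeffs R Dp Dm n"
    using assms frac_R unfolding dpd_coeffs_def
    by (auto simp: A.global_sections_iff A.add_floor_nonneg_iff)
  moreover have "0 \<in> dpd_coeffs R Dp Dm m" for m
    using frac_R unfolding dpd_coeffs_def by (simp add: A.global_sections_iff)
  ultimately show ?thesis by (auto simp: dpd_algebra_def lookup_single when_def)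
qed

lemma const_emb_base_algebra:
  assumes "a \<in> R"
  shows "const_emb a \<in> base_algebra"
proof (cases "a = 0")
  case True
  thus ?thesis using subring_0[OF base_algebra_subring] by simp
next
  case False
  hence "Poly_Mapping.single 0 a \<in> dpd_algebra R Dp Dm"
    using A.ord_R_ge_0 assms by (intro dpd_algebra_single) auto
  thus ?thesis by (auto simp: base_algebra_def const_emb_def)
qed

lemmas base_closure = integral_closure_subring[OF base_algebra_subring]

lemma ext_integral_base:
  assumes "x \<in> ext"
  shows "integral_over base_algebra x"
  by (rule integral_over_mono[OF _ ext_integral[OF assms]]) (auto intro: const_emb_base_algebra)

lemma Dp_finite: "finite {P. Dp P \<noteq> 0}" and Dm_finite: "finite {P. Dm P \<noteq> 0}"
  using Dp Dm by (auto simp: qdivisor_def)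

text \<open>The \<open>a \<in> R\<close> for which \<open>a g u\<^sup>n\<close> is integral form an ideal. It is not contained in any \<open>P\<close>:
  some power of \<open>g u\<^sup>n\<close> differs from a section of \<open>n N D\<close> by a factor that is integral over \<open>P\<close>,
  and the finitely many other points are dealt with by a function in all of them but not in \<open>P\<close>.\<close>

lemma section_integral:
  fixes n :: int
  defines "E \<equiv> (\<lambda>P. if n \<ge> 0 then of_int n * Dp P else of_int (- n) * Dm P)"
  assumes g: "g \<in> radical_field" "g \<noteq> 0"
    and ord_g: "\<And>Q. is_maximal ext Q \<Longrightarrow> 0 \<le> of_int (ord_at ext Q g) + eram Q * E (contract Q)"
  shows "integral_over base_algebra (g * u_var powi n)"
proof -
  have E_fin: "finite {P. E P \<noteq> 0}"
    by (rule finite_subset[of _ "{P. Dp P \<noteq> 0} \<union> {P. Dm P \<noteq> 0}"]) (auto simp: E_def Dp_finite Dm_finite)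
  have "E ` UNIV \<subseteq> insert 0 (E ` {P. E P \<noteq> 0})" by auto
  hence "finite (E ` UNIV)" using E_fin finite_subset by blast
  \<comment> \<open>\<open>N\<close> clears the denominators of the divisor, so that near any point
    there is a function of exactly the minimal order required.\<close>
  from common_denominator[OF this] obtain N where
    N: "N > 0" "\<And>P. \<exists>z. of_nat N * E P = of_int z" by auto
  define gu where "gu = g * u_var powi n"
  define I where "I = {a \<in> R. integral_over base_algebra (const_emb a * gu)}"
  have I: "is_ideal R I"
    unfolding is_ideal_def
  proof (intro conjI ballI)
    show "I \<subseteq> R" by (auto simp: I_def)
    show "0 \<in> I" using A.R_intros(1) subring_0[OF base_closure] by (simp add: I_def)
  next
    fix a b assume "a \<in> I" "b \<in> I"
    thus "a + b \<in> I"
      using A.R_intros(3) subring_add[OF base_closure, of "const_emb a * gu" "const_emb b * gu"]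
      by (simp add: I_def hom_distribs distrib_right)
  next
    fix r a assume "r \<in> R" "a \<in> I"
    thus "r * a \<in> I"
      using A.R_intros(4) subring_mult[OF base_closure, of "const_emb r" "const_emb a * gu"]
        integral_incl[OF base_algebra_subring const_emb_base_algebra]
      by (simp add: I_def hom_distribs mult.assoc)
  qed
  have "1 \<in> I"
  proof (rule ccontr)
    assume "1 \<notin> I"
    then obtain P where P: "is_maximal R P" "I \<subseteq> P"
      using exists_maximal_ideal[OF A.subring A.noeth I] by blast
    obtain e0 where e0: "of_nat N * E P = of_int e0" using N(2) by blast
    obtain \<pi> where \<pi>: "uniformizer R P \<pi>" using A.uniformizer_exists[OF P(1)] by blast
    have \<pi>0: "\<pi> \<noteq> 0" by (rule A.unif_nonzero[OF P(1) \<pi>])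
    \<comment> \<open>Near \<open>P\<close> the element \<open>c * u_var powi (n * N)\<close>
      generates the sections of degree \<open>n * N\<close>: its order there is the least one
      allowed.\<close>
    define c where "c = \<pi> powi (- e0)"
    have c0: "c \<noteq> 0" using \<pi>0 by (simp add: c_def)
    have frac: "x \<in> frac_field R" for x using frac_R by simp
    have ord_c: "ord_at R P c = - e0"
      using A.ord_powi[OF P(1) frac \<pi>0, of "- e0"] A.ord_unif[OF P(1) \<pi>] by (simp add: c_def)
    \<comment> \<open>The comparison factor between \<open>gu ^ N\<close> and
      \<open>c * u_var powi (n * N)\<close>. It has nonnegative order over \<open>P\<close>;
      elsewhere neither \<open>G\<close> nor \<open>c\<close> is under control yet.\<close>
    define G where "G = g ^ N * inverse (const_emb c)"
    have G: "G \<in> radical_field" "G \<noteq> 0"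
      using g c0 radical_field_inverse[OF range_h_radical_field]
      by (auto simp: G_def intro!: radical_intros)
    have ord_G: "ord_at ext Q G = int N * ord_at ext Q g - ramification_index const_emb R ext Q * ord_at R (contract Q) c"
      if Q: "is_maximal ext Q" for Q
    proof -
      have fr: "g \<in> frac_field ext" "g ^ N \<in> frac_field ext" "const_emb c \<in> frac_field ext" "inverse (const_emb c) \<in> frac_field ext"
        using g(1) frac_ext h_frac_ext B0.frac_field_inverse subring_power[OF B0.frac_field_subring] by auto
      have "ord_at ext Q G = ord_at ext Q (g ^ N) + ord_at ext Q (inverse (const_emb c))"
        unfolding G_def using g(2) c0 fr by (intro B.ord_mult[OF Q]) auto
      also have "ord_at ext Q (g ^ N) = int N * ord_at ext Q g"
        by (rule B.ord_power[OF Q fr(1) g(2)])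
      also have "ord_at ext Q (inverse (const_emb c)) = - ord_at ext Q (const_emb c)"
        using c0 by (intro B.ord_inverse[OF Q fr(3)]) simp
      finally show ?thesis using ord_pullback[OF Q c0] by simp
    qed
    have ord_G_over: "0 \<le> ord_at ext Q G" if Q: "is_maximal ext Q" "contract Q = P" for Q
    proof -
      have "0 \<le> of_nat N * (of_int (ord_at ext Q g) + eram Q * E P)"
        using ord_g[OF Q(1)] Q(2) by simp
      also have "\<dots> = of_nat N * of_int (ord_at ext Q g) + eram Q * (of_nat N * E P)"
        by (simp add: algebra_simps)
      also have "\<dots> = of_int (ord_at ext Q G)"
        unfolding ord_G[OF Q(1)] Q(2) ord_c e0 by simp
      finally show ?thesis by simp
    qed
    \<comment> \<open>Outside \<open>F1\<close> and \<open>P\<close> the conditions on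
      \<open>c\<close> hold trivially, and \<open>F2\<close> contains the images of all possible
      poles of \<open>G\<close> not over \<open>P\<close>.\<close>
    define F1 where "F1 = {P'. is_maximal R P' \<and> P' \<noteq> P \<and> (ord_at R P' c \<noteq> 0 \<or> E P' \<noteq> 0)}"
    define QG where "QG = {Q. is_maximal ext Q \<and> ord_at ext Q G \<noteq> 0}"
    define F2 where "F2 = contract ` QG - {P}"
    have "F1 \<subseteq> {P'. is_maximal R P' \<and> ord_at R P' c \<noteq> 0} \<union> {P'. E P' \<noteq> 0}" by (auto simp: F1_def)
    hence F1_fin: "finite F1" using A.finite_ord_nonzero[OF frac c0] E_fin finite_subset by blast
    have QG_fin: "finite QG" unfolding QG_def using G frac_ext by (intro B.finite_ord_nonzero) auto
    have F_fin: "finite (F1 \<union> F2)" using F1_fin QG_fin by (simp add: F2_def)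
    have F_max: "is_maximal R P' \<and> P' \<noteq> P" if "P' \<in> F1 \<union> F2" for P'
      using that contract_maximal by (auto simp: F1_def F2_def QG_def)
    obtain y where y: "y \<in> R" "y \<notin> P" "\<forall>P'\<in>F1 \<union> F2. y \<in> P'"
      using A.maximal_separation[OF P(1) F_fin F_max] by blast
    have y0: "y \<noteq> 0" by (rule A.not_P_nonzero[OF P(1) y(2)])
    from uniform_lower_bound[OF F1_fin, of "\<lambda>P'. of_int (ord_at R P' c) + of_nat N * E P'"]
    obtain M1 :: nat where M1: "\<forall>P'\<in>F1. - of_nat M1 \<le> of_int (ord_at R P' c) + of_nat N * E P'" ..
    from uniform_lower_bound[OF QG_fin, of "\<lambda>Q. rat_of_int (ord_at ext Q G)"]
    obtain M2 :: nat where M2: "\<forall>Q\<in>QG. - of_nat M2 \<le> rat_of_int (ord_at ext Q G)" ..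
    \<comment> \<open>\<open>M1\<close> bounds the failure of \<open>c\<close> to be a section and
      \<open>M2\<close> the pole orders of \<open>G\<close>; the power \<open>y ^ M\<close>
      compensates for both.\<close>
    define M where "M = M1 + M2"
    define z where "z = y ^ M"
    have z: "z \<in> R" "z \<notin> P" "z \<noteq> 0"
    proof -
      show "z \<in> R" unfolding z_def by (rule subring_power[OF A.subring y(1)])
      show "z \<noteq> 0" using y0 by (simp add: z_def)
      have "y ^ m \<notin> P" for m
        by (induction m) (use A.maximal_not_1[OF P(1)] A.not_P_mult[OF P(1) y(1,2)] subring_power[OF A.subring y(1)] in auto)
      thus "z \<notin> P" by (simp add: z_def)
    qed
    have zP: "ord_at R P' z \<ge> int M" if "P' \<in> F1 \<union> F2" for P'
    proof -
      have P': "is_maximal R P'" using F_max that by blast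
      have "1 \<le> ord_at R P' y" using A.ord_R_pos_iff[OF P' y(1) y0] y(3) that by force
      hence "int M * 1 \<le> int M * ord_at R P' y" by (intro mult_left_mono) auto
      thus ?thesis using A.ord_power[OF P' frac y0, of M] by (simp add: z_def)
    qed
    have "Poly_Mapping.single (n * int N) (z * c) \<in> dpd_algebra R Dp Dm"
    proof (rule dpd_algebra_single)
      show "z * c \<noteq> 0" using z(3) c0 by simp
      fix P' assume P': "is_maximal R P'"
      have ord_zc: "ord_at R P' (z * c) = ord_at R P' z + ord_at R P' c"
        by (rule A.ord_mult[OF P' frac z(3) frac c0])
      have "0 \<le> of_int (ord_at R P' (z * c)) + of_nat N * E P'"
      proof (cases "P' \<in> F1")
        case True
        have "rat_of_nat M1 \<le> of_nat M" by (simp add: M_def)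
        moreover have "rat_of_int (int M) \<le> of_int (ord_at R P' z)" using zP[of P'] True by (simp only: of_int_le_iff) blast
        ultimately show ?thesis using M1 True unfolding ord_zc by fastforce
      next
        case False
        have zge: "0 \<le> ord_at R P' z" by (rule A.ord_R_ge_0[OF P' z(1,3)])
        show ?thesis
        proof (cases "P' = P")
          case True
          thus ?thesis using zge unfolding ord_zc by (simp add: ord_c e0)
        next
          case False
          thus ?thesis using zge \<open>P' \<notin> F1\<close> P' unfolding ord_zc by (simp add: F1_def)
        qed
      qed
      also have "of_nat N * E P' = (if n * int N \<ge> 0 then of_int (n * int N) * Dp P' else of_int (- (n * int N)) * Dm P')"
        using N(1) by (simp add: E_def zero_le_mult_iff mult_ac)
      finally show "0 \<le> of_int (ord_at R P' (z * c)) + (if n * int N \<ge> 0 then of_int (n * int N) * Dp P' else of_int (- (n * int N)) * Dm P')" .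
    qed
    hence "laurent_emb (Poly_Mapping.single (n * int N) (z * c)) \<in> base_algebra"
      unfolding base_algebra_def by blast
    hence int1: "integral_over base_algebra (const_emb (z * c) * u_var powi (n * int N))"
      unfolding laurent_emb_single by (rule integral_incl[OF base_algebra_subring])
    have "const_emb z * G \<in> ext"
    proof (rule B.in_R_if_ord_ge_0)
      show "const_emb z * G \<in> frac_field ext"
        using G(1) frac_ext by (auto intro: radical_intros)
      show "const_emb z * G \<noteq> 0" using z(3) G(2) by simp
      fix Q assume Q: "is_maximal ext Q"
      have "G \<in> frac_field ext" using G(1) frac_ext by simp
      hence ord_zG: "ord_at ext Q (const_emb z * G) = ord_at ext Q (const_emb z) + ord_at ext Q G"
        using z(3) G(2) by (intro B.ord_mult[OF Q h_frac_ext]) auto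
      have zge: "0 \<le> ord_at ext Q (const_emb z)"
        using z by (intro B.ord_R_ge_0[OF Q h_ext]) auto
      show "0 \<le> ord_at ext Q (const_emb z * G)"
      proof (cases "contract Q = P \<or> ord_at ext Q G = 0")
        case True
        thus ?thesis using ord_G_over[OF Q] zge ord_zG by auto
      next
        case False
        hence QQ: "Q \<in> QG" "contract Q \<in> F2" using Q by (auto simp: QG_def F2_def)
        have "y \<in> contract Q" using y(3) QQ(2) by blast
        hence "const_emb y \<in> Q" by (simp add: contract_def)
        hence "1 \<le> ord_at ext Q (const_emb y)"
          using B.ord_R_pos_iff[OF Q h_ext[OF y(1)]] y0 by simp
        hence "int M * 1 \<le> int M * ord_at ext Q (const_emb y)" by (intro mult_left_mono) auto
        moreover have "ord_at ext Q (const_emb z) = int M * ord_at ext Q (const_emb y)"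
          using B.ord_power[OF Q h_frac_ext, of y M] y0 by (simp add: z_def hom_distribs)
        moreover have "- int M2 \<le> ord_at ext Q G"
        proof -
          have "rat_of_int (- int M2) \<le> rat_of_int (ord_at ext Q G)" using M2 QQ(1) by simp
          thus ?thesis by (simp only: of_int_le_iff)
        qed
        ultimately show ?thesis using ord_zG by (simp add: M_def)
      qed
    qed
    hence int2: "integral_over base_algebra (const_emb z * G)" by (rule ext_integral_base)
    have u_pow: "(u_var :: 'k laurent_closure) powi (n * int N) = (u_var powi n) ^ N"
      by (simp add: power_int_mult)
    \<comment> \<open>One factor \<open>z\<close> brings the section into \<open>A\<close>, another
      brings \<open>G\<close> into \<open>ext\<close>; hence the square of \<open>z\<close> in front
      of \<open>gu ^ N\<close>.\<close>
    have "integral_over base_algebra ((const_emb (z * c) * u_var powi (n * int N)) * (const_emb z * G))"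
      using subring_mult[OF base_closure] int1 int2 by blast
    also have "(const_emb (z * c) * u_var powi (n * int N)) * (const_emb z * G) = const_emb (z * z) * gu ^ N"
      using c0 by (simp add: u_pow G_def gu_def hom_distribs power_mult_distrib mult_ac)
    finally have "integral_over base_algebra (const_emb (z * z) * gu ^ N)" .
    \<comment> \<open>The missing factors complete an \<open>N\<close>-th power, so that an
      \<open>N\<close>-th root can be taken.\<close>
    moreover have "integral_over base_algebra (const_emb ((z * z) ^ (N - 1)))"
      using z(1) by (intro integral_incl[OF base_algebra_subring] const_emb_base_algebra A.R_intros)
    ultimately have "integral_over base_algebra (const_emb ((z * z) ^ (N - 1)) * (const_emb (z * z) * gu ^ N))"
      using subring_mult[OF base_closure] by blast
    also have "const_emb ((z * z) ^ (N - 1)) * (const_emb (z * z) * gu ^ N) = (const_emb (z * z) * gu) ^ N"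
    proof -
      have "const_emb (y ^ (N - 1)) * const_emb y = const_emb y ^ N" for y :: 'k
        using N(1) by (cases N) (auto simp: h.hom_power mult.commute)
      from this[of "z * z"] show ?thesis by (simp only: power_mult_distrib mult.assoc[symmetric])
    qed
    finally have "integral_over base_algebra (const_emb (z * z) * gu)"
      by (rule integral_root[OF base_algebra_subring N(1)])
    hence "z * z \<in> I" using z(1) A.R_intros(4) by (simp add: I_def)
    moreover have "z * z \<notin> P" by (rule A.not_P_mult[OF P(1) z(1,2) z(1,2)])
    ultimately show False using P(2) by blast
  qed
  thus ?thesis by (simp add: I_def gu_def)
qed

lemma dpd_coeffs_radical: "f \<in> dpd_coeffs ext Dp' Dm' n \<Longrightarrow> f \<in> radical_field"
  using B.dpd_coeffs_iff[of Dp' Dm', OF D'_le_all] frac_ext by blast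

text \<open>The \<open>d'\<close>-th power of \<open>f * w powi n\<close> is
  \<open>g * u_var powi n\<close>, and \<open>d'\<close> times the condition on \<open>f\<close> is
  exactly the condition on \<open>g\<close> in \<open>section_integral\<close>. Integrality then
  descends to the root.\<close>

lemma dpd_coeffs_imp_integral:
  assumes f: "f \<in> dpd_coeffs ext Dp' Dm' n"
  shows "integral_over base_algebra (f * w powi n)"
proof (cases "f = 0")
  case True
  thus ?thesis using subring_0[OF base_closure] by simp
next
  case False
  have fr: "f \<in> radical_field" by (rule dpd_coeffs_radical[OF f])
  define g where "g = f ^ d' * s powi (\<beta> * n)"
  have g: "g \<in> radical_field" "g \<noteq> 0"
    using fr False s_nonzero s_powi_radical by (auto simp: g_def intro: radical_intros)
  have "integral_over base_algebra (g * u_var powi n)"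
  proof (rule section_integral[OF g])
    fix Q assume Q: "is_maximal ext Q"
    have frac: "f \<in> frac_field ext" "f ^ d' \<in> frac_field ext" "s powi (\<beta> * n) \<in> frac_field ext"
      using fr frac_ext s_powi_radical by (auto intro: radical_intros)
    have "ord_at ext Q g = ord_at ext Q (f ^ d') + ord_at ext Q (s powi (\<beta> * n))"
      unfolding g_def using False s_nonzero by (intro B.ord_mult[OF Q frac(2) _ frac(3)]) auto
    hence ord_g: "ord_at ext Q g = int d' * ord_at ext Q f + \<beta> * n * ord_at ext Q s"
      using B.ord_power[OF Q frac(1) False] ord_s_powi[OF Q] by simp
    have cond: "0 \<le> of_int (ord_at ext Q f) + of_int n * Dp' Q" "0 \<le> of_int (ord_at ext Q f) + of_int n * (- Dm' Q)"
      using f False Q B.dpd_coeffs_iff[of Dp' Dm', OF D'_le_all] by blast+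
    show "0 \<le> of_int (ord_at ext Q g) + eram Q * (if n \<ge> 0 then of_int n * Dp (contract Q) else of_int (- n) * Dm (contract Q))"
    proof (cases "n \<ge> 0")
      case True
      have "0 \<le> of_nat d' * (of_int (ord_at ext Q f) + of_int n * Dp' Q)" using cond(1) by simp
      also have "\<dots> = of_nat d' * of_int (ord_at ext Q f) + of_int n * (of_nat d' * Dp' Q)"
        by (simp add: algebra_simps)
      also have "\<dots> = of_int (ord_at ext Q g) + eram Q * (of_int n * Dp (contract Q))"
        unfolding Dp'_at[OF Q] ord_g by (simp add: algebra_simps)
      finally show ?thesis using True by simp
    next
      case False
      have "0 \<le> of_nat d' * (of_int (ord_at ext Q f) + of_int n * (- Dm' Q))" using cond(2) by simp
      also have "\<dots> = of_nat d' * of_int (ord_at ext Q f) - of_int n * (of_nat d' * Dm' Q)"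
        by (simp add: algebra_simps)
      also have "\<dots> = of_int (ord_at ext Q g) + eram Q * (of_int (- n) * Dm (contract Q))"
        unfolding Dm'_at[OF Q] ord_g by (simp add: algebra_simps)
      finally show ?thesis using False by simp
    qed
  qed
  also have "g * u_var powi n = (f * w powi n) ^ d'"
  proof -
    have "s powi (\<beta> * n) * u_var powi n = w powi (int d' * n)"
      unfolding u_powi using s_nonzero by (simp add: power_int_minus flip: mult.assoc)
    also have "\<dots> = (w powi n) ^ d'" by (simp add: power_int_mult mult.commute[of "int d'"])
    finally show ?thesis by (simp add: g_def power_mult_distrib mult.assoc)
  qed
  finally show ?thesis by (rule integral_root[OF base_algebra_subring d'_pos])
qed

end

section \<open>Laurent polynomials over a field are integrally closed\<close>

text \<open>Leading coefficients multiply, so the coefficients of \<open>H\<close> are recovered in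
  \<open>K\<close> from the top down. Needed because greatest common divisors are formed over the
  whole type, not over \<open>K\<close>.\<close>

lemma poly_over_factor:
  fixes Q H :: "'a::field poly"
  assumes K: "is_subring K" "\<And>x. x \<in> K \<Longrightarrow> inverse x \<in> K"
    and Q: "poly_over K Q" "Q \<noteq> 0" and QH: "poly_over K (Q * H)"
  shows "poly_over K H"
proof -
  have "poly_over K H" if "poly_over K (Q * H)" "\<forall>i\<ge>n. coeff H i = 0" for n H
    using that
  proof (induction n arbitrary: H)
    case 0
    hence "H = 0" by (intro poly_eqI) auto
    thus ?case by (simp add: poly_over_0[OF K(1)])
  next
    case (Suc n)
    define c where "c = coeff H n"
    have cK: "c \<in> K"
    proof (cases "c = 0")
      case True
      thus ?thesis using subring_0[OF K(1)] by simp
    next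
      case False
      have "degree H \<le> n" using Suc.prems(2) by (intro degree_le) auto
      moreover have "n \<le> degree H" using False unfolding c_def by (rule le_degree)
      ultimately have "degree H = n" by simp
      hence "coeff (Q * H) (degree Q + n) = lead_coeff Q * c"
        using coeff_mult_degree_sum[of Q H] by (simp add: c_def)
      moreover have "coeff (Q * H) (degree Q + n) \<in> K" "lead_coeff Q \<in> K"
        using Suc.prems(1) Q(1) by (auto simp: poly_over_def)
      ultimately have "lead_coeff Q * c * inverse (lead_coeff Q) \<in> K"
        using K(2) subring_mult[OF K(1)] by auto
      also have "lead_coeff Q * c * inverse (lead_coeff Q) = c"
        using Q(2) by (simp add: field_simps)
      finally show ?thesis .
    qed
    have "poly_over K (Q * (H - monom c n))"
      unfolding right_diff_distrib
      by (intro poly_over_diff[OF K(1)] Suc.prems(1) poly_over_mult[OF K(1)] Q(1) poly_over_monom[OF K(1)] cK)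
    moreover have "\<forall>i\<ge>n. coeff (H - monom c n) i = 0"
      using Suc.prems(2) by (auto simp: c_def Suc_le_eq)
    ultimately have "poly_over K (H - monom c n)" by (rule Suc.IH)
    from poly_over_add[OF K(1) this poly_over_monom[OF K(1) cK, of n]] show ?case by simp
  qed
  from this[OF QH, of "Suc (degree H)"] show ?thesis by (simp add: coeff_eq_0)
qed

text \<open>Provides greatest common divisors of polynomials over the closure, and with them reduced
  fractions.\<close>

instance alg_closure :: (field) field_gcd ..

text \<open>The rational root argument: in a reduced fraction the denominator divides a power of the
  numerator, hence is a unit. Transcendence of \<open>w\<close> permits the argument to be carried
  out with formal polynomials.\<close>

lemma polys_at_integrally_closed:
  fixes z w :: "'a::field_gcd"
  assumes K: "is_subring K" "\<And>x. x \<in> K \<Longrightarrow> inverse x \<in> K"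
    and transc: "\<And>p. poly_over K p \<Longrightarrow> poly p w = 0 \<Longrightarrow> p = 0"
    and z: "z \<in> frac_field (polys_at K w)" "integral_over (polys_at K w) z"
  shows "z \<in> polys_at K w"
proof -
  obtain P Q where PQ: "z = poly P w / poly Q w" "poly_over K P" "poly_over K Q" "poly Q w \<noteq> 0"
    using z(1) by (auto simp: frac_field_def polys_at_def)
  have "Q \<noteq> 0" using PQ(4) by auto
  obtain F where F: "lead_coeff F = 1" "poly_over (polys_at K w) F" "poly F z = 0"
    using z(2) by (auto simp: integral_over_def)
  have "\<forall>i. \<exists>C. poly_over K C \<and> coeff F i = poly C w"
    using F(2) by (auto simp: poly_over_def polys_at_def)
  from choice[OF this] obtain C where C: "\<And>i. poly_over K (C i)" "\<And>i. coeff F i = poly (C i) w" by blast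
  define m where "m = degree F"
  \<comment> \<open>The equation of \<open>P / Q\<close> with its denominators cleared. It vanishes
    at \<open>w\<close>, hence as a polynomial.\<close>
  define G where "G = P ^ m + (\<Sum>i<m. C i * P ^ i * Q ^ (m - i))"
  have pow: "poly_over K (p ^ n)" if "poly_over K p" for p n
    by (induction n) (auto intro: poly_over_1[OF K(1)] poly_over_mult[OF K(1)] that)
  have "poly_over K G"
    unfolding G_def using C(1) pow PQ(2,3)
    by (intro poly_over_add[OF K(1)] poly_over_sum[OF K(1)] poly_over_mult[OF K(1)])
  moreover have "poly G w = 0"
  proof -
    have "poly G w = poly P w ^ m + (\<Sum>i<m. coeff F i * poly P w ^ i * poly Q w ^ (m - i))"
      by (simp add: G_def poly_sum C(2))
    also have "poly P w = z * poly Q w" using PQ(1,4) by simp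
    also have "(\<Sum>i<m. coeff F i * (z * poly Q w) ^ i * poly Q w ^ (m - i)) =
        (\<Sum>i<m. poly Q w ^ m * (coeff F i * z ^ i))"
    proof (intro sum.cong refl)
      fix i assume "i \<in> {..<m}"
      hence "poly Q w ^ m = poly Q w ^ i * poly Q w ^ (m - i)" by (simp flip: power_add)
      thus "coeff F i * (z * poly Q w) ^ i * poly Q w ^ (m - i) = poly Q w ^ m * (coeff F i * z ^ i)"
        by (simp add: power_mult_distrib mult_ac)
    qed
    also have "(z * poly Q w) ^ m + (\<Sum>i<m. poly Q w ^ m * (coeff F i * z ^ i)) =
        poly Q w ^ m * ((\<Sum>i<m. coeff F i * z ^ i) + z ^ m)"
      by (simp add: power_mult_distrib distrib_left sum_distrib_left mult_ac)
    also have "(\<Sum>i<m. coeff F i * z ^ i) + z ^ m = (\<Sum>i\<le>m. coeff F i * z ^ i)"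
      using F(1) by (simp add: m_def lessThan_Suc_atMost[symmetric])
    also have "\<dots> = 0" using F(3) by (simp add: poly_altdef m_def)
    finally show ?thesis by simp
  qed
  ultimately have "G = 0" by (rule transc)
  define D where "D = gcd P Q"
  have "D \<noteq> 0" using \<open>Q \<noteq> 0\<close> by (simp add: D_def)
  then obtain P1 Q1 where PQ1: "P = P1 * D" "Q = Q1 * D" "coprime P1 Q1"
    using gcd_coprime_exists[of P Q] unfolding D_def by blast
  have "G = D ^ m * (P1 ^ m + (\<Sum>i<m. C i * P1 ^ i * Q1 ^ (m - i)))"
  proof -
    have "P ^ m = D ^ m * P1 ^ m" by (simp add: PQ1(1) power_mult_distrib mult.commute)
    moreover have "C i * P ^ i * Q ^ (m - i) = D ^ m * (C i * P1 ^ i * Q1 ^ (m - i))" if "i < m" for i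
    proof -
      have "D ^ m = D ^ i * D ^ (m - i)" using that by (simp flip: power_add)
      thus ?thesis by (simp add: PQ1 power_mult_distrib mult_ac)
    qed
    hence "(\<Sum>i<m. C i * P ^ i * Q ^ (m - i)) = (\<Sum>i<m. D ^ m * (C i * P1 ^ i * Q1 ^ (m - i)))"
      by (intro sum.cong) auto
    ultimately show ?thesis by (simp only: G_def distrib_left sum_distrib_left)
  qed
  hence "P1 ^ m + (\<Sum>i<m. C i * P1 ^ i * Q1 ^ (m - i)) = 0"
    using \<open>G = 0\<close> \<open>D \<noteq> 0\<close> by simp
  hence "P1 ^ m = - (\<Sum>i<m. C i * P1 ^ i * Q1 ^ (m - i))" by (simp only: eq_neg_iff_add_eq_0)
  moreover have "Q1 dvd (\<Sum>i<m. C i * P1 ^ i * Q1 ^ (m - i))"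
  proof (rule dvd_sum)
    fix i assume "i \<in> {..<m}"
    thus "Q1 dvd C i * P1 ^ i * Q1 ^ (m - i)" by (intro dvd_mult dvd_power) auto
  qed
  ultimately have "Q1 dvd P1 ^ m" by (simp only: dvd_minus_iff)
  moreover have "coprime Q1 (P1 ^ m)" using PQ1(3) by (simp add: coprime_commute)
  ultimately have "Q1 dvd 1" by (intro coprime_common_divisor[of Q1 "P1 ^ m" Q1]) auto
  then obtain H where H: "1 = Q1 * H" by (rule dvdE)
  have "P = P1 * D * (Q1 * H)" unfolding H[symmetric] PQ1(1)[symmetric] by simp
  hence P_eq: "P = Q * (P1 * H)" unfolding PQ1(2) by (simp only: mult_ac)
  \<comment> \<open>The reduction may have left \<open>K\<close>; the quotient \<open>P1 * H\<close>
    of two polynomials over \<open>K\<close> is brought back.\<close>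
  have "poly_over K (Q * (P1 * H))" unfolding P_eq[symmetric] by (rule PQ(2))
  with K PQ(3) \<open>Q \<noteq> 0\<close> have "poly_over K (P1 * H)" by (rule poly_over_factor)
  moreover have "poly P w = poly Q w * poly (P1 * H) w" by (subst P_eq) (simp only: poly_mult)
  hence "z = poly (P1 * H) w" unfolding PQ(1) using PQ(4) by simp
  ultimately show ?thesis unfolding polys_at_def by blast
qed

context cyclic_cover
begin

definition laurents :: "'k laurent_closure set" where
  "laurents = laurent_eval w ` laurent_over radical_field"

lemma laurents_subring: "is_subring laurents"
proof -
  note L = laurent_over_subring[OF radical_field_subring]
  have "1 \<in> laurents" unfolding laurents_def using subring_1[OF L] laurent_eval_1[of w] by (metis imageI)
  thus ?thesis
    unfolding is_subring_def laurents_def using subring_diff[OF L] subring_mult[OF L]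
    by (auto simp: laurent_eval_mult[OF w_nonzero, symmetric] simp flip: laurent_eval_diff)
qed

lemma laurents_monomial: "f \<in> radical_field \<Longrightarrow> f * w powi n \<in> laurents"
  unfolding laurents_def using laurent_over_single[OF radical_field_subring, of f n] laurent_eval_single
  by (metis imageI)

lemma laurents_least:
  assumes M: "is_subring M" and "\<And>f n. f \<in> radical_field \<Longrightarrow> f * w powi n \<in> M"
  shows "laurents \<subseteq> M"
  unfolding laurents_def laurent_eval_def
  using assms(2) by (auto simp: laurent_over_def intro!: subring_sum[OF M])

lemma laurents_clear_denominator:
  assumes "y \<in> laurents"
  shows "\<exists>N. \<forall>M\<ge>N. y * w ^ M \<in> polys_at radical_field w"
proof -
  note T0 = polys_at_subring[OF radical_field_subring, of w]
  obtain p where p: "p \<in> laurent_over radical_field" "y = laurent_eval w p"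
    using assms by (auto simp: laurents_def)
  define N where "N = (\<Sum>n\<in>Poly_Mapping.keys p. nat (- n))"
  have "y * w ^ M \<in> polys_at radical_field w" if "M \<ge> N" for M
  proof -
    have "Poly_Mapping.lookup p n * w powi n * w ^ M \<in> polys_at radical_field w"
      if n: "n \<in> Poly_Mapping.keys p" for n
    proof -
      have "nat (- n) \<le> N" unfolding N_def by (rule member_le_sum) (use n in auto)
      hence nonneg: "0 \<le> n + int M" using \<open>M \<ge> N\<close> by simp
      have "w powi n * w ^ M = w powi (n + int M)"
        using w_nonzero by (simp add: power_int_add)
      hence eq: "Poly_Mapping.lookup p n * w powi n * w ^ M = Poly_Mapping.lookup p n * w ^ nat (n + int M)"
        using nonneg by (simp add: power_int_def mult.assoc)
      have "Poly_Mapping.lookup p n \<in> polys_at radical_field w"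
        using p(1) polys_at_incl[OF radical_field_subring] by (auto simp: laurent_over_def)
      thus ?thesis unfolding eq
        by (rule subring_mult[OF T0 _ subring_power[OF T0 polys_at_gen[OF radical_field_subring]]])
    qed
    thus ?thesis unfolding p(2) laurent_eval_def sum_distrib_right by (intro subring_sum[OF T0])
  qed
  thus ?thesis by blast
qed

lemma polys_at_w_laurents: "polys_at radical_field w \<subseteq> laurents"
  using laurents_monomial[of _ 0] laurents_monomial[of 1 1] radical_intros(2)
  by (intro polys_at_least[OF radical_field_subring laurents_subring]) auto

lemma transcendental_poly:
  assumes "poly_over radical_field p" "poly p w = 0"
  shows "p = 0"
proof -
  define a where "a = (\<Sum>i\<le>degree p. Poly_Mapping.single (int i) (coeff p i))"
  have "laurent_eval w a = poly p w"
    by (simp add: a_def laurent_eval_sum poly_altdef)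
  moreover have "a \<in> laurent_over radical_field"
    unfolding a_def using assms(1)
    by (intro subring_sum[OF laurent_over_subring[OF radical_field_subring]] laurent_over_single[OF radical_field_subring])
       (auto simp: poly_over_def)
  ultimately have "a = 0" using assms(2) by (intro transcendental) auto
  moreover have "Poly_Mapping.lookup a (int (degree p)) = (\<Sum>i\<le>degree p. if i = degree p then coeff p i else 0)"
    unfolding a_def lookup_sum by (intro sum.cong refl) (auto simp: lookup_single when_def)
  ultimately show ?thesis by simp
qed

text \<open>Multiplication by a high power of \<open>w\<close> reduces the claim to the polynomial
  ring in \<open>w\<close>; afterwards this power, a unit of \<open>laurents\<close>, is divided
  out.\<close>

lemma laurents_integrally_closed:
  assumes x: "x \<in> frac_field laurents" "integral_over laurents x"
  shows "x \<in> laurents"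
proof -
  let ?T0 = "polys_at radical_field w"
  note T0 = polys_at_subring[OF radical_field_subring, of w]
  obtain y q where yq: "x = y / q" "y \<in> laurents" "q \<in> laurents" "q \<noteq> 0" by (rule frac_fieldE[OF x(1)])
  obtain F where F: "lead_coeff F = 1" "poly_over laurents F" "poly F x = 0"
    using x(2) by (auto simp: integral_over_def)
  define m where "m = degree F"
  have "\<forall>i. \<exists>N. \<forall>M\<ge>N. coeff F i * w ^ M \<in> ?T0"
    using F(2) laurents_clear_denominator by (auto simp: poly_over_def)
  from choice[OF this] obtain Ni where Ni: "\<And>i M. M \<ge> Ni i \<Longrightarrow> coeff F i * w ^ M \<in> ?T0" by blast
  obtain Ny where Ny: "\<And>M. M \<ge> Ny \<Longrightarrow> y * w ^ M \<in> ?T0" using laurents_clear_denominator[OF yq(2)] by blast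
  obtain Nq where Nq: "\<And>M. M \<ge> Nq \<Longrightarrow> q * w ^ M \<in> ?T0" using laurents_clear_denominator[OF yq(3)] by blast
  define N where "N = Ny + Nq + (\<Sum>i<m. Ni i)"
  have Ni_le: "Ni i \<le> N" if "i < m" for i
    using member_le_sum[of i "{..<m}" Ni] that by (simp add: N_def)
  define z where "z = w ^ N * x"
  \<comment> \<open>The equation for \<open>w ^ N * x\<close>: each coefficient acquires a power of
    \<open>w\<close> large enough to remove negative exponents, while the leading one stays
    \<open>1\<close>.\<close>
  define H where "H = (\<Sum>i\<le>m. monom (coeff F i * w ^ (N * (m - i))) i)"
  have coeff_H: "coeff H i = (if i \<le> m then coeff F i * w ^ (N * (m - i)) else 0)" for i
  proof -
    have "coeff H i = (\<Sum>j\<le>m. if j = i then coeff F j * w ^ (N * (m - j)) else 0)"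
      unfolding H_def coeff_sum by (intro sum.cong refl) auto
    thus ?thesis by simp
  qed
  have "coeff H m = 1" using F(1) by (simp add: coeff_H m_def)
  moreover have "degree H \<le> m" by (intro degree_le) (simp add: coeff_H)
  ultimately have "lead_coeff H = 1" using le_degree[of H m] by simp
  moreover have "poly_over ?T0 H"
    unfolding poly_over_def
  proof
    fix i
    consider "i < m" | "i = m" | "i > m" by linarith
    thus "coeff H i \<in> ?T0"
    proof cases
      case 1
      hence "N * 1 \<le> N * (m - i)" by (intro mult_le_mono) auto
      hence "Ni i \<le> N * (m - i)" using Ni_le[OF 1] by linarith
      thus ?thesis using Ni 1 by (simp add: coeff_H)
    next
      case 2
      thus ?thesis using \<open>coeff H m = 1\<close> subring_1[OF T0] by simp
    next
      case 3
      thus ?thesis using subring_0[OF T0] by (simp add: coeff_H)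
    qed
  qed
  moreover have "poly H z = 0"
  proof -
    have "poly H z = (\<Sum>i\<le>m. w ^ (N * m) * (coeff F i * x ^ i))"
      unfolding H_def poly_sum poly_monom
    proof (intro sum.cong refl)
      fix i assume "i \<in> {..m}"
      hence "N * m = N * (m - i) + N * i" by (simp flip: distrib_left)
      hence "w ^ (N * m) = w ^ (N * (m - i)) * (w ^ N) ^ i" by (simp add: power_add power_mult)
      thus "coeff F i * w ^ (N * (m - i)) * z ^ i = w ^ (N * m) * (coeff F i * x ^ i)"
        by (simp add: z_def power_mult_distrib mult_ac)
    qed
    also have "\<dots> = w ^ (N * m) * poly F x" by (simp add: poly_altdef m_def sum_distrib_left)
    finally show ?thesis using F(3) by simp
  qed
  ultimately have int: "integral_over ?T0 z" unfolding integral_over_def by blast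
  \<comment> \<open>One factor \<open>w ^ N\<close> clears numerator and denominator alike; the
    additional one in the numerator turns \<open>x\<close> into \<open>z\<close>.\<close>
  have "y * w ^ (N + N) \<in> ?T0" "q * w ^ N \<in> ?T0" by (auto intro!: Ny Nq simp: N_def)
  hence "(y * w ^ (N + N)) / (q * w ^ N) \<in> frac_field ?T0"
    using yq(4) w_nonzero by (intro frac_fieldI) auto
  also have "(y * w ^ (N + N)) / (q * w ^ N) = z"
    using w_nonzero by (simp add: z_def yq(1) power_add)
  finally have zf: "z \<in> frac_field ?T0" .
  have "z \<in> ?T0"
    by (rule polys_at_integrally_closed[OF radical_field_subring _ _ zf int])
       (fact radical_field_inverse, fact transcendental_poly)
  hence "z * (1 * w powi (- int N)) \<in> laurents"
    using polys_at_w_laurents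
    by (intro subring_mult[OF laurents_subring] laurents_monomial[OF radical_intros(2)]) blast
  also have "z * (1 * w powi (- int N)) = x"
    using w_nonzero by (simp add: z_def power_int_minus field_simps)
  finally show ?thesis .
qed

section \<open>The normalization and its grading\<close>

lemma laurent_emb_laurents: "laurent_emb a \<in> laurents"
  unfolding laurents_def using laurent_eval_lift lift_laurent_over by (metis imageI)

definition cover_field :: "'k laurent_closure set" where
  "cover_field = adjoin (frac_field base_algebra) v"

lemma cover_field_subring: "is_subring cover_field"
  unfolding cover_field_def adjoin_def by (rule generate_ring_subring)

lemma cover_field_incl: "frac_field base_algebra \<subseteq> cover_field" "v \<in> cover_field"
  unfolding cover_field_def adjoin_def using generate_ring_incl[of "frac_field base_algebra \<union> {v}"] by auto

lemma cover_field_frac: "cover_field \<subseteq> frac_field laurents"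
  unfolding cover_field_def adjoin_def
proof (rule generate_ring_least[OF frac_field_is_subring[OF laurents_subring]])
  have "base_algebra \<subseteq> laurents" using laurent_emb_laurents by (auto simp: base_algebra_def)
  hence "frac_field base_algebra \<subseteq> frac_field laurents" unfolding frac_field_def by blast
  moreover have "v \<in> laurents"
    using v_powi[of 1] laurents_monomial[OF s_powi_radical, of \<gamma> "int b'"] by simp
  ultimately show "frac_field base_algebra \<union> {v} \<subseteq> frac_field laurents"
    using frac_field_contains[OF laurents_subring] by blast
qed

lemma const_emb_frac: "const_emb c \<in> frac_field base_algebra"
proof -
  obtain x y where "c = x / y" "x \<in> R" "y \<in> R" "y \<noteq> 0" using frac_fieldE[of c R] frac_R by blast
  thus ?thesis
    using frac_fieldI[OF const_emb_base_algebra const_emb_base_algebra, of x y] by (simp add: hom_distribs)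
qed

text \<open>\<open>u\<close> need not belong to \<open>A\<close>, as \<open>Dp\<close> may be
  negative. A function vanishing at all points of the support of \<open>Dp\<close>, raised to a
  sufficient power, multiplies it into \<open>A\<close>.\<close>

lemma u_var_frac: "(u_var :: 'k laurent_closure) \<in> frac_field base_algebra"
proof -
  define F where "F = {P. is_maximal R P \<and> Dp P \<noteq> 0}"
  have F: "finite F" using finite_subset[OF _ Dp_finite] by (auto simp: F_def)
  have "\<exists>a. a \<in> R \<and> a \<noteq> 0 \<and> (\<forall>P\<in>F'. a \<in> P)" if "finite F'" "F' \<subseteq> F" for F'
    using that
  proof (induction F' rule: finite_induct)
    case empty
    show ?case using A.R_intros(2) zero_neq_one by (metis empty_iff)
  next
    case (insert P F')
    then obtain a where a: "a \<in> R" "a \<noteq> 0" "\<forall>P\<in>F'. a \<in> P" by auto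
    have P: "is_maximal R P" using insert.prems by (auto simp: F_def)
    obtain c where c: "c \<in> P" "c \<noteq> 0" using A.maximal_nonzero[OF P] by blast
    have cR: "c \<in> R" by (rule A.maximal_subset[OF P c(1)])
    have "a * c \<in> P" by (rule is_idealD(4)[OF A.maximal_ideal[OF P] a(1) c(1)])
    moreover have "a * c \<in> P'" if "P' \<in> F'" for P'
    proof -
      have "is_maximal R P'" using insert.prems that by (auto simp: F_def)
      thus ?thesis using is_idealD(5)[OF A.maximal_ideal _ _, of P' c a] cR a(3) that by blast
    qed
    ultimately show ?case using a c A.R_intros(4)[OF a(1) cR] by (intro exI[of _ "a * c"]) auto
  qed
  then obtain a where a: "a \<in> R" "a \<noteq> 0" "\<forall>P\<in>F. a \<in> P" using F by blast
  from uniform_lower_bound[OF F, of Dp] obtain M where M: "\<forall>P\<in>F. - of_nat M \<le> Dp P" ..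
  have "Poly_Mapping.single 1 (a ^ M) \<in> dpd_algebra R Dp Dm"
  proof (rule dpd_algebra_single)
    show "a ^ M \<noteq> 0" using a(2) by simp
    fix P assume P: "is_maximal R P"
    have ord: "ord_at R P (a ^ M) = int M * ord_at R P a"
      using frac_R a(2) by (intro A.ord_power[OF P]) auto
    show "0 \<le> of_int (ord_at R P (a ^ M)) + (if (1::int) \<ge> 0 then of_int 1 * Dp P else of_int (- 1) * Dm P)"
    proof (cases "P \<in> F")
      case True
      hence "1 \<le> ord_at R P a" using A.ord_R_pos_iff[OF P a(1,2)] a(3) by force
      hence "int M * 1 \<le> int M * ord_at R P a" by (intro mult_left_mono) auto
      hence "rat_of_int (int M) \<le> of_int (ord_at R P (a ^ M))" unfolding ord by (simp only: of_int_le_iff mult_1_right)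
      thus ?thesis using M True by fastforce
    next
      case False
      hence "Dp P = 0" using P by (simp add: F_def)
      thus ?thesis using A.ord_R_ge_0[OF P a(1,2)] ord by simp
    qed
  qed
  hence "const_emb (a ^ M) * u_var \<in> base_algebra"
    using laurent_emb_single[of 1 "a ^ M"] unfolding base_algebra_def by (metis imageI power_int_1_right)
  moreover have "const_emb (a ^ M) \<in> base_algebra"
    using a(1) by (intro const_emb_base_algebra A.R_intros)
  ultimately have "const_emb (a ^ M) * u_var / const_emb (a ^ M) \<in> frac_field base_algebra"
    using a(2) by (intro frac_fieldI) auto
  thus ?thesis using a(2) by simp
qed

text \<open>\<open>cover_field\<close> is given only as a generated ring, so the inverse of
  \<open>v\<close> must be exhibited; it is read off from
  \<open>v ^ d' = s * u_var ^ b'\<close>.\<close>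

lemma laurents_cover_field: "laurents \<subseteq> cover_field"
proof (rule laurents_least[OF cover_field_subring])
  note CF = subring_intros[OF cover_field_subring]
  note base_inv = inverse_frac_field[OF base_algebra_subring]
  have u: "u_var powi n \<in> cover_field" for n
    using cover_field_incl(1) u_var_frac base_inv[OF u_var_frac] by (auto simp: power_int_def intro!: CF(9))
  have "s = v ^ d' * u_var powi (- int b')"
    by (simp add: s_eq divide_inverse power_int_minus)
  hence "s \<in> cover_field" using CF(4)[OF CF(9)[OF cover_field_incl(2)] u] by metis
  hence radical: "radical_field \<subseteq> cover_field"
    unfolding radical_field_def using const_emb_frac cover_field_incl(1)
    by (intro polys_at_least[OF range_h_subring cover_field_subring]) auto
  have "v * (v ^ (d' - 1) * (inverse s * u_var powi (- int b'))) = 1"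
  proof -
    have "v * v ^ (d' - 1) = v ^ d'" using d'_pos by (cases d') auto
    also have "\<dots> = s * u_var ^ b'" by (simp add: s_eq u_var_nonzero)
    finally have "v * v ^ (d' - 1) = s * u_var ^ b'" .
    hence "v * (v ^ (d' - 1) * (inverse s * u_var powi (- int b'))) =
        (s * inverse s) * (u_var ^ b' * inverse (u_var ^ b'))"
      by (simp add: power_int_minus mult.assoc[symmetric])
    thus ?thesis using s_nonzero by (simp add: u_var_nonzero)
  qed
  hence "inverse v = v ^ (d' - 1) * (inverse s * u_var powi (- int b'))" by (rule inverse_unique)
  also have "\<dots> \<in> cover_field"
    using radical radical_field_inverse[OF s_radical_field] u
    by (intro CF(4) CF(9)[OF cover_field_incl(2)]) auto
  finally have v: "v powi n \<in> cover_field" for n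
    using cover_field_incl(2) by (auto simp: power_int_def intro!: CF(9))
  fix f n assume "f \<in> radical_field"
  thus "f * w powi n \<in> cover_field"
    using radical u v unfolding w_powi by (intro CF(4)) auto
qed

definition normalized_algebra :: "'k laurent_closure set" where
  "normalized_algebra = normalization_in base_algebra cover_field"

text \<open>The field \<open>L\<close> lies in the fractions of \<open>laurents\<close>, and an
  element integral over \<open>A\<close> is integral over \<open>laurents\<close>, which is
  integrally closed.\<close>

lemma normalized_algebra_iff:
  "x \<in> normalized_algebra \<longleftrightarrow> x \<in> laurents \<and> integral_over base_algebra x"
proof -
  have "x \<in> laurents" if "x \<in> cover_field" "integral_over base_algebra x"
  proof (rule laurents_integrally_closed)
    show "x \<in> frac_field laurents" using that(1) cover_field_frac by blast
    show "integral_over laurents x"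
      by (rule integral_over_mono[OF _ that(2)]) (auto simp: base_algebra_def laurent_emb_laurents)
  qed
  thus ?thesis
    using laurents_cover_field by (auto simp: normalized_algebra_def normalization_in_eq)
qed

lemma dpd_algebra_laurent_over: "dpd_algebra ext Dp' Dm' \<subseteq> laurent_over radical_field"
  using dpd_coeffs_radical by (auto simp: dpd_algebra_def laurent_over_def)

lemma normalized_algebra_eq: "normalized_algebra = laurent_eval w ` dpd_algebra ext Dp' Dm'"
proof (intro equalityI subsetI)
  fix x assume "x \<in> normalized_algebra"
  then obtain p where p: "p \<in> laurent_over radical_field" "x = laurent_eval w p" "integral_over base_algebra x"
    by (auto simp: normalized_algebra_iff laurents_def)
  hence "p \<in> dpd_algebra ext Dp' Dm'" by (intro integral_imp_dpd_coeffs) auto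
  thus "x \<in> laurent_eval w ` dpd_algebra ext Dp' Dm'" using p(2) by blast
next
  fix x assume "x \<in> laurent_eval w ` dpd_algebra ext Dp' Dm'"
  then obtain p where p: "p \<in> dpd_algebra ext Dp' Dm'" "x = laurent_eval w p" by blast
  have "x \<in> {x. integral_over base_algebra x}"
    unfolding p(2) laurent_eval_def
    using p(1) dpd_coeffs_imp_integral by (intro subring_sum[OF base_closure]) (auto simp: dpd_algebra_def)
  thus "x \<in> normalized_algebra"
    using p dpd_algebra_laurent_over unfolding normalized_algebra_iff laurents_def by blast
qed

text \<open>The monomials of degree \<open>n / d'\<close> are the powers of \<open>s\<close> times
  \<open>w powi n\<close>, and the powers of \<open>s\<close> span \<open>K\<close> over
  \<open>K\<^sub>0\<close>.\<close>

lemma homogeneous_of_degree_eq: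
  "homogeneous_of_degree v (k * b') (k * d') (of_int n / of_nat d') = {f * w powi n | f. f \<in> radical_field}"
proof -
  interpret m: Modules.module "\<lambda>c x. const_emb c * (x :: 'k laurent_closure)"
    by unfold_locales (simp_all add: h.hom_add h.hom_mult distrib_left distrib_right mult.assoc)
  have deg: "of_int i + of_int j * of_nat (k * b') / of_nat (k * d') = (of_int n / of_nat d' :: rat) \<longleftrightarrow>
      int d' * i + int b' * j = n" for i j
  proof -
    have "of_nat (k * b') / of_nat (k * d') = (of_nat b' / of_nat d' :: rat)" using k_pos by simp
    hence "of_int i + of_int j * of_nat (k * b') / of_nat (k * d') =
        of_int i + rat_of_int j * (of_nat b' / of_nat d')" by (simp only: times_divide_eq_right[symmetric])
    also have "\<dots> = rat_of_int (int d' * i + int b' * j) / of_nat d'"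
      using d'_pos by (simp add: add_divide_distrib mult.commute)
    finally have "of_int i + of_int j * of_nat (k * b') / of_nat (k * d') =
      rat_of_int (int d' * i + int b' * j) / of_nat d'" .
    thus ?thesis using d'_pos by (simp only: divide_cancel_right of_int_eq_iff) simp
  qed
  define W where "W = {f * w powi n | f. f \<in> radical_field}"
  have sub: "m.subspace W"
    unfolding m.subspace_def
  proof (intro conjI ballI allI)
    have "0 * w powi n \<in> W" unfolding W_def using radical_intros(1) by blast
    thus "0 \<in> W" by simp
  next
    fix x y assume "x \<in> W" "y \<in> W"
    then obtain f g where "x = f * w powi n" "y = g * w powi n" "f \<in> radical_field" "g \<in> radical_field"
      by (auto simp: W_def)
    moreover from this have "x + y = (f + g) * w powi n" by (simp add: distrib_right)
    ultimately show "x + y \<in> W" using radical_intros(3) unfolding W_def by blast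
  next
    fix c x assume "x \<in> W"
    then obtain f where "x = f * w powi n" "f \<in> radical_field" by (auto simp: W_def)
    moreover from this have "const_emb c * x = (const_emb c * f) * w powi n" by (simp add: mult.assoc)
    ultimately show "const_emb c * x \<in> W"
      using radical_intros(4)[OF range_h_radical_field] unfolding W_def by blast
  qed
  define B where "B = {u_var powi i * v powi j | i j. int d' * i + int b' * j = n}"
  have "B \<subseteq> W"
    using monomial_eq s_powi_radical by (auto simp: B_def W_def)
  hence "m.span B \<subseteq> W" using sub by (rule m.span_minimal)
  moreover have "W \<subseteq> m.span B"
  proof
    fix x assume "x \<in> W"
    then obtain f where f: "x = f * w powi n" "f \<in> radical_field" by (auto simp: W_def)
    obtain F where F: "degree F < rdeg" "f = ev F s" by (rule radical_fieldE[OF f(2)])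
    have "s ^ a * w powi n \<in> B" for a :: nat
    proof -
      \<comment> \<open>The exponents come from inverting the substitution of
        \<open>monomial_eq\<close>.\<close>
      define j where "j = int d' * int a + \<beta> * n"
      define i where "i = \<gamma> * n - int b' * int a"
      have "\<gamma> * j - \<beta> * i = (\<beta> * int b' + \<gamma> * int d') * int a"
        by (simp add: i_def j_def algebra_simps)
      moreover have deg: "int d' * i + int b' * j = (\<beta> * int b' + \<gamma> * int d') * n"
        by (simp add: i_def j_def algebra_simps)
      ultimately have "s ^ a * w powi n = u_var powi i * v powi j"
        using monomial_eq[of i j] by (simp add: bezout)
      thus ?thesis using deg unfolding B_def by (auto simp: bezout)
    qed
    hence "(\<Sum>i<rdeg. const_emb (coeff F i) * (s ^ i * w powi n)) \<in> m.span B"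
      by (intro m.span_sum m.span_scale m.span_base)
    thus "x \<in> m.span B"
      unfolding f(1) F(2) ev_altdef[OF F(1)] by (simp add: sum_distrib_right mult.assoc)
  qed
  ultimately show ?thesis
    unfolding homogeneous_of_degree_def deg B_def[symmetric] W_def[symmetric] by blast
qed

lemma dpd_coeffs_iff_integral:
  assumes "f \<in> radical_field"
  shows "f \<in> dpd_coeffs ext Dp' Dm' n \<longleftrightarrow> integral_over base_algebra (f * w powi n)"
proof
  assume "integral_over base_algebra (f * w powi n)"
  hence "Poly_Mapping.single n f \<in> dpd_algebra ext Dp' Dm'"
    using assms by (intro integral_imp_dpd_coeffs laurent_over_single[OF radical_field_subring]) auto
  hence "Poly_Mapping.lookup (Poly_Mapping.single n f) n \<in> dpd_coeffs ext Dp' Dm' n"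
    unfolding dpd_algebra_def by blast
  thus "f \<in> dpd_coeffs ext Dp' Dm' n" by simp
qed (rule dpd_coeffs_imp_integral)

lemma degree_part_eq:
  "degree_part normalized_algebra v (k * b') (k * d') (of_int n / of_nat d') =
   {f * w powi n | f. f \<in> dpd_coeffs ext Dp' Dm' n}"
  unfolding degree_part_def homogeneous_of_degree_eq
proof (intro equalityI subsetI)
  fix x assume "x \<in> normalized_algebra \<inter> {f * w powi n | f. f \<in> radical_field}"
  then obtain f where f: "x = f * w powi n" "f \<in> radical_field" "integral_over base_algebra x"
    by (auto simp: normalized_algebra_iff)
  hence "f \<in> dpd_coeffs ext Dp' Dm' n" using dpd_coeffs_iff_integral by simp
  thus "x \<in> {f * w powi n | f. f \<in> dpd_coeffs ext Dp' Dm' n}" using f(1) by blast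
next
  fix x assume "x \<in> {f * w powi n | f. f \<in> dpd_coeffs ext Dp' Dm' n}"
  then obtain f where f: "x = f * w powi n" "f \<in> dpd_coeffs ext Dp' Dm' n" by blast
  have fr: "f \<in> radical_field" by (rule dpd_coeffs_radical[OF f(2)])
  hence "x \<in> normalized_algebra"
    unfolding f(1) normalized_algebra_iff using laurents_monomial dpd_coeffs_imp_integral[OF f(2)] by blast
  thus "x \<in> normalized_algebra \<inter> {f * w powi n | f. f \<in> radical_field}" using f(1) fr by blast
qed

lemma dpd_coeffs_0: "dpd_coeffs ext Dp' Dm' 0 = ext"
proof (intro equalityI subsetI)
  fix f assume "f \<in> dpd_coeffs ext Dp' Dm' 0"
  hence "f \<in> frac_field ext" "f \<noteq> 0 \<Longrightarrow> \<forall>Q. is_maximal ext Q \<longrightarrow> 0 \<le> ord_at ext Q f"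
    by (auto simp: dpd_coeffs_def B.global_sections_iff)
  thus "f \<in> ext" using B.in_R_if_ord_ge_0 ext_intros(1) by blast
next
  fix f assume "f \<in> ext"
  thus "f \<in> dpd_coeffs ext Dp' Dm' 0"
    using B.ord_R_ge_0 B0.frac_field_incl by (auto simp: dpd_coeffs_def B.global_sections_iff)
qed

section \<open>The curve and the divisors upstairs\<close>

lemma finite_pullback:
  assumes "qdivisor R D"
  shows "finite {Q. pullback_divisor const_emb R ext D Q \<noteq> 0}"
proof -
  have D: "finite {P. D P \<noteq> 0}" "{P. D P \<noteq> 0} \<subseteq> closed_points R"
    using assms by (auto simp: qdivisor_def)
  have "finite (\<Union>P\<in>{P. D P \<noteq> 0}. {Q. is_maximal ext Q \<and> contract Q = P})"
    using D closed_points_iff[OF A.subring] by (intro finite_UN_I finite_fibre) auto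
  moreover have "{Q. pullback_divisor const_emb R ext D Q \<noteq> 0} \<subseteq>
      (\<Union>P\<in>{P. D P \<noteq> 0}. {Q. is_maximal ext Q \<and> contract Q = P})"
    by (auto simp: pullback_divisor_def closed_points_iff[OF ext_subring] contract_def split: if_splits)
  ultimately show ?thesis by (rule finite_subset[rotated])
qed

lemma finite_principal: "finite {Q. principal_divisor ext s Q \<noteq> 0}"
proof (rule finite_subset[OF _ B.finite_ord_nonzero[OF s_frac_ext s_nonzero]])
  show "{Q. principal_divisor ext s Q \<noteq> 0} \<subseteq> {Q. is_maximal ext Q \<and> ord_at ext Q s \<noteq> 0}"
    by (auto simp: principal_divisor_def closed_points_iff[OF ext_subring] split: if_splits)
qed

lemma qdivisor_Dp': "qdivisor ext Dp'" and qdivisor_Dm': "qdivisor ext Dm'"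
proof -
  have "{Q. Dp' Q \<noteq> 0} \<subseteq> {Q. pullback_divisor const_emb R ext Dp Q \<noteq> 0} \<union> {Q. principal_divisor ext s Q \<noteq> 0}"
    "{Q. Dm' Q \<noteq> 0} \<subseteq> {Q. pullback_divisor const_emb R ext Dm Q \<noteq> 0} \<union> {Q. principal_divisor ext s Q \<noteq> 0}"
    by (auto simp: Dp'_def Dm'_def)
  hence "finite {Q. Dp' Q \<noteq> 0}" "finite {Q. Dm' Q \<noteq> 0}"
    using finite_pullback[OF Dp] finite_pullback[OF Dm] finite_principal by (auto intro: finite_subset)
  thus "qdivisor ext Dp'" "qdivisor ext Dm'"
    by (auto simp: qdivisor_def Dp'_def Dm'_def pullback_divisor_def principal_divisor_def split: if_splits)
qed

lemma smooth_ext: "smooth_affine_curve (const_emb \<circ> \<iota>) ext"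
  unfolding smooth_affine_curve_def
proof (intro conjI allI impI ballI)
  show "const_emb \<circ> \<iota> \<in> Ring.ring_hom ring_of_type_algebra ring_of_type_algebra"
    by (auto simp: Ring.ring_hom_def ring_of_type_algebra_def hom_distribs)
  show "\<exists>T. finite T \<and> ext = generate_ring ring_of_type_algebra (range (const_emb \<circ> \<iota>) \<union> T)"
    by (rule ext_generated)
  show "\<not> maximalideal {0} (ring_on ext)"
    using zero_not_maximal maximalideal_ring_on[OF ext_subring] by blast
next
  fix Q assume Q: "primeideal Q (ring_on ext)" "Q \<noteq> {0}"
  hence "is_prime ext Q" using primeideal_ring_on[OF ext_subring] by blast
  moreover from this have "0 \<in> Q" using is_idealD(2) by (auto simp: is_prime_def)
  then obtain x where "x \<in> Q" "x \<noteq> 0" using Q(2) by blast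
  ultimately show "maximalideal Q (ring_on ext)"
    using ext_prime_maximal maximalideal_ring_on[OF ext_subring] by blast
next
  fix Q assume "Q \<in> closed_points ext"
  thus "\<exists>\<pi>. uniformizer ext Q \<pi>"
    using B.uniformizer_exists closed_points_iff[OF ext_subring] by blast
qed

lemma laurent_eval_ring_iso:
  "laurent_eval w \<in> ring_iso (ring_on (dpd_algebra ext Dp' Dm')) (ring_on normalized_algebra)"
  unfolding ring_iso_def Ring.ring_hom_def
proof (intro CollectI conjI)
  have "inj_on (laurent_eval w) (dpd_algebra ext Dp' Dm')"
    using laurent_eval_inj dpd_algebra_laurent_over by (intro inj_onI) blast
  thus "bij_betw (laurent_eval w) (carrier (ring_on (dpd_algebra ext Dp' Dm'))) (carrier (ring_on normalized_algebra))"
    by (simp add: bij_betw_def normalized_algebra_eq)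
qed (auto simp: ring_of_type_algebra_def normalized_algebra_eq laurent_eval_add laurent_eval_mult[OF w_nonzero])

end

section \<open>From smooth curves to the working hypotheses\<close>

lemma curve_extensionI:
  fixes \<iota> :: "complex \<Rightarrow> 'k::field"
  assumes curve: "smooth_affine_curve \<iota> A0" and frac: "frac_field A0 = UNIV"
    and "t \<noteq> 0" "k > 0" "s ^ k = const_emb t"
  shows "\<exists>S. curve_extension const_emb \<iota> s t k A0 S"
proof -
  have hom: "\<iota> \<in> Ring.ring_hom ring_of_type_algebra ring_of_type_algebra"
    using curve by (simp add: smooth_affine_curve_def)
  have \<iota>: "\<iota> (x * y) = \<iota> x * \<iota> y" "\<iota> (x + y) = \<iota> x + \<iota> y" "\<iota> 1 = 1" for x y
    using hom by (auto simp: Ring.ring_hom_def ring_of_type_algebra_def)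
  interpret \<iota>: field_hom \<iota>
    by unfold_locales (use \<iota> in \<open>auto, metis add_cancel_right_left\<close>)
  interpret c: field_hom "const_emb :: 'k \<Rightarrow> 'k laurent_closure" by (rule const_emb_field_hom)
  obtain S where S: "finite S" "A0 = generate_ring ring_of_type_algebra (range \<iota> \<union> S)"
    using curve by (auto simp: smooth_affine_curve_def)
  have sub: "is_subring A0" unfolding S(2) by (rule generate_ring_subring)
  have F: "is_subring (range \<iota>)"
    unfolding is_subring_def by (auto simp flip: \<iota>.hom_minus \<iota>.hom_mult)
  have "inverse x \<in> range \<iota>" if "x \<in> range \<iota>" for x
    using that by (auto simp flip: \<iota>.hom_inverse)
  hence noeth: "noetherian A0" unfolding S(2) by (rule noetherian_finitely_generated[OF F _ S(1)])
  have nz: "\<exists>x\<in>P. x \<noteq> 0" if P: "is_maximal A0 P" for P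
  proof (rule ccontr)
    assume "\<not> (\<exists>x\<in>P. x \<noteq> 0)"
    moreover have "0 \<in> P" using P is_idealD(2) by (auto simp: is_maximal_def)
    ultimately have "P = {0}" by blast
    thus False using P curve maximalideal_ring_on[OF sub] by (auto simp: smooth_affine_curve_def)
  qed
  have pm: "is_maximal A0 P" if "is_prime A0 P" "x \<in> P" "x \<noteq> 0" for P x
    using that curve maximalideal_ring_on[OF sub] primeideal_ring_on[OF sub]
    unfolding smooth_affine_curve_def by blast
  have un: "\<exists>\<pi>. uniformizer A0 P \<pi>" if "is_maximal A0 P" for P
    using that curve closed_points_iff[OF sub] unfolding smooth_affine_curve_def by blast
  have "curve_extension const_emb \<iota> s t k A0 S"
    by unfold_locales (use assms sub noeth nz pm un S in auto)
  thus ?thesis by blast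
qed

theorem proposition4p12:
  fixes \<iota> :: "complex \<Rightarrow> 'k::field"
    and A0 :: "'k set"
    and Dp Dm :: "'k set \<Rightarrow> rat"
    and t :: 'k
    and b d k :: nat
    and \<beta> :: int
    and v s :: "'k laurent_closure"
    and A :: "(int \<Rightarrow>\<^sub>0 'k) set"
    and L A' A0' :: "'k laurent_closure set"
    and Dp' Dm' :: "'k laurent_closure set \<Rightarrow> rat"
  assumes "smooth_affine_curve \<iota> A0"
    and "frac_field A0 = UNIV"
    and "qdivisor A0 Dp" and "qdivisor A0 Dm"
    and "\<And>P. Dp P + Dm P \<le> 0"
    and "A = dpd_algebra A0 Dp Dm"
    and "t \<noteq> 0" and "d \<ge> 1"
    and "v ^ d = const_emb t * u_var ^ b"
    and "L = adjoin (frac_field (laurent_emb ` A)) v"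
    and "A' = normalization_in (laurent_emb ` A) L"
    and "A0' = degree_part A' v b d 0"
    and "k = gcd b d"
    and "s = v ^ (d div k) / u_var ^ (b div k)"
    and "[\<beta> * int b = int k] (mod int d)"
    and "Dp' = (\<lambda>Q. of_nat k / of_nat d *
           (pullback_divisor const_emb A0 A0' Dp Q + of_int \<beta> * principal_divisor A0' s Q))"
    and "Dm' = (\<lambda>Q. of_nat k / of_nat d *
           (pullback_divisor const_emb A0 A0' Dm Q - of_int \<beta> * principal_divisor A0' s Q))"
  shows "A0' = normalization_in (const_emb ` A0) (adjoin (range const_emb) s) \<and>
         smooth_affine_curve (const_emb \<circ> \<iota>) A0' \<and>
         qdivisor A0' Dp' \<and> qdivisor A0' Dm' \<and> (\<forall>Q. Dp' Q + Dm' Q \<le> 0) \<and>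
         (\<exists>\<phi>. \<phi> \<in> ring_iso (ring_on (dpd_algebra A0' Dp' Dm')) (ring_on A') \<and>
              (\<forall>a\<in>A0'. \<phi> (Poly_Mapping.single 0 a) = a) \<and>
              (\<forall>n. \<phi> ` dpd_part A0' Dp' Dm' n =
                   degree_part A' v b d (of_int n * of_nat k / of_nat d)))"
proof -
  define d' where "d' = d div k"
  define b' where "b' = b div k"
  have k_pos: "k > 0" using assms(8,13) by auto
  have d: "d = k * d'" and b: "b = k * b'" using assms(13) by (auto simp: d'_def b'_def)
  have d'_pos: "d' > 0" using assms(8) d by (cases d') auto
  \<comment> \<open>Dividing \<open>\<beta> b - k = d m\<close> by \<open>k\<close> gives the Bezout
    relation, with \<open>- m\<close> in the role of \<gamma>.\<close>
  obtain m where "\<beta> * int b - int k = int d * m"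
    using assms(15) by (auto simp: cong_iff_dvd_diff dvd_def)
  hence "int k * (\<beta> * int b' + (- m) * int d') = int k * 1" by (simp add: d b algebra_simps)
  hence bezout: "\<beta> * int b' + (- m) * int d' = 1" using k_pos by simp
  have v0: "v \<noteq> 0"
  proof
    assume "v = 0"
    hence "const_emb t * u_var ^ b = 0" using assms(8,9) by (simp add: power_0_left)
    moreover have "const_emb t \<noteq> 0"
      using assms(7) by (simp add: const_emb_def laurent_emb_eq_0_iff) (metis lookup_single_eq lookup_zero)
    ultimately show False by (simp add: u_var_nonzero)
  qed
  have "s ^ k = v ^ d / u_var ^ b"
    unfolding assms(14) d'_def[symmetric] b'_def[symmetric]
    by (simp add: power_divide d b mult.commute flip: power_mult)
  hence s_power: "s ^ k = const_emb t" by (simp add: assms(9) u_var_nonzero)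
  obtain S where "curve_extension const_emb \<iota> s t k A0 S"
    using curve_extensionI[OF assms(1,2,7) k_pos s_power] by blast
  then interpret curve_extension const_emb \<iota> s t k A0 S .
  interpret C: cyclic_cover \<iota> s t k A0 S v d' b' \<beta> "- m" Dp Dm
    by unfold_locales (use d'_pos bezout v0 assms(3-5,14) in \<open>auto simp: d'_def b'_def\<close>)
  have A': "A' = C.normalized_algebra"
    by (simp add: assms(6,10,11) C.normalized_algebra_def C.cover_field_def C.base_algebra_def)
  \<comment> \<open>The divisors in the statement refer to \<open>A0'\<close>, so it has to be
    identified with \<open>ext\<close> before they can be compared with those of the locale.\<close>
  have "A0' = {f * C.w powi 0 | f. f \<in> dpd_coeffs ext C.Dp' C.Dm' 0}"
    using C.degree_part_eq[of 0] by (simp add: assms(12) A' b d)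
  hence A0': "A0' = ext" using C.dpd_coeffs_0 by simp
  have kd: "of_nat k / of_nat d = (1 / of_nat d' :: rat)" using k_pos by (simp add: d)
  have Dp': "Dp' = C.Dp'" and Dm': "Dm' = C.Dm'"
    by (auto simp: assms(16,17) kd A0' C.Dp'_def C.Dm'_def)
  have "ext = normalization_in (const_emb ` A0) (adjoin (range const_emb) s)"
    by (simp add: ext_def normalization_in_eq adjoin_eq_polys_at[OF range_h_subring] radical_field_def)
  moreover have "laurent_eval C.w ` dpd_part ext C.Dp' C.Dm' n =
      degree_part C.normalized_algebra v b d (of_int n * of_nat k / of_nat d)" for n
  proof -
    have "of_int n * of_nat k / of_nat d = (of_int n / of_nat d' :: rat)" using k_pos by (simp add: d)
    thus ?thesis
      using C.degree_part_eq[of n] by (auto simp: dpd_part_def b d image_image)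
  qed
  ultimately show ?thesis
    unfolding A0' Dp' Dm' A'
    using C.smooth_ext C.qdivisor_Dp' C.qdivisor_Dm' C.D'_le_all C.laurent_eval_ring_iso
    by (intro conjI allI exI[of _ "laurent_eval C.w"] ballI) auto
qed

end
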